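(* Let $f$ be real analytic on a neighborhood of $0\in\mathbb R^J$ with $f(0)=0$, $\nabla f(0)=0$, $\nabla^2f(0)=0$, and expansion $f=\sum_{j\ge p}f_j$ where $f_j$ is a homogeneous polynomial of degree $j$, $p\ge3$ an integer and $f_p\not\equiv0$. Let $\hat f_p=f_p|_{\mathbb S^{J-1}}$, $\mathbf C=\{\theta\in\mathbb S^{J-1}:\nabla_{\mathbb S^{J-1}}\hat f_p(\theta)=0\}$ and $\mathbf D=\hat f_p(\mathbf C)$. Let $z:[0,\infty)\to\mathbb R^J\setminus\{0\}$ be a $C^1$ curve satisfying $z'(t)+\nabla f(z(t))=G(t)$, where $G$ is continuous with $|G(t)|\le C|z(t)|^{p-\varepsilon}$ for constants $\varepsilon\in(0,1/2)$ and $C<\infty$, and assume $\lim_{t\to\infty}z(t)=0$. Then $|z(t)|^{-p}f(z(t))$ converges as $t\to\infty$ to some $\alpha_0\in\mathbf D$ with $\alpha_0\ge0$, and: (1) if $\alpha_0>0$, then $z(t)/|z(t)|$ converges to some $\theta^*\in\mathbf C$ with $\hat f_p(\theta^* )=\alpha_0$, and $\lim_{t\to\infty}t^{1/(p-2)}|z(t)|=(\alpha_0p(p-2))^{-1/(p-2)}$; (2) if $\alpha_0=0$, then $\lim_{t\to\infty}\operatorname{dist}(z(t)/|z(t)|,\mathbf C_0)=0$ for some connected component $\mathbf C_0$ of $\mathbf C\cap\{\theta:\hat f_p(\theta)=0\}$, and $\lim_{t\to\infty}t^{1/(p-2)}|z(t)|=\infty$.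
   Context: $\nabla_{\mathbb S^{J-1}}$ denotes the gradient on the round unit sphere $\mathbb S^{J-1}\subset\mathbb R^J$; $\operatorname{dist}$ is the distance on $\mathbb S^{J-1}$. *)

theory Defs
  imports "HOL-Analysis.Analysis"
begin

definition mdeg :: "('n::finite \<Rightarrow> nat) \<Rightarrow> nat" where
  "mdeg \<alpha> = (\<Sum>i\<in>UNIV. \<alpha> i)"

definition monom_vec :: "('n::finite \<Rightarrow> nat) \<Rightarrow> real^'n \<Rightarrow> real" where
  "monom_vec \<alpha> x = (\<Prod>i\<in>UNIV. (x $ i) ^ (\<alpha> i))"

definition hom_part :: "(('n::finite \<Rightarrow> nat) \<Rightarrow> real) \<Rightarrow> nat \<Rightarrow> real^'n \<Rightarrow> real" where
  "hom_part c j x = (\<Sum>\<alpha>\<in>{\<alpha>. mdeg \<alpha> = j}. c \<alpha> * monom_vec \<alpha> x)"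

definition real_analytic_on :: "(real^'n::finite \<Rightarrow> real) \<Rightarrow> (real^'n) set \<Rightarrow> bool" where
  "real_analytic_on f U \<longleftrightarrow>
     (\<forall>a\<in>U. \<exists>r>0. \<exists>c. \<forall>x\<in>ball a r.
        (\<lambda>\<alpha>. norm (c \<alpha> * monom_vec \<alpha> (x - a))) summable_on UNIV \<and>
        f x = (\<Sum>\<^sub>\<infinity>\<alpha>. c \<alpha> * monom_vec \<alpha> (x - a)))"

definition grad :: "(real^'n::finite \<Rightarrow> real) \<Rightarrow> real^'n \<Rightarrow> real^'n" where
  "grad f x = (THE g. (f has_derivative (\<lambda>h. g \<bullet> h)) (at x))"

text \<open>Gradient on the round unit sphere of the restriction of f: the tangential
  projection of the Euclidean gradient at the point \<theta> of the sphere.\<close>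

definition sphere_grad :: "(real^'n::finite \<Rightarrow> real) \<Rightarrow> real^'n \<Rightarrow> real^'n" where
  "sphere_grad f \<theta> = grad f \<theta> - (grad f \<theta> \<bullet> \<theta>) *\<^sub>R \<theta>"

definition sphere_crit :: "(real^'n::finite \<Rightarrow> real) \<Rightarrow> (real^'n) set" where
  "sphere_crit f = {\<theta> \<in> sphere 0 1. sphere_grad f \<theta> = 0}"

definition sphere_dist :: "real^'n::finite \<Rightarrow> real^'n \<Rightarrow> real" where
  "sphere_dist u v = arccos (u \<bullet> v)"

definition sphere_setdist :: "real^'n::finite \<Rightarrow> (real^'n) set \<Rightarrow> real" where
  "sphere_setdist u A = (INF a\<in>A. sphere_dist u a)"

end

theory Submission
  imports Defs "HOL-Computational_Algebra.Polynomial"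
begin

text \<open>In polar coordinates \<open>z = r \<theta>\<close>, and in the time \<open>s\<close> with \<open>ds = r\<^sup>p\<^sup>-\<^sup>2 dt\<close>, the direction \<open>\<theta>\<close> follows the negative gradient flow of
  the leading form \<open>g\<close> on the sphere, up to an error \<open>O(r\<^sup>1\<^sup>-\<^sup>\<epsilon>)\<close>, while \<open>ln r\<close> decreases at rate \<open>p g(\<theta>)\<close> up to the same error.
  As critical values of \<open>g\<close> are isolated, \<open>g(\<theta>)\<close> converges to a critical value \<open>\<alpha>\<close>, and \<open>\<alpha> \<ge> 0\<close> because \<open>r\<close> tends to \<open>0\<close>.
  If \<open>\<alpha> > 0\<close>, then \<open>r\<close> decays exponentially in \<open>s\<close>, and a Kurdyka-Lojasiewicz inequality bounds the length of \<open>\<theta>\<close>.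
  If \<open>\<alpha> = 0\<close>, the limit set of \<open>\<theta>\<close> is connected and consists of critical points.

  The Kurdyka-Lojasiewicz inequality, in an integral form without exponent, and the isolation of critical values come from
  Tarski-Seidenberg elimination (in the style of Cohen and Hormander) and the monotonicity of semialgebraic functions of one variable.\<close>

section \<open>Quantifier elimination\<close>

text \<open>Only the leading form carries the geometry. The higher terms of \<open>f\<close> change
  the gradient by \<open>O(r^p)\<close>, which relative to the leading size \<open>r^(p-1)\<close>
  is an error of the same kind as the forcing. The function to desingularize is thus a polynomial on
  a compact algebraic set, and real elimination theory takes the place of the analytic Lojasiewicz
  inequality. The obstacle is the error near critical directions: where the tangential gradient is
  smaller than the error, the leading form need not decrease, and the inequality alone gives no
  bound on the length. For \<alpha> > 0 the radius decays at a definite rate, so the square of a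
  multiple of \<open>r powr \<delta>\<close> can be added to the leading form. This restores strict
  decrease, and with the multiple as a new coordinate the sum is again a polynomial to which the
  inequality applies. For \<alpha> = 0 no such rate is available, and only a component of the
  critical set is identified. No exponent is sought, because finite length needs no more than a
  bounded monotone \<psi> whose increments dominate those of the direction.\<close>

lemma strict_mono_extension:
  fixes f :: "real \<Rightarrow> real"
  assumes "finite S" "strict_mono_on S f"
  shows "\<exists>h::real\<Rightarrow>real. strict_mono h \<and> surj h \<and> (\<forall>s\<in>S. h s = f s)"
  using assms
proof (induction S rule: finite_linorder_max_induct)
  case empty
  show ?case by (intro exI[of _ id]) (auto simp: strict_mono_def)
next
  case (insert b A)
  show ?case
  proof (cases "A = {}")
    case True
    have "surj (\<lambda>y. y + (f b - b))"
      by (rule surjI[of _ "\<lambda>y. y - (f b - b)"]) simp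
    with True show ?thesis by (intro exI[of _ "\<lambda>y. y + (f b - b)"]) (auto simp: strict_mono_def)
  next
    case False
    from insert obtain h0 where h0: "strict_mono h0" "surj h0" "\<And>s. s \<in> A \<Longrightarrow> h0 s = f s"
      by (metis monotone_on_subset subset_insertI)
    define m where "m = Max A"
    have mA: "m \<in> A" and mmax: "\<And>a. a \<in> A \<Longrightarrow> a \<le> m"
      using False insert.hyps(1) by (auto simp: m_def)
    have mb: "m < b" using insert mA by auto
    then have fmb: "f m < f b" using insert.prems mA by (auto simp: strict_mono_on_def)
    \<comment> \<open>The earlier extension is kept up to \<open>m\<close>. Beyond \<open>m\<close>
      it is replaced by the line through \<open>(m, f m)\<close> and \<open>(b, f b)\<close>, whose
      positive slope keeps the map onto.\<close>
    define k where "k = (f b - f m) / (b - m)"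
    have k: "k > 0" using mb fmb by (simp add: k_def)
    define h where "h y = (if y \<le> m then h0 y else f m + k * (y - m))" for y
    have "strict_mono h"
    proof (rule strict_monoI)
      fix x y :: real assume xy: "x < y"
      have "h0 x \<le> f m" if "x \<le> m"
        using that h0(1) h0(3)[OF mA] by (metis strict_mono_less_eq)
      moreover have "k * (y - m) > 0" if "y > m" using k that by simp
      moreover have "k * (x - m) < k * (y - m)" using k xy by simp
      ultimately show "h x < h y" using xy h0(1) by (auto simp: h_def strict_mono_less)
    qed
    moreover have "surj h"
    proof (rule surjI)
      fix v
      show "h (if v \<le> f m then inv h0 v else m + (v - f m) / k) = v"
      proof (cases "v \<le> f m")
        case True
        have "h0 (inv h0 v) \<le> h0 m" using True h0 mA by (simp add: surj_f_inv_f)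
        then have "inv h0 v \<le> m" using h0(1) strict_mono_less_eq by blast
        then show ?thesis using True h0(2) by (simp add: h_def surj_f_inv_f)
      next
        case False
        then have "\<not> m + (v - f m) / k \<le> m" using k by (simp add: not_le)
        then show ?thesis using False k by (simp add: h_def del: add_le_same_cancel1)
      qed
    qed
    moreover have "\<forall>s\<in>insert b A. h s = f s"
      using h0(3) mb mmax by (auto simp: h_def k_def)
    ultimately show ?thesis by blast
  qed
qed

text \<open>The image under \<open>h\<close> of the component of \<open>- Z\<close> containing \<open>y\<close>, for \<open>y\<close> outside \<open>Z\<close>.\<close>

definition gap :: "real set \<Rightarrow> (real \<Rightarrow> real) \<Rightarrow> real \<Rightarrow> real set" where
  "gap Z h y = {u. \<forall>z\<in>Z. (z < y \<longrightarrow> h z < u) \<and> (y < z \<longrightarrow> u < h z)}"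

lemma gap_between: "u \<in> gap Z h y \<Longrightarrow> v \<in> gap Z h y \<Longrightarrow> u \<le> w \<Longrightarrow> w \<le> v \<Longrightarrow> w \<in> gap Z h y"
  by (force simp: gap_def)

lemma gap_self: "strict_mono h \<Longrightarrow> h y \<in> gap Z h y"
  by (auto simp: gap_def strict_mono_def)

text \<open>Serves a gap unbounded to the left, which has no endpoint at which a sign could be read.
  A nonconstant polynomial is unbounded near minus infinity, and being increasing there excludes
  large positive values.\<close>

lemma poly_takes_neg:
  fixes q :: "real poly"
  assumes "degree q > 0" and inc: "\<And>u. u \<le> x \<Longrightarrow> poly (pderiv q) u > 0"
  shows "\<exists>u<x. poly q u < 0"
proof -
  \<comment> \<open>Reflection turns the behaviour at minus infinity into that at plus infinity,
    which the leading coefficient governs.\<close>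
  define r where "r = pcompose q [:0, -1:]"
  have pr: "poly r u = poly q (- u)" for u by (simp add: r_def poly_pcompose)
  have dr: "degree r > 0" using assms(1) by (simp add: r_def degree_pcompose)
  have lim: "\<exists>n. \<forall>u\<ge>n. poly s u > M" if "degree s > 0" "lead_coeff s > 0" for M and s :: "real poly"
  proof -
    have "degree (s + (- [:M:])) = degree s"
      using that(1) by (intro degree_add_eq_left) simp
    then have c: "degree (s - [:M:]) = degree s" by (simp only: diff_conv_add_uminus)
    have "lead_coeff (s - [:M:]) > 0"
      using that c by (cases "degree s") (simp_all add: coeff_pCons)
    from poly_pinfty_gt_lc[OF this] obtain n where n: "\<And>u. u \<ge> n \<Longrightarrow> lead_coeff (s - [:M:]) \<le> poly (s - [:M:]) u" by blast
    have "poly s u > M" if "u \<ge> n" for u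
    proof -
      have "poly (s - [:M:]) u > 0" using n[OF that] \<open>0 < lead_coeff (s - [:M:])\<close> by linarith
      then show ?thesis by simp
    qed
    then show ?thesis by blast
  qed
  have mono: "poly q u < poly q x" if ux: "u < x" for u
  proof -
    obtain w where w: "u < w" "w < x" "poly q x - poly q u = (x - u) * poly (pderiv q) w"
      using poly_MVT[OF ux, of q] by blast
    have "(x - u) * poly (pderiv q) w > 0" using inc[of w] w ux by simp
    then show ?thesis using w by simp
  qed
  have "lead_coeff r \<noteq> 0" using dr by auto
  then consider "lead_coeff r > 0" | "lead_coeff r < 0" by linarith
  then show ?thesis
  proof cases
    case 1
    from lim[OF dr 1, of "poly q x"] obtain n where n: "\<forall>u\<ge>n. poly r u > poly q x" by blast
    define u where "u = max n (1 - x)"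
    have "poly r u > poly q x" using n by (simp add: u_def)
    then have "poly q (-u) > poly q x" using pr[of u] by simp
    moreover have "- u < x" by (auto simp: u_def)
    ultimately have False using mono[of "-u"] by simp
    then show ?thesis ..
  next
    case 2
    have "degree (-r) > 0" "lead_coeff (-r) > 0" using dr 2 by auto
    from lim[OF this, of 0] obtain n where n: "\<forall>u\<ge>n. poly (-r) u > 0" by blast
    define u where "u = max n (1 - x)"
    have "poly (-r) u > 0" using n by (simp add: u_def)
    then have "poly q (-u) < 0" using pr[of u] by simp
    moreover have "- u < x" by (auto simp: u_def)
    ultimately show ?thesis by blast
  qed
qed

text \<open>Since \<open>p\<close> increases on the gap, a negative value forces one at the left
  endpoint \<open>a\<close>, where the signs of \<open>p\<close> and \<open>q\<close> agree.
  Continuity of \<open>q\<close> carries it to points just right of \<open>h a\<close>. A gap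
  without left endpoint is served by \<open>poly_takes_neg\<close>.\<close>

lemma gap_neg_transfer_inc:
  fixes p q :: "real poly"
  assumes Z: "finite Z" and h: "strict_mono h"
    and sg: "\<And>z. z \<in> Z \<Longrightarrow> sgn (poly p z) = sgn (poly q (h z))"
    and q: "degree q > 0"
    and p': "\<And>u. u \<in> gap Z (\<lambda>x. x) y \<Longrightarrow> poly (pderiv p) u > 0"
    and q': "\<And>u. u \<in> gap Z h y \<Longrightarrow> poly (pderiv q) u > 0"
    and u: "u \<in> gap Z (\<lambda>x. x) y" "poly p u < 0"
  shows "\<exists>u'\<in>gap Z h y. poly q u' < 0"
proof (cases "\<exists>z\<in>Z. z < y")
  case False
  then have "w \<in> gap Z h y" if "w \<le> h y" for w
    using that h by (force simp: gap_def strict_mono_def)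
  then show ?thesis using poly_takes_neg[OF q, of "h y"] q' less_imp_le by blast
next
  case True
  define a where "a = Max {z\<in>Z. z < y}"
  have fin: "finite {z\<in>Z. z < y}" "{z\<in>Z. z < y} \<noteq> {}" using Z True by auto
  have a: "a \<in> Z" "a < y" using Max_in[OF fin] by (auto simp: a_def)
  have amax: "z \<le> a" if "z \<in> Z" "z < y" for z using that fin by (simp add: a_def)
  have au: "a < u" using u a by (auto simp: gap_def)
  have "poly p a < 0"
  proof -
    obtain x where x: "a < x" "x < u" "poly p u - poly p a = (u - a) * poly (pderiv p) x"
      using poly_MVT[OF au] by blast
    have "x \<in> gap Z (\<lambda>x. x) y"
      using u(1) amax x by (force simp: gap_def)
    then have "(u - a) * poly (pderiv p) x > 0" using p' au by simp
    then show ?thesis using u(2) x(3) by simp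
  qed
  then have qa: "poly q (h a) < 0" using sg[OF a(1)] by (metis sgn_1_neg)
  have "\<forall>\<^sub>F v in at_right (h a). poly q v < 0"
    using qa by (intro order_tendstoD(2)[of "poly q" "poly q (h a)"]) (auto intro!: tendsto_intros)
  moreover have "\<forall>\<^sub>F v in at_right (h a). v \<in> {h a<..<h y}"
    using h a by (intro eventually_at_right_real) (simp add: strict_mono_def)
  ultimately have "\<forall>\<^sub>F v in at_right (h a). poly q v < 0 \<and> v \<in> {h a<..<h y}"
    by eventually_elim auto
  from eventually_happens'[OF _ this] obtain v where v: "poly q v < 0" "h a < v" "v < h y"
    by auto
  have "v \<in> gap Z h y"
    unfolding gap_def
  proof (intro CollectI ballI conjI impI)
    fix z assume z: "z \<in> Z"
    show "h z < v" if "z < y"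
      using amax[OF z that] v(2) strict_mono_less_eq[OF h, of z a] by linarith
    show "v < h z" if "y < z"
      using v(3) strict_mono_less[OF h, of y z] that by linarith
  qed
  with v show ?thesis by blast
qed

lemma poly_sgn_const_between:
  fixes p :: "real poly"
  assumes "\<And>w. min u v \<le> w \<Longrightarrow> w \<le> max u v \<Longrightarrow> poly p w \<noteq> 0"
  shows "sgn (poly p u) = sgn (poly p v)"
proof (rule ccontr)
  have *: False if "u' < v'" "sgn (poly p u') \<noteq> sgn (poly p v')" "\<And>w. u' \<le> w \<Longrightarrow> w \<le> v' \<Longrightarrow> poly p w \<noteq> 0" for u' v'
  proof -
    have "poly p u' \<noteq> 0" "poly p v' \<noteq> 0" using that by auto
    with that(2) have "poly p u' * poly p v' < 0"
      by (auto simp: sgn_if mult_less_0_iff split: if_splits)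
    from poly_IVT[OF that(1) this] that show False by (meson less_imp_le)
  qed
  assume ne: "sgn (poly p u) \<noteq> sgn (poly p v)"
  then consider "u < v" | "v < u" by fastforce
  then show False using *[of u v] *[of v u] ne assms by cases auto
qed

text \<open>The derivatives have no zero on the gap, hence one common sign there. The decreasing
  case becomes the increasing one when both lines are reflected.\<close>

lemma gap_neg_transfer:
  fixes p q :: "real poly"
  assumes Z: "finite Z" and h: "strict_mono h"
    and sg: "\<And>z. z \<in> Z \<Longrightarrow> sgn (poly p z) = sgn (poly q (h z))"
    and q: "degree q > 0"
    and rp: "\<And>u. poly (pderiv p) u = 0 \<Longrightarrow> u \<in> Z"
    and rq: "\<And>u. poly (pderiv q) u = 0 \<Longrightarrow> u \<in> h ` Z"
    and y: "y \<notin> Z" "sgn (poly (pderiv p) y) = sgn (poly (pderiv q) (h y))"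
    and u: "u \<in> gap Z (\<lambda>x. x) y" "poly p u < 0"
  shows "\<exists>u'\<in>gap Z h y. poly q u' < 0"
proof -
  have dp: "poly (pderiv p) y \<noteq> 0" using rp y by blast
  have gp: "sgn (poly (pderiv p) v) = sgn (poly (pderiv p) y)" if "v \<in> gap Z (\<lambda>x. x) y" for v
  proof (rule poly_sgn_const_between)
    fix w assume w: "min v y \<le> w" "w \<le> max v y"
    have "w \<notin> Z" using w that y by (force simp: gap_def min_def max_def split: if_splits)
    then show "poly (pderiv p) w \<noteq> 0" using rp by blast
  qed
  have gq: "sgn (poly (pderiv q) v) = sgn (poly (pderiv q) (h y))" if "v \<in> gap Z h y" for v
  proof (rule poly_sgn_const_between)
    fix w assume w: "min v (h y) \<le> w" "w \<le> max v (h y)"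
    have "w \<in> gap Z h y" using gap_between[OF that gap_self[OF h]] gap_between[OF gap_self[OF h] that] w
      by (auto simp: min_def max_def split: if_splits)
    then have "w \<notin> h ` Z" using y by (force simp: gap_def)
    then show "poly (pderiv q) w \<noteq> 0" using rq by blast
  qed
  consider "poly (pderiv p) y > 0" | "poly (pderiv p) y < 0" using dp by linarith
  then show ?thesis
  proof cases
    case 1
    then have "sgn (poly (pderiv p) y) = 1" by simp
    with gp gq y(2) show ?thesis
      by (intro gap_neg_transfer_inc[OF Z h sg q _ _ u]) (metis sgn_1_pos)+
  next
    case 2
    then have m1: "sgn (poly (pderiv p) y) = -1" by simp
    define pm where "pm = pcompose p [:0, -1:]"
    define qm where "qm = pcompose q [:0, -1:]"
    define hm where "hm v = - h (- v)" for v
    have g1: "v \<in> gap (uminus ` Z) (\<lambda>x. x) (- y) \<longleftrightarrow> - v \<in> gap Z (\<lambda>x. x) y" for v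
      by (force simp: gap_def)
    have g2: "v \<in> gap (uminus ` Z) hm (- y) \<longleftrightarrow> - v \<in> gap Z h y" for v
      by (force simp: gap_def hm_def)
    have d: "poly (pderiv pm) v = - poly (pderiv p) (-v)" "poly (pderiv qm) v = - poly (pderiv q) (-v)" for v
      by (simp_all add: pm_def qm_def pderiv_pcompose poly_pcompose pderiv_pCons)
    have "\<exists>u'\<in>gap (uminus ` Z) hm (-y). poly qm u' < 0"
    proof (rule gap_neg_transfer_inc[where p = pm and u = "-u"])
      show "finite (uminus ` Z)" using Z by simp
      show "strict_mono hm" using h by (auto simp: hm_def strict_mono_def)
      show "sgn (poly pm z) = sgn (poly qm (hm z))" if "z \<in> uminus ` Z" for z
        using that sg by (auto simp: pm_def qm_def hm_def poly_pcompose)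
      show "degree qm > 0" using q by (simp add: qm_def degree_pcompose)
      show "poly (pderiv pm) v > 0" if "v \<in> gap (uminus ` Z) (\<lambda>x. x) (- y)" for v
        using gp[of "-v"] that m1 g1 d by (simp add: sgn_1_neg)
      show "poly (pderiv qm) v > 0" if "v \<in> gap (uminus ` Z) hm (- y)" for v
        using gq[of "-v"] that m1 y(2) g2 d by (simp add: sgn_1_neg)
      show "-u \<in> gap (uminus ` Z) (\<lambda>x. x) (- y)" using u g1 by simp
      show "poly pm (-u) < 0" using u by (simp add: pm_def poly_pcompose)
    qed
    then obtain w where "w \<in> gap (uminus ` Z) hm (-y)" "poly qm w < 0" by blast
    then show ?thesis using g2 by (intro bexI[of _ "-w"]) (auto simp: qm_def poly_pcompose)
  qed
qed

lemma gap_pos_transfer: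
  fixes p q :: "real poly"
  assumes "finite Z" "strict_mono h"
    and "\<And>z. z \<in> Z \<Longrightarrow> sgn (poly p z) = sgn (poly q (h z))"
    and "degree q > 0"
    and "\<And>u. poly (pderiv p) u = 0 \<Longrightarrow> u \<in> Z"
    and "\<And>u. poly (pderiv q) u = 0 \<Longrightarrow> u \<in> h ` Z"
    and "y \<notin> Z" "sgn (poly (pderiv p) y) = sgn (poly (pderiv q) (h y))"
    and "u \<in> gap Z (\<lambda>x. x) y" "poly p u > 0"
  shows "\<exists>u'\<in>gap Z h y. poly q u' > 0"
proof -
  have "\<exists>u'\<in>gap Z h y. poly (-q) u' < 0"
    by (rule gap_neg_transfer[where p = "-p" and u = u]) (use assms in \<open>auto simp: pderiv_minus sgn_minus\<close>)
  then show ?thesis by auto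
qed

text \<open>A root off \<open>Z\<close> is simple, so \<open>p\<close> takes both signs near it
  inside the gap. Both signs transfer to \<open>q\<close>, and the intermediate value property
  yields a root.\<close>

lemma gap_root_transfer:
  fixes p q :: "real poly"
  assumes Z: "finite Z" and h: "strict_mono h"
    and sg: "\<And>z. z \<in> Z \<Longrightarrow> sgn (poly p z) = sgn (poly q (h z))"
    and q: "degree q > 0"
    and rp: "\<And>u. poly (pderiv p) u = 0 \<Longrightarrow> u \<in> Z"
    and rq: "\<And>u. poly (pderiv q) u = 0 \<Longrightarrow> u \<in> h ` Z"
    and y: "y \<notin> Z" "sgn (poly (pderiv p) y) = sgn (poly (pderiv q) (h y))"
    and w: "w \<in> gap Z (\<lambda>x. x) y" "poly p w = 0"
  shows "\<exists>w'\<in>gap Z h y. poly q w' = 0"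
proof -
  have wZ: "w \<notin> Z" using w y by (force simp: gap_def)
  have d: "poly (pderiv p) w \<noteq> 0" using rp wZ by blast
  \<comment> \<open>Within \<open>e\<close> of \<open>w\<close> no point of \<open>Z\<close> is met,
    so the gap is not left. The inserted \<open>1\<close> covers an empty \<open>Z\<close>.\<close>
  define e where "e = Min (insert 1 ((\<lambda>z. \<bar>z - w\<bar>) ` Z))"
  have e: "e > 0" using Z wZ by (auto simp: e_def)
  have ez: "e \<le> \<bar>z - w\<bar>" if "z \<in> Z" for z using Z that by (auto simp: e_def)
  have near: "v \<in> gap Z (\<lambda>x. x) y" if "\<bar>v - w\<bar> < e" for v
    using that ez w(1) by (force simp: gap_def)
  have der: "(poly p has_real_derivative poly (pderiv p) w) (at w)" by (rule poly_DERIV)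
  have "\<exists>u v. \<bar>u - w\<bar> < e \<and> \<bar>v - w\<bar> < e \<and> poly p u < 0 \<and> poly p v > 0"
  proof (cases "poly (pderiv p) w > 0")
    case True
    from DERIV_pos_inc_right[OF der True] obtain d1 where d1: "d1 > 0" "\<And>k. 0 < k \<Longrightarrow> k < d1 \<Longrightarrow> poly p w < poly p (w + k)" by blast
    from DERIV_pos_inc_left[OF der True] obtain d2 where d2: "d2 > 0" "\<And>k. 0 < k \<Longrightarrow> k < d2 \<Longrightarrow> poly p (w - k) < poly p w" by blast
    define k where "k = min e (min d1 d2) / 2"
    have k: "0 < k" "k < e" "k < d1" "k < d2" using e d1(1) d2(1) by (auto simp: k_def min_def)
    then show ?thesis using d1(2)[of k] d2(2)[of k] w
      by (intro exI[of _ "w - k"] exI[of _ "w + k"]) auto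
  next
    case False
    then have neg: "poly (pderiv p) w < 0" using d by simp
    from DERIV_neg_dec_right[OF der neg] obtain d1 where d1: "d1 > 0" "\<And>k. 0 < k \<Longrightarrow> k < d1 \<Longrightarrow> poly p w > poly p (w + k)" by blast
    from DERIV_neg_dec_left[OF der neg] obtain d2 where d2: "d2 > 0" "\<And>k. 0 < k \<Longrightarrow> k < d2 \<Longrightarrow> poly p (w - k) > poly p w" by blast
    define k where "k = min e (min d1 d2) / 2"
    have k: "0 < k" "k < e" "k < d1" "k < d2" using e d1(1) d2(1) by (auto simp: k_def min_def)
    then show ?thesis using d1(2)[of k] d2(2)[of k] w
      by (intro exI[of _ "w + k"] exI[of _ "w - k"]) auto
  qed
  then obtain u v where uv: "u \<in> gap Z (\<lambda>x. x) y" "v \<in> gap Z (\<lambda>x. x) y" "poly p u < 0" "poly p v > 0"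
    using near by blast
  obtain u' where u': "u' \<in> gap Z h y" "poly q u' < 0"
    using gap_neg_transfer[OF Z h sg q rp rq y uv(1,3)] by blast
  obtain v' where v': "v' \<in> gap Z h y" "poly q v' > 0"
    using gap_pos_transfer[OF Z h sg q rp rq y uv(2,4)] by blast
  have "sgn (poly q u') \<noteq> sgn (poly q v')" using u' v' by simp
  then obtain w' where w': "min u' v' \<le> w'" "w' \<le> max u' v'" "poly q w' = 0"
    using poly_sgn_const_between by blast
  have "w' \<in> gap Z h y"
    using w' u' v' gap_between[OF u'(1) v'(1)] gap_between[OF v'(1) u'(1)]
    by (auto simp: min_def max_def split: if_splits)
  with w' show ?thesis by blast
qed

text \<open>As \<open>pderiv p\<close> is one of the \<open>l i\<close>, \<open>p\<close> is strictly monotone between consecutive roots of the \<open>l i\<close>.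
  The signs of \<open>p\<close> at those roots thus locate the roots of \<open>p\<close>.\<close>

lemma root_order_extension:
  fixes l l' :: "'i \<Rightarrow> real poly" and p q :: "real poly"
  assumes I: "finite I" and h: "strict_mono h" "surj h"
    and cj: "\<And>i y. i \<in> I \<Longrightarrow> sgn (poly (l i) y) = sgn (poly (l' i) (h y))"
    and rt: "\<And>i y. i \<in> I \<Longrightarrow> l i \<noteq> 0 \<Longrightarrow> poly (l i) y = 0 \<Longrightarrow> sgn (poly p y) = sgn (poly q (h y))"
    and k: "k \<in> I" "l k = pderiv p" "l' k = pderiv q"
    and deg: "degree p > 0" "degree q > 0"
  shows "\<exists>h'. strict_mono h' \<and> surj h' \<and> (\<forall>i\<in>I. \<forall>y. sgn (poly (l i) y) = sgn (poly (l' i) (h' y)))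
     \<and> (\<forall>y. sgn (poly p y) = sgn (poly q (h' y)))"
proof -
  define Z where "Z = (\<Union>i\<in>{i\<in>I. l i \<noteq> 0}. {y. poly (l i) y = 0})"
  have finZ: "finite Z" unfolding Z_def using I by (auto intro: poly_roots_finite)
  have sgZ: "sgn (poly p z) = sgn (poly q (h z))" if "z \<in> Z" for z
    using that rt by (auto simp: Z_def)
  have nz: "p \<noteq> 0" "q \<noteq> 0" "pderiv p \<noteq> 0" "pderiv q \<noteq> 0"
    using deg by (auto simp: pderiv_eq_0_iff)
  have rp: "u \<in> Z" if "poly (pderiv p) u = 0" for u using that k nz by (auto simp: Z_def)
  have cjk: "sgn (poly (pderiv p) y) = sgn (poly (pderiv q) (h y))" for y
    using cj[OF k(1)] k by simp
  have rq: "u \<in> h ` Z" if "poly (pderiv q) u = 0" for u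
  proof -
    obtain v where v: "u = h v" using h(2) by (metis surjD)
    then have "poly (pderiv p) v = 0" using cjk[of v] that by (simp add: sgn_0_0)
    then show ?thesis using rp v by blast
  qed
  define W where "W = {y. poly p y = 0}"
  have finW: "finite W" unfolding W_def using nz by (simp add: poly_roots_finite)
  have ex: "\<exists>w'\<in>gap Z h w. poly q w' = 0" if "w \<in> W" "w \<notin> Z" for w
    by (rule gap_root_transfer[OF finZ h(1) sgZ deg(2) rp rq that(2) cjk _, of w])
       (use that in \<open>auto simp: gap_def W_def\<close>)
  \<comment> \<open>Points of \<open>Z\<close> keep their images, and a root of \<open>p\<close> off
    \<open>Z\<close> goes to a root of \<open>q\<close> in the corresponding gap. By Rolle's theorem
    a point of \<open>Z\<close> separates any two roots of \<open>p\<close>, so these choices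
    respect the order.\<close>
  define f where "f w = (if w \<in> Z then h w else (SOME w'. w' \<in> gap Z h w \<and> poly q w' = 0))" for w
  have fW: "f w \<in> gap Z h w" "poly q (f w) = 0" if "w \<in> W" "w \<notin> Z" for w
    using someI_ex[of "\<lambda>w'. w' \<in> gap Z h w \<and> poly q w' = 0"] ex[OF that] that by (auto simp: f_def)
  have fZ: "f z = h z" if "z \<in> Z" for z using that by (simp add: f_def)
  have sep: "\<exists>z\<in>Z. u < z \<and> z < v" if uv: "u \<in> W" "v \<in> W" "u < v" for u v
  proof -
    obtain x where x: "u < x" "x < v" "poly p v - poly p u = (v - u) * poly (pderiv p) x"
      using poly_MVT[OF uv(3)] by blast
    then have "poly (pderiv p) x = 0" using uv by (auto simp: W_def)
    then show ?thesis using x rp by blast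
  qed
  define T where "T = Z \<union> W"
  have finT: "finite T" using finZ finW by (simp add: T_def)
  have "strict_mono_on T f"
  proof (rule strict_mono_onI)
    fix u v assume uv: "u \<in> T" "v \<in> T" "u < v"
    consider "u \<in> Z" "v \<in> Z" | "u \<in> Z" "v \<notin> Z" "v \<in> W" | "u \<notin> Z" "u \<in> W" "v \<in> Z"
      | "u \<in> W" "u \<notin> Z" "v \<in> W" "v \<notin> Z" using uv by (auto simp: T_def)
    then show "f u < f v"
    proof cases
      case 1 then show ?thesis using h uv by (simp add: fZ strict_mono_less)
    next
      case 2 then show ?thesis using fW(1)[of v] uv by (auto simp: gap_def fZ)
    next
      case 3 then show ?thesis using fW(1)[of u] uv by (auto simp: gap_def fZ)
    next
      case 4
      then obtain z where "z \<in> Z" "u < z" "z < v" using sep uv by blast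
      then show ?thesis using fW(1)[of u] fW(1)[of v] 4 by (force simp: gap_def)
    qed
  qed
  from strict_mono_extension[OF finT this] obtain g
    where g: "strict_mono g" "surj g" "\<And>t. t \<in> T \<Longrightarrow> g t = f t" by blast
  have gZ: "g z = h z" if "z \<in> Z" for z using that g(3) fZ by (simp add: T_def)
  have gW: "poly q (g w) = 0" if "w \<in> W" for w
  proof (cases "w \<in> Z")
    case True
    then show ?thesis using gZ sgZ[OF True] that by (simp add: W_def sgn_0_0)
  next
    case False
    then show ?thesis using g(3) fW that by (simp add: T_def)
  qed
  \<comment> \<open>\<open>g\<close> and \<open>h\<close> agree on \<open>Z\<close>, so off
    \<open>Z\<close> no image of a point of \<open>Z\<close> lies between \<open>g y\<close> and
    \<open>h y\<close>, and the old signs survive.\<close>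
  have gl: "sgn (poly (l i) y) = sgn (poly (l' i) (g y))" if i: "i \<in> I" for i y
  proof (cases "l i = 0 \<or> y \<in> Z")
    case True
    then show ?thesis
    proof
      assume "l i = 0"
      then have "sgn (poly (l' i) (h v)) = 0" for v using cj[OF i, of v] by simp
      then have "poly (l' i) v = 0" for v using h(2) by (metis sgn_0_0 surjD)
      then show ?thesis using \<open>l i = 0\<close> by simp
    next
      assume "y \<in> Z" then show ?thesis using cj[OF i] gZ by simp
    qed
  next
    case False
    have "sgn (poly (l' i) (g y)) = sgn (poly (l' i) (h y))"
    proof (rule poly_sgn_const_between)
      fix w assume w: "min (g y) (h y) \<le> w" "w \<le> max (g y) (h y)"
      obtain v where v: "w = h v" using h(2) by (metis surjD)
      have "v \<notin> Z"
      proof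
        assume vZ: "v \<in> Z"
        have "v \<noteq> y" using False vZ by blast
        then consider "v < y" | "v > y" by linarith
        then show False
        proof cases
          case 1
          then have "g v < g y" "h v < h y" using g(1) h(1) by (auto simp: strict_mono_less)
          then show False using w v gZ[OF vZ] by auto
        next
          case 2
          then have "g v > g y" "h v > h y" using g(1) h(1) by (auto simp: strict_mono_less)
          then show False using w v gZ[OF vZ] by auto
        qed
      qed
      then have "poly (l i) v \<noteq> 0" using i False by (auto simp: Z_def)
      then show "poly (l' i) w \<noteq> 0" using cj[OF i, of v] v by (metis sgn_0_0)
    qed
    then show ?thesis using cj[OF i] by simp
  qed
  have gp': "sgn (poly (pderiv p) y) = sgn (poly (pderiv q) (g y))" for y
    using gl[OF k(1)] k by simp
  \<comment> \<open>\<open>g\<close> must account for every root of \<open>q\<close>, or the sign of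
    \<open>q\<close> could change where that of \<open>p\<close> does not. The root transfer is run
    backwards along \<open>inv h\<close>.\<close>
  have qroots: "v \<in> g ` W" if qv: "poly q v = 0" for v
  proof (cases "v \<in> h ` Z")
    case True
    then obtain z where z: "z \<in> Z" "v = h z" by blast
    then have "poly p z = 0" using sgZ[OF z(1)] qv by (simp add: sgn_0_0)
    then show ?thesis using z gZ by (force simp: W_def)
  next
    case False
    obtain y where y: "v = h y" using h(2) by (metis surjD)
    have ih: "inv h (h u) = u" for u using h(1) by (simp add: strict_mono_imp_inj_on)
    have hi: "h (inv h u) = u" for u using h(2) by (simp add: surj_f_inv_f)
    have smi: "strict_mono (inv h)"
      by (rule strict_monoI) (metis hi strict_mono_less[OF h(1)])
    have "\<exists>w'\<in>gap (h ` Z) (inv h) v. poly p w' = 0"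
    proof (rule gap_root_transfer[where p = q and w = v])
      show "finite (h ` Z)" using finZ by simp
      show "strict_mono (inv h)" by (rule smi)
      show "sgn (poly q z) = sgn (poly p (inv h z))" if "z \<in> h ` Z" for z using that sgZ ih by auto
      show "degree p > 0" by (rule deg)
      show "u \<in> h ` Z" if "poly (pderiv q) u = 0" for u using that by (rule rq)
      show "u \<in> inv h ` h ` Z" if "poly (pderiv p) u = 0" for u using imageI[OF imageI[OF rp[OF that], of h], of "inv h"] ih by simp
      show "v \<notin> h ` Z" by fact
      show "sgn (poly (pderiv q) v) = sgn (poly (pderiv p) (inv h v))" using cjk[of y] y ih by simp
      show "v \<in> gap (h ` Z) (\<lambda>x. x) v" by (simp add: gap_def)
      show "poly q v = 0" by fact
    qed
    then obtain w where w: "w \<in> gap (h ` Z) (inv h) v" "poly p w = 0" by blast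
    have wy: "\<And>z. z \<in> Z \<Longrightarrow> (z < y \<longrightarrow> z < w) \<and> (y < z \<longrightarrow> w < z)"
      using w(1) y ih h(1) by (auto simp: gap_def strict_mono_less)
    have yZ: "y \<notin> Z" using False y by blast
    have wZ: "w \<notin> Z" using wy yZ by (metis linorder_neqE_linordered_idom less_irrefl)
    have wW: "w \<in> W" using w by (simp add: W_def)
    \<comment> \<open>Two distinct roots of \<open>q\<close> in one gap would enclose a root of
      \<open>pderiv q\<close>, which would have to be the image of a point of
      \<open>Z\<close>.\<close>
    have "f w = v"
    proof (rule ccontr)
      assume ne: "f w \<noteq> v"
      have fg: "f w \<in> gap Z h y" using fW(1)[OF wW wZ] wy yZ wZ
        by (force simp: gap_def)
      have vg: "v \<in> gap Z h y" using gap_self[OF h(1)] y by simp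
      have sub: "\<exists>x. s < x \<and> x < t \<and> poly (pderiv q) x = 0" if "s < t" "poly q s = 0" "poly q t = 0" for s t
        using poly_MVT[OF that(1), of q] that by auto
      obtain x where x: "min (f w) v < x" "x < max (f w) v" "poly (pderiv q) x = 0"
      proof (cases "f w < v")
        case True
        then show ?thesis using sub[OF True fW(2)[OF wW wZ] qv] that by auto
      next
        case False
        then have "v < f w" using ne by simp
        then show ?thesis using sub[OF _ qv fW(2)[OF wW wZ]] that by auto
      qed
      have "x \<in> gap Z h y" using gap_between[OF fg vg, of x] gap_between[OF vg fg, of x] x
        by (auto simp: min_def max_def split: if_splits)
      moreover obtain z where "z \<in> Z" "x = h z" using rq[OF x(3)] by blast
      ultimately show False using yZ by (force simp: gap_def)
    qed
    then have "g w = v" using g(3) wW by (simp add: T_def)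
    then show ?thesis using wW by blast
  qed
  have gp: "sgn (poly p y) = sgn (poly q (g y))" for y
  proof (cases "y \<in> T")
    case True
    then show ?thesis using gW gZ sgZ by (auto simp: T_def W_def)
  next
    case False
    have sgT: "sgn (poly p z) = sgn (poly q (g z))" if "z \<in> T" for z
      using that gW gZ sgZ by (auto simp: T_def W_def)
    have rpT: "u \<in> T" if "poly (pderiv p) u = 0" for u using rp[OF that] by (simp add: T_def)
    have rqT: "u \<in> g ` T" if "poly (pderiv q) u = 0" for u using rq[OF that] gZ by (force simp: T_def)
    have yy: "y \<in> gap T (\<lambda>x. x) y" by (simp add: gap_def)
    \<comment> \<open>No root of \<open>q\<close> lies in the image of an interval between
      consecutive points of \<open>T\<close>, so one value settles the sign on the whole
      interval.\<close>
    have same: "sgn (poly q u) = sgn (poly q (g y))" if u: "u \<in> gap T g y" for u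
    proof (rule poly_sgn_const_between)
      fix w assume w: "min u (g y) \<le> w" "w \<le> max u (g y)"
      have wg: "w \<in> gap T g y" using gap_between[OF u gap_self[OF g(1)]] gap_between[OF gap_self[OF g(1)] u] w
        by (auto simp: min_def max_def split: if_splits)
      show "poly q w \<noteq> 0"
      proof
        assume "poly q w = 0"
        then obtain t where "t \<in> W" "w = g t" using qroots by blast
        then show False using wg False by (force simp: gap_def T_def)
      qed
    qed
    have "poly p y \<noteq> 0" using False by (auto simp: T_def W_def)
    then consider "poly p y < 0" | "poly p y > 0" by linarith
    then show ?thesis
    proof cases
      case 1
      obtain u where "u \<in> gap T g y" "poly q u < 0"
        using gap_neg_transfer[OF finT g(1) sgT deg(2) rpT rqT False gp' yy 1] by blast
      then show ?thesis using same[of u] 1 by simp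
    next
      case 2
      obtain u where "u \<in> gap T g y" "poly q u > 0"
        using gap_pos_transfer[OF finT g(1) sgT deg(2) rpT rqT False gp' yy 2] by blast
      then show ?thesis using same[of u] 2 by simp
    qed
  qed
  show ?thesis using g gl gp by blast
qed

section \<open>Univariate polynomials with polynomial coefficients\<close>

definition polfam :: "nat \<Rightarrow> ('a::real_normed_vector \<Rightarrow> real poly) \<Rightarrow> bool" where
  "polfam d P \<longleftrightarrow> (\<forall>i. real_polynomial_function (\<lambda>x. coeff (P x) i)) \<and> (\<forall>x. degree (P x) \<le> d)"

lemma polfam_coeff: "polfam d P \<Longrightarrow> real_polynomial_function (\<lambda>x. coeff (P x) i)"
  by (simp add: polfam_def)

lemma polfam_degree: "polfam d P \<Longrightarrow> degree (P x) \<le> d"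
  by (simp add: polfam_def)

lemma polfam_mono: "polfam d P \<Longrightarrow> d \<le> e \<Longrightarrow> polfam e P"
  by (meson polfam_def order_trans)

text \<open>The degree of \<open>P x\<close> may drop as \<open>x\<close> varies. Truncation at
  \<open>j\<close> gives a family of formal degree \<open>j\<close> that agrees with the original
  wherever the true degree is at most \<open>j\<close>.\<close>

definition trunc_poly :: "nat \<Rightarrow> real poly \<Rightarrow> real poly" where
  "trunc_poly j p = (\<Sum>i\<le>j. monom (coeff p i) i)"

lemma coeff_trunc_poly: "coeff (trunc_poly j p) i = (if i \<le> j then coeff p i else 0)"
  by (simp add: trunc_poly_def coeff_sum)

lemma degree_trunc_poly: "degree (trunc_poly j p) \<le> j"
  by (rule degree_le) (simp add: coeff_trunc_poly)

lemma trunc_poly_id: "degree p \<le> j \<Longrightarrow> trunc_poly j p = p"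
  by (rule poly_eqI) (simp add: coeff_trunc_poly coeff_eq_0)

lemma polfam_trunc:
  assumes "polfam d P"
  shows "polfam j (\<lambda>x. trunc_poly j (P x))"
proof -
  have "real_polynomial_function (\<lambda>x. coeff (trunc_poly j (P x)) i)" for i
    using polfam_coeff[OF assms, of i] by (cases "i \<le> j") (auto simp: coeff_trunc_poly)
  then show ?thesis by (simp add: polfam_def degree_trunc_poly)
qed

lemma polfam_pderiv:
  assumes "polfam (Suc d) P"
  shows "polfam d (\<lambda>x. pderiv (P x))"
proof -
  have "degree (pderiv (P x)) \<le> d" for x
    using polfam_degree[OF assms, of x] by (simp add: degree_pderiv)
  then show ?thesis
    using polfam_coeff[OF assms] by (auto simp: polfam_def coeff_pderiv)
qed

text \<open>Pseudo-division. The factor \<open>c x ^ 2\<close> avoids dividing by the leading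
  coefficient, so all coefficients stay polynomial in \<open>x\<close>. Being a nonzero square, it
  also preserves signs at the roots of \<open>M x\<close>.\<close>

lemma polfam_remainder:
  assumes M: "polfam j M" and j: "j > 0" and P: "polfam d P"
  shows "\<exists>R. polfam (j - 1) R \<and> (\<forall>x y. coeff (M x) j \<noteq> 0 \<and> poly (M x) y = 0 \<longrightarrow> sgn (poly (R x) y) = sgn (poly (P x) y))"
  using P
proof (induction d arbitrary: P)
  case 0
  then show ?case using polfam_mono[of 0 P "j - 1"] by blast
next
  case (Suc d)
  show ?case
  proof (cases "Suc d < j")
    case True
    then have "polfam (j - 1) P" by (intro polfam_mono[OF Suc.prems]) simp
    then show ?thesis by blast
  next
    case False
    define c where "c x = coeff (M x) j" for x
    \<comment> \<open>Both terms have the coefficient \<open>c x ^ 2 * coeff (P x) (Suc d)\<close>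
      at \<open>Suc d\<close>, so the formal degree drops.\<close>
    define Q where "Q x = smult (c x ^ 2) (P x) - smult (c x * coeff (P x) (Suc d)) (monom 1 (Suc d - j) * M x)" for x
    have cQ: "coeff (Q x) i = c x ^ 2 * coeff (P x) i
        - c x * coeff (P x) (Suc d) * (if i < Suc d - j then 0 else coeff (M x) (i - (Suc d - j)))" for x i
      by (simp add: Q_def coeff_monom_mult)
    have rc: "real_polynomial_function c" using polfam_coeff[OF M, of j] by (simp add: c_def[abs_def])
    have Q1: "real_polynomial_function (\<lambda>x. coeff (Q x) i)" for i
      unfolding cQ using rc polfam_coeff[OF M] polfam_coeff[OF Suc.prems]
      by (cases "i < Suc d - j") (auto intro!: real_polynomial_function_diff real_polynomial_function.intros(4) real_polynomial_function_power)
    have Q2: "coeff (Q x) i = 0" if "i \<ge> Suc d" for x i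
    proof (cases "i = Suc d")
      case True
      have "Suc d - (Suc d - j) = j" using False by simp
      then show ?thesis using True by (simp add: cQ c_def power2_eq_square)
    next
      case False'': False
      then have "i > Suc d" using that by simp
      moreover then have "i - (Suc d - j) > j" using False by arith
      ultimately show ?thesis using polfam_degree[OF Suc.prems, of x] polfam_degree[OF M, of x]
        by (simp add: cQ coeff_eq_0)
    qed
    have "degree (Q x) \<le> d" for x
      by (rule degree_le) (use Q2 in auto)
    with Q1 have "polfam d Q" by (simp add: polfam_def)
    from Suc.IH[OF this] obtain R where R: "polfam (j - 1) R"
      "\<And>x y. coeff (M x) j \<noteq> 0 \<Longrightarrow> poly (M x) y = 0 \<Longrightarrow> sgn (poly (R x) y) = sgn (poly (Q x) y)" by blast
    have "sgn (poly (Q x) y) = sgn (poly (P x) y)" if "coeff (M x) j \<noteq> 0" "poly (M x) y = 0" for x y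
      using that by (simp add: Q_def c_def poly_monom sgn_mult) (simp add: sgn_if)
    with R show ?thesis by (metis)
  qed
qed

definition same_signs :: "('a \<Rightarrow> real) set \<Rightarrow> 'a \<Rightarrow> 'a \<Rightarrow> bool" where
  "same_signs A x y \<longleftrightarrow> (\<forall>a\<in>A. sgn (a x) = sgn (a y))"

text \<open>The sign table of the family \<open>F x\<close> of real polynomials, as \<open>x\<close> varies, depends only on the signs of finitely
  many polynomials in \<open>x\<close>. Equality of sign tables is expressed by an order isomorphism of the line.\<close>

definition sign_determined :: "('a::real_normed_vector \<Rightarrow> real poly) set \<Rightarrow> bool" where
  "sign_determined F \<longleftrightarrow> (\<exists>A. finite A \<and> (\<forall>a\<in>A. real_polynomial_function a) \<and>
     (\<forall>x x'. same_signs A x x' \<longrightarrow>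
        (\<exists>h. strict_mono h \<and> surj h \<and> (\<forall>P\<in>F. \<forall>y. sgn (poly (P x) y) = sgn (poly (P x') (h y))))))"

lemma sign_determined_0:
  assumes "finite F" "\<And>P. P \<in> F \<Longrightarrow> polfam 0 P"
  shows "sign_determined F"
  unfolding sign_determined_def
proof (intro exI conjI allI impI ballI)
  show "finite ((\<lambda>P x. coeff (P x) 0) ` F)" using assms by simp
  show "real_polynomial_function a" if "a \<in> (\<lambda>P x. coeff (P x) 0) ` F" for a
    using that assms by (auto simp: polfam_def)
  fix x x' assume s: "same_signs ((\<lambda>P x. coeff (P x) 0) ` F) x x'"
  show "strict_mono (\<lambda>x::real. x)" by (simp add: strict_mono_def)
  show "surj (\<lambda>x::real. x)" by simp
  fix P y assume P: "P \<in> F"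
  have "poly (P z) y = coeff (P z) 0" for z
    using polfam_degree[OF assms(2)[OF P], of z] by (auto elim!: degree_eq_zeroE)
  with s P show "sgn (poly (P x) y) = sgn (poly (P x') y)" by (auto simp: same_signs_def)
qed

text \<open>One elimination step. Where the coefficient at \<open>Suc n\<close> vanishes,
  \<open>P\<close> is its truncation. Elsewhere the signs of \<open>P\<close> at the roots of
  \<open>L\<close> and of its own derivative are those of remainders of lower degree, which is
  enough to locate the roots of \<open>P\<close>.\<close>

lemma sign_determined_insert:
  fixes P :: "'a::real_normed_vector \<Rightarrow> real poly"
  assumes L: "finite L" "\<And>l. l \<in> L \<Longrightarrow> polfam (Suc n) l" and P: "polfam (Suc n) P"
    and trunc: "sign_determined (insert (\<lambda>x. trunc_poly n (P x)) L)"
    and rems: "\<And>R. finite R \<Longrightarrow> (\<And>r. r \<in> R \<Longrightarrow> polfam n r) \<Longrightarrow> sign_determined (insert (\<lambda>x. pderiv (P x)) L \<union> R)"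
  shows "sign_determined (insert P L)"
proof -
  define dP where "dP = (\<lambda>x. pderiv (P x))"
  define L' where "L' = insert dP L"
  have L': "finite L'" "\<And>l. l \<in> L' \<Longrightarrow> polfam (Suc n) l"
    using L polfam_mono[OF polfam_pderiv[OF P], of "Suc n"] by (auto simp: L'_def dP_def)
  \<comment> \<open>One remainder for each possible true degree \<open>j\<close> of
    \<open>l\<close>. Degree \<open>0\<close> is left out, as a nonzero constant has no
    roots.\<close>
  have "\<exists>r. \<forall>l\<in>L'. \<forall>j\<in>{1..Suc n}. polfam (j - 1) (r l j) \<and> (\<forall>x y. coeff (l x) j \<noteq> 0 \<and> poly (trunc_poly j (l x)) y = 0
       \<longrightarrow> sgn (poly (r l j x) y) = sgn (poly (P x) y))"
  proof -
    have "\<exists>R. polfam (j - 1) R \<and> (\<forall>x y. coeff (l x) j \<noteq> 0 \<and> poly (trunc_poly j (l x)) y = 0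
       \<longrightarrow> sgn (poly (R x) y) = sgn (poly (P x) y))" if "l \<in> L'" "j \<in> {1..Suc n}" for l j
      using polfam_remainder[OF polfam_trunc[OF L'(2)[OF that(1)], of j] _ P] that
      by (auto simp: coeff_trunc_poly)
    then show ?thesis by metis
  qed
  then obtain r where r: "\<And>l j. l \<in> L' \<Longrightarrow> j \<in> {1..Suc n} \<Longrightarrow> polfam (j - 1) (r l j)"
    "\<And>l j x y. l \<in> L' \<Longrightarrow> j \<in> {1..Suc n} \<Longrightarrow> coeff (l x) j \<noteq> 0 \<Longrightarrow> poly (trunc_poly j (l x)) y = 0
       \<Longrightarrow> sgn (poly (r l j x) y) = sgn (poly (P x) y)" by blast
  define R where "R = (\<lambda>(l, j). r l j) ` (L' \<times> {1..Suc n})"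
  have R: "finite R" "\<And>f. f \<in> R \<Longrightarrow> polfam n f"
    using L' r(1) by (auto simp: R_def intro!: polfam_mono[OF r(1)])
  from rems[OF R] obtain A1 where A1: "finite A1" "\<And>a. a \<in> A1 \<Longrightarrow> real_polynomial_function a"
    "\<And>x x'. same_signs A1 x x' \<Longrightarrow> \<exists>h. strict_mono h \<and> surj h \<and>
       (\<forall>Q\<in>L' \<union> R. \<forall>y. sgn (poly (Q x) y) = sgn (poly (Q x') (h y)))"
    unfolding sign_determined_def L'_def dP_def by blast
  from trunc obtain A2 where A2: "finite A2" "\<And>a. a \<in> A2 \<Longrightarrow> real_polynomial_function a"
    "\<And>x x'. same_signs A2 x x' \<Longrightarrow> \<exists>h. strict_mono h \<and> surj h \<and>
       (\<forall>Q\<in>insert (\<lambda>x. trunc_poly n (P x)) L. \<forall>y. sgn (poly (Q x) y) = sgn (poly (Q x') (h y)))"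
    unfolding sign_determined_def by blast
  \<comment> \<open>Equal signs of all coefficients force equal true degrees at \<open>x\<close> and
    \<open>x'\<close>, so the same remainder applies at both.\<close>
  define A3 where "A3 = (\<lambda>(l, j). (\<lambda>x. coeff (l x) j)) ` (insert P L' \<times> {..Suc n})"
  have A3: "finite A3" "\<And>a. a \<in> A3 \<Longrightarrow> real_polynomial_function a"
    using L' P by (auto simp: A3_def intro: polfam_coeff)
  show ?thesis
    unfolding sign_determined_def
  proof (intro exI[of _ "A1 \<union> A2 \<union> A3"] conjI allI impI)
    show "finite (A1 \<union> A2 \<union> A3)" using A1 A2 A3 by simp
    show "\<forall>a\<in>A1 \<union> A2 \<union> A3. real_polynomial_function a" using A1 A2 A3 by blast
    fix x x' assume s: "same_signs (A1 \<union> A2 \<union> A3) x x'"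
    then have s1: "same_signs A1 x x'" and s2: "same_signs A2 x x'" and s3: "same_signs A3 x x'"
      by (auto simp: same_signs_def)
    have c0: "coeff (l x) j = 0 \<longleftrightarrow> coeff (l x') j = 0" if "l \<in> insert P L'" for l j
    proof (cases "j \<le> Suc n")
      case True
      then have "(\<lambda>x. coeff (l x) j) \<in> A3" using that by (force simp: A3_def)
      then have "sgn (coeff (l x) j) = sgn (coeff (l x') j)" using s3 by (auto simp: same_signs_def)
      then show ?thesis by (metis sgn_0_0)
    next
      case False
      have "polfam (Suc n) l" using that P L' by auto
      then have "degree (l x) \<le> Suc n" "degree (l x') \<le> Suc n" by (auto simp: polfam_def)
      then show ?thesis using False by (simp add: coeff_eq_0)
    qed
    show "\<exists>h. strict_mono h \<and> surj h \<and> (\<forall>Q\<in>insert P L. \<forall>y. sgn (poly (Q x) y) = sgn (poly (Q x') (h y)))"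
    proof (cases "coeff (P x) (Suc n) = 0")
      case True
      then have T': "coeff (P x') (Suc n) = 0" using c0 by blast
      have tr: "trunc_poly n (P z) = P z" if "coeff (P z) (Suc n) = 0" for z
        by (rule trunc_poly_id, rule degree_le)
           (metis Suc_leI coeff_eq_0 le_neq_implies_less polfam_degree[OF P] that le_less_trans)
      show ?thesis using A2(3)[OF s2] tr[OF True] tr[OF T'] by auto
    next
      case False
      then have F': "coeff (P x') (Suc n) \<noteq> 0" using c0 by blast
      have deg: "degree (P x) > 0" "degree (P x') > 0"
        using le_degree[OF False] le_degree[OF F'] by auto
      obtain h where h: "strict_mono h" "surj h"
        and cj: "\<And>Q y. Q \<in> L' \<union> R \<Longrightarrow> sgn (poly (Q x) y) = sgn (poly (Q x') (h y))"
        using A1(3)[OF s1] by blast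
      have "\<exists>h'. strict_mono h' \<and> surj h' \<and> (\<forall>i\<in>L'. \<forall>y. sgn (poly (i x) y) = sgn (poly (i x') (h' y)))
         \<and> (\<forall>y. sgn (poly (P x) y) = sgn (poly (P x') (h' y)))"
      proof (rule root_order_extension[where l = "\<lambda>i. i x" and l' = "\<lambda>i. i x'" and k = dP])
        show "finite L'" by fact
        show "strict_mono h" "surj h" by fact+
        show "sgn (poly (i x) y) = sgn (poly (i x') (h y))" if "i \<in> L'" for i y using cj that by blast
        show "dP \<in> L'" by (simp add: L'_def)
        show "dP x = pderiv (P x)" "dP x' = pderiv (P x')" by (simp_all add: dP_def)
        show "degree (P x) > 0" "degree (P x') > 0" by fact+
        fix i y assume i: "i \<in> L'" "i x \<noteq> 0" "poly (i x) y = 0"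
        define j where "j = degree (i x)"
        have jn: "j \<le> Suc n" using L'(2)[OF i(1)] by (simp add: polfam_def j_def)
        have j0: "j > 0" using i by (auto simp: j_def elim!: degree_eq_zeroE intro!: gr0I)
        have cx: "coeff (i x) j \<noteq> 0" using i by (simp add: j_def)
        then have cx': "coeff (i x') j \<noteq> 0" using c0 i by blast
        have "degree (i x') \<le> j"
        proof (rule degree_le, intro allI impI)
          fix m assume "j < m"
          then have "coeff (i x) m = 0" by (simp add: j_def coeff_eq_0)
          then show "coeff (i x') m = 0" using c0 i by blast
        qed
        then have t': "trunc_poly j (i x') = i x'" by (rule trunc_poly_id)
        have t: "trunc_poly j (i x) = i x" by (rule trunc_poly_id) (simp add: j_def)
        have jj: "j \<in> {1..Suc n}" using jn j0 by simp
        have "sgn (poly (i x') (h y)) = 0" using cj[of i y] i by simp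
        then have y': "poly (i x') (h y) = 0" by (simp add: sgn_0_0)
        have "r i j \<in> R" using i jj by (force simp: R_def)
        then have "sgn (poly (r i j x) y) = sgn (poly (r i j x') (h y))" using cj by blast
        then show "sgn (poly (P x) y) = sgn (poly (P x') (h y))"
          using r(2)[OF i(1) jj cx, of y] r(2)[OF i(1) jj cx', of "h y"] t t' i(3) y' by simp
      qed
      then show ?thesis by (auto simp: L'_def)
    qed
  qed
qed

text \<open>Outer induction on the degree, inner induction on the number of members of top degree. A
  step trades one of these for finitely many of lower degree, hence the split into \<open>F1\<close>
  and an arbitrary finite \<open>F0\<close>.\<close>

lemma sign_determined_polfam:
  fixes F :: "('a::real_normed_vector \<Rightarrow> real poly) set"
  assumes "finite F" "\<And>P. P \<in> F \<Longrightarrow> polfam n P"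
  shows "sign_determined F"
  using assms
proof (induction n arbitrary: F)
  case 0
  then show ?case by (rule sign_determined_0)
next
  case (Suc n)
  have "sign_determined (F0 \<union> F1)"
    if "finite F1" "\<And>P. P \<in> F1 \<Longrightarrow> polfam (Suc n) P" "finite F0" "\<And>P. P \<in> F0 \<Longrightarrow> polfam n P" for F0 F1 :: "('a \<Rightarrow> real poly) set"
    using that
  proof (induction F1 arbitrary: F0 rule: finite_induct)
    case (empty F0)
    have "sign_determined F0" by (rule Suc.IH) (use empty.prems in auto)
    then show ?case by simp
  next
    case (insert P F1 F0)
    have "sign_determined (insert P (F0 \<union> F1))"
    proof (rule sign_determined_insert[where n = n])
      show "finite (F0 \<union> F1)" using insert by simp
      show "polfam (Suc n) l" if "l \<in> F0 \<union> F1" for l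
        using that insert.prems polfam_mono[of n l "Suc n"] by auto
      show P: "polfam (Suc n) P" using insert.prems by simp
      have "sign_determined (insert (\<lambda>x. trunc_poly n (P x)) F0 \<union> F1)"
        using insert.prems polfam_trunc[OF P, of n] by (intro insert.IH) auto
      then show "sign_determined (insert (\<lambda>x. trunc_poly n (P x)) (F0 \<union> F1))" by simp
      fix R :: "('a \<Rightarrow> real poly) set" assume R: "finite R" "\<And>r. r \<in> R \<Longrightarrow> polfam n r"
      have "sign_determined (insert (\<lambda>x. pderiv (P x)) (F0 \<union> R) \<union> F1)"
        using insert.prems polfam_pderiv[OF P] R by (intro insert.IH) auto
      then show "sign_determined (insert (\<lambda>x. pderiv (P x)) (F0 \<union> F1) \<union> R)"
        by (simp add: Un_ac)
    qed
    then show ?case by simp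
  qed
  from this[of F "{}"] Suc.prems show ?case by simp
qed

text \<open>Semialgebraic predicates: membership depends only on the signs of finitely many polynomials.\<close>

definition sa :: "('a::real_normed_vector \<Rightarrow> bool) \<Rightarrow> bool" where
  "sa P \<longleftrightarrow> (\<exists>A. finite A \<and> (\<forall>a\<in>A. real_polynomial_function a) \<and> (\<forall>x y. same_signs A x y \<longrightarrow> P x = P y))"

lemma saI:
  "finite A \<Longrightarrow> (\<And>a. a \<in> A \<Longrightarrow> real_polynomial_function a) \<Longrightarrow> (\<And>x y. same_signs A x y \<Longrightarrow> P x = P y) \<Longrightarrow> sa P"
  unfolding sa_def by blast

lemma sa_const: "sa (\<lambda>x. c)"
  by (rule saI[of "{}"]) auto

lemma sa_not: "sa P \<Longrightarrow> sa (\<lambda>x. \<not> P x)"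
  unfolding sa_def by meson

lemma sa_conj: 
  assumes "sa P" "sa Q" shows "sa (\<lambda>x. P x \<and> Q x)"
proof -
  obtain A where A: "finite A" "\<And>a. a \<in> A \<Longrightarrow> real_polynomial_function a" "\<And>x y. same_signs A x y \<Longrightarrow> P x = P y"
    using assms(1) unfolding sa_def by blast
  obtain B where B: "finite B" "\<And>a. a \<in> B \<Longrightarrow> real_polynomial_function a" "\<And>x y. same_signs B x y \<Longrightarrow> Q x = Q y"
    using assms(2) unfolding sa_def by blast
  have "same_signs A x y \<and> same_signs B x y" if "same_signs (A \<union> B) x y" for x y
    using that by (simp add: same_signs_def)
  then show ?thesis using A B by (intro saI[of "A \<union> B"]) blast+
qed

lemma sa_disj:
  assumes "sa P" "sa Q" shows "sa (\<lambda>x. P x \<or> Q x)"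
proof -
  have "sa (\<lambda>x. \<not> (\<not> P x \<and> \<not> Q x))" by (intro sa_not sa_conj assms)
  then show ?thesis by simp
qed

lemma sa_imp:
  assumes "sa P" "sa Q" shows "sa (\<lambda>x. P x \<longrightarrow> Q x)"
proof -
  have "sa (\<lambda>x. \<not> P x \<or> Q x)" by (intro sa_not sa_disj assms)
  then show ?thesis by (simp only: imp_conv_disj)
qed

lemma sa_less: "real_polynomial_function a \<Longrightarrow> real_polynomial_function b \<Longrightarrow> sa (\<lambda>x. a x < b x)"
  by (rule saI[of "{\<lambda>x. b x - a x}"]) (auto simp: same_signs_def sgn_if split: if_splits intro!: real_polynomial_function_diff)

lemma sa_le:
  assumes "real_polynomial_function a" "real_polynomial_function b" shows "sa (\<lambda>x. a x \<le> b x)"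
proof -
  have "sa (\<lambda>x. \<not> b x < a x)" by (intro sa_not sa_less assms)
  then show ?thesis by (simp add: not_less)
qed

lemma sa_comp:
  assumes "sa P" "polynomial_function f" shows "sa (\<lambda>x. P (f x))"
proof -
  obtain A where A: "finite A" "\<forall>a\<in>A. real_polynomial_function a" "\<forall>x y. same_signs A x y \<longrightarrow> P x = P y"
    using assms unfolding sa_def by blast
  then show ?thesis
    using real_polynomial_function_compose[OF assms(2)]
    by (intro saI[of "(\<lambda>a. a \<circ> f) ` A"]) (auto simp: same_signs_def o_def)
qed

section \<open>Projections of semialgebraic sets\<close>

lemma real_polynomial_function_polfam:
  fixes a :: "'a::real_normed_vector \<times> real \<Rightarrow> real"
  assumes "real_polynomial_function a"
  shows "\<exists>d P. polfam d P \<and> (\<forall>x y. a (x, y) = poly (P x) y)"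
  using assms
proof (induction rule: real_polynomial_function.induct)
  case (linear f)
  note bl = linear
  then interpret bounded_linear f .
  have eq: "f (x, y) = f (x, 0) + y * f (0, 1)" for x y
    using add[of "(x, 0)" "(0, y)"] scaleR[of y "(0, 1)"] by simp
  have "real_polynomial_function (\<lambda>x. f (x, 0))"
    by (intro real_polynomial_function.intros(1)) (intro bounded_linear_compose[OF bl] bounded_linear_Pair bounded_linear_ident bounded_linear_zero)
  then have "real_polynomial_function (\<lambda>x. coeff [:f (x, 0), f (0, 1):] i)" for i
  proof (cases i)
    case (Suc m)
    then show ?thesis by (cases m) auto
  qed simp
  then have "polfam 1 (\<lambda>x. [:f (x, 0), f (0, 1):])"
    by (auto simp: polfam_def)
  moreover have "f (x, y) = poly [:f (x, 0), f (0, 1):] y" for x y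
    using eq[of x y] by simp
  ultimately show ?case by blast
next
  case (const c)
  have "polfam 0 (\<lambda>x. [:c:])" by (auto simp: polfam_def)
  then show ?case by (intro exI[of _ 0] exI[of _ "\<lambda>x. [:c:]"]) simp
next
  case (add f g)
  then obtain d P e Q where *: "polfam d P" "\<And>x y. f (x, y) = poly (P x) y" "polfam e Q" "\<And>x y. g (x, y) = poly (Q x) y"
    by blast
  have "degree (P x + Q x) \<le> max d e" for x
    using polfam_degree[OF *(1), of x] polfam_degree[OF *(3), of x] by (intro degree_add_le) auto
  then have "polfam (max d e) (\<lambda>x. P x + Q x)"
    using polfam_coeff[OF *(1)] polfam_coeff[OF *(3)] by (auto simp: polfam_def)
  then show ?case using * by (intro exI[of _ "max d e"] exI[of _ "\<lambda>x. P x + Q x"]) simp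
next
  case (mult f g)
  then obtain d P e Q where *: "polfam d P" "\<And>x y. f (x, y) = poly (P x) y" "polfam e Q" "\<And>x y. g (x, y) = poly (Q x) y"
    by blast
  have "degree (P x * Q x) \<le> d + e" for x
    using polfam_degree[OF *(1), of x] polfam_degree[OF *(3), of x] degree_mult_le[of "P x" "Q x"] by linarith
  moreover have "real_polynomial_function (\<lambda>x. coeff (P x * Q x) i)" for i
    unfolding coeff_mult
    by (intro real_polynomial_function_sum real_polynomial_function.intros(4) polfam_coeff[OF *(1)] polfam_coeff[OF *(3)]) simp
  ultimately have "polfam (d + e) (\<lambda>x. P x * Q x)" by (simp add: polfam_def)
  then show ?case using * by (intro exI[of _ "d + e"] exI[of _ "\<lambda>x. P x * Q x"]) simp
qed

text \<open>The Tarski-Seidenberg step: if \<open>x\<close> and \<open>x'\<close> have the same sign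
  table, the order isomorphism \<open>h\<close> carries a witness \<open>y\<close> over
  \<open>x\<close> to the witness \<open>h y\<close> over \<open>x'\<close>.\<close>

lemma sa_ex_real':
  fixes P :: "'a::real_normed_vector \<times> real \<Rightarrow> bool"
  assumes "sa P" shows "sa (\<lambda>x. \<exists>y. P (x, y))"
proof -
  obtain A where A: "finite A" "\<And>a. a \<in> A \<Longrightarrow> real_polynomial_function a" "\<And>x y. same_signs A x y \<Longrightarrow> P x = P y"
    using assms unfolding sa_def by blast
  obtain d Q where Q: "\<And>a. a \<in> A \<Longrightarrow> polfam (d a) (Q a)" "\<And>a x y. a \<in> A \<Longrightarrow> a (x, y) = poly (Q a x) y"
    using real_polynomial_function_polfam A(2) by metis
  have "sign_determined (Q ` A)"
    using A(1) by (intro sign_determined_polfam[where n = "Max (d ` A)"]) (auto intro!: polfam_mono[OF Q(1)])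
  then obtain B where B: "finite B" "\<forall>a\<in>B. real_polynomial_function a"
    "\<And>x x'. same_signs B x x' \<Longrightarrow> \<exists>h. strict_mono h \<and> surj h \<and> (\<forall>P\<in>Q ` A. \<forall>y. sgn (poly (P x) y) = sgn (poly (P x') (h y)))"
    unfolding sign_determined_def by blast
  have *: "\<exists>y. P (x', y)" if sb: "same_signs B x x'" and pxy: "P (x, y)" for x x' y
  proof -
    obtain h where "\<forall>P\<in>Q ` A. \<forall>y. sgn (poly (P x) y) = sgn (poly (P x') (h y))" using B(3)[OF sb] by blast
    then have "same_signs A (x, y) (x', h y)" using Q by (auto simp: same_signs_def)
    then show ?thesis using A(3) pxy by blast
  qed
  have sym: "same_signs B x' x" if "same_signs B x x'" for x x' using that by (simp add: same_signs_def)
  show ?thesis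
  proof (rule saI[of B])
    show "finite B" by (rule B(1))
    show "real_polynomial_function a" if "a \<in> B" for a using B(2) that by blast
    fix x x' assume s: "same_signs B x x'"
    show "(\<exists>y. P (x, y)) = (\<exists>y. P (x', y))" using *[OF s] *[OF sym[OF s]] by blast
  qed
qed

lemma polynomial_function_Pair:
  assumes "polynomial_function f" "polynomial_function g"
  shows "polynomial_function (\<lambda>x. (f x, g x))"
  unfolding polynomial_function_def
proof (intro allI impI)
  fix h :: "'b \<times> 'c \<Rightarrow> real" assume h: "bounded_linear h"
  have 1: "bounded_linear (\<lambda>u. h (u, 0))" "bounded_linear (\<lambda>u. h (0, u))"
    by (intro bounded_linear_compose[OF h] bounded_linear_Pair bounded_linear_ident bounded_linear_zero)+
  have "h (f x, g x) = h (f x, 0) + h (0, g x)" for x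
    using linear_add[OF bounded_linear.linear[OF h], of "(f x, 0)" "(0, g x)"] by simp
  moreover have "real_polynomial_function (\<lambda>x. h (f x, 0))" "real_polynomial_function (\<lambda>x. h (0, g x))"
    using assms 1 unfolding polynomial_function_def by (auto simp: o_def)
  ultimately show "real_polynomial_function (h \<circ> (\<lambda>x. (f x, g x)))"
    by (auto simp: o_def)
qed

lemma polynomial_function_fst: "polynomial_function f \<Longrightarrow> polynomial_function (\<lambda>x. fst (f x))"
  using polynomial_function_compose[of f fst] polynomial_function_bounded_linear[OF bounded_linear_fst] by (simp add: o_def)

lemma polynomial_function_snd: "polynomial_function f \<Longrightarrow> polynomial_function (\<lambda>x. snd (f x))"
  using polynomial_function_compose[of f snd] polynomial_function_bounded_linear[OF bounded_linear_snd] by (simp add: o_def)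

lemma polynomial_function_comp:
  "polynomial_function f \<Longrightarrow> polynomial_function g \<Longrightarrow> polynomial_function (\<lambda>x. g (f x))"
  using polynomial_function_compose[of f g] by (simp add: o_def)

lemma polynomial_function_inner:
  fixes f g :: "'a::real_normed_vector \<Rightarrow> 'b::euclidean_space"
  assumes "polynomial_function f" "polynomial_function g"
  shows "polynomial_function (\<lambda>x. f x \<bullet> g x)"
proof -
  have "polynomial_function (\<lambda>x. \<Sum>b\<in>Basis. (f x \<bullet> b) * (g x \<bullet> b))"
    using assms polynomial_function_iff_Basis_inner[of f] polynomial_function_iff_Basis_inner[of g]
    by (auto simp flip: real_polynomial_function_eq intro!: real_polynomial_function_sum real_polynomial_function.intros(4))
  moreover have "(\<lambda>x. f x \<bullet> g x) = (\<lambda>x. \<Sum>b\<in>Basis. (f x \<bullet> b) * (g x \<bullet> b))"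
    by (rule ext) (rule euclidean_inner)
  ultimately show ?thesis by metis
qed

lemma polynomial_function_scaleR:
  fixes g :: "'a::real_normed_vector \<Rightarrow> 'b::euclidean_space"
  assumes "polynomial_function f" "polynomial_function g"
  shows "polynomial_function (\<lambda>x. f x *\<^sub>R g x)"
  by (rule polynomial_function_mult[OF assms])

text \<open>One coordinate at a time. The quantifier runs over displacements \<open>w\<close>
  supported on \<open>B\<close>, with the base point as a parameter, so the next coordinate can be
  absorbed into the base point by a polynomial map.\<close>

lemma sa_ex_euclidean:
  fixes P :: "'a::real_normed_vector \<times> 'b::euclidean_space \<Rightarrow> bool"
  assumes "sa P" shows "sa (\<lambda>x. \<exists>v. P (x, v))"
proof -
  note pf = polynomial_function_Pair polynomial_function_fst polynomial_function_snd polynomial_function_id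
     polynomial_function_add polynomial_function_scaleR polynomial_function_const
  have *: "sa (\<lambda>z. \<exists>w. (\<forall>b\<in>Basis - B. w \<bullet> b = 0) \<and> P (fst z, snd z + w))" if "finite B" "B \<subseteq> Basis" for B
    using that
  proof (induction B rule: finite_induct)
    case empty
    have "(\<forall>b\<in>Basis - {}. w \<bullet> b = 0) \<longleftrightarrow> w = 0" for w :: 'b
      by (simp add: euclidean_all_zero_iff)
    then show ?case using assms by simp
  next
    case (insert c B)
    have cB: "c \<in> Basis" using insert by blast
    have IH: "sa (\<lambda>z. \<exists>w. (\<forall>b\<in>Basis - B. w \<bullet> b = 0) \<and> P (fst z, snd z + w))" (is "sa ?Q") using insert by blast
    have "polynomial_function (\<lambda>u::('a \<times> 'b) \<times> real. (fst (fst u), snd (fst u) + snd u *\<^sub>R c))"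
      by (intro pf)
    from sa_ex_real'[OF sa_comp[OF IH this]]
    have "sa (\<lambda>z. \<exists>y. \<exists>w. (\<forall>b\<in>Basis - B. w \<bullet> b = 0) \<and> P (fst z, snd z + y *\<^sub>R c + w))" by simp
    moreover have "(\<exists>y. \<exists>w. (\<forall>b\<in>Basis - B. w \<bullet> b = 0) \<and> P (fst z, snd z + y *\<^sub>R c + w)) \<longleftrightarrow>
      (\<exists>w. (\<forall>b\<in>Basis - insert c B. w \<bullet> b = 0) \<and> P (fst z, snd z + w))" for z
    proof
      assume "\<exists>y. \<exists>w. (\<forall>b\<in>Basis - B. w \<bullet> b = 0) \<and> P (fst z, snd z + y *\<^sub>R c + w)"
      then obtain y w where yw: "\<forall>b\<in>Basis - B. w \<bullet> b = 0" "P (fst z, snd z + y *\<^sub>R c + w)" by blast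
      show "\<exists>w. (\<forall>b\<in>Basis - insert c B. w \<bullet> b = 0) \<and> P (fst z, snd z + w)"
        using yw cB by (intro exI[of _ "y *\<^sub>R c + w"]) (auto simp: inner_add_left add.assoc inner_Basis)
    next
      assume "\<exists>w. (\<forall>b\<in>Basis - insert c B. w \<bullet> b = 0) \<and> P (fst z, snd z + w)"
      then obtain w where w: "\<forall>b\<in>Basis - insert c B. w \<bullet> b = 0" "P (fst z, snd z + w)" by blast
      show "\<exists>y. \<exists>w. (\<forall>b\<in>Basis - B. w \<bullet> b = 0) \<and> P (fst z, snd z + y *\<^sub>R c + w)"
        using w cB insert by (intro exI[of _ "w \<bullet> c"] exI[of _ "w - (w \<bullet> c) *\<^sub>R c"]) (auto simp: inner_diff_left inner_Basis)
    qed
    ultimately show ?case by simp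
  qed
  have "polynomial_function (\<lambda>x::'a. (x, 0::'b))" by (intro pf)
  from sa_comp[OF *[OF finite_Basis order_refl] this] show ?thesis by simp
qed

lemma sa_ex:
  fixes P :: "'a::real_normed_vector \<Rightarrow> 'b::euclidean_space \<Rightarrow> bool"
  assumes "sa (\<lambda>z. P (fst z) (snd z))" shows "sa (\<lambda>x. \<exists>v. P x v)"
  using sa_ex_euclidean[OF assms] by simp

lemma sa_all:
  fixes P :: "'a::real_normed_vector \<Rightarrow> 'b::euclidean_space \<Rightarrow> bool"
  assumes "sa (\<lambda>z. P (fst z) (snd z))" shows "sa (\<lambda>x. \<forall>v. P x v)"
proof -
  have "sa (\<lambda>x. \<not> (\<exists>v. \<not> P x v))" by (intro sa_not sa_ex assms)
  then show ?thesis by simp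
qed

section \<open>Germs of semialgebraic functions of one variable\<close>

lemma polynomial_function_times:
  fixes f g :: "'a::real_normed_vector \<Rightarrow> real"
  shows "polynomial_function f \<Longrightarrow> polynomial_function g \<Longrightarrow> polynomial_function (\<lambda>x. f x * g x)"
  by (auto simp flip: real_polynomial_function_eq)

lemmas pf_intros = polynomial_function_const polynomial_function_Pair polynomial_function_fst polynomial_function_snd
  polynomial_function_id polynomial_function_add polynomial_function_diff polynomial_function_minus
  polynomial_function_times polynomial_function_inner polynomial_function_scaleR

lemma sa_lt: "polynomial_function a \<Longrightarrow> polynomial_function b \<Longrightarrow> sa (\<lambda>x. a x < (b x::real))"
  by (simp add: sa_less real_polynomial_function_eq)

lemma sa_leq: "polynomial_function a \<Longrightarrow> polynomial_function b \<Longrightarrow> sa (\<lambda>x. a x \<le> (b x::real))"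
  by (simp add: sa_le real_polynomial_function_eq)

lemma sa_equal:
  fixes a b :: "'a::real_normed_vector \<Rightarrow> 'b::euclidean_space"
  assumes "polynomial_function a" "polynomial_function b"
  shows "sa (\<lambda>x. a x = b x)"
proof -
  have "sa (\<lambda>x. (a x - b x) \<bullet> (a x - b x) \<le> 0)"
    by (intro sa_leq pf_intros assms)
  moreover have "((a x - b x) \<bullet> (a x - b x) \<le> 0) = (a x = b x)" for x
    by (metis inner_eq_zero_iff inner_ge_zero order_antisym_conv right_minus_eq order_refl)
  ultimately show ?thesis by simp
qed

lemmas sa_intros = sa_const sa_ex sa_all sa_imp sa_conj sa_disj sa_not sa_lt sa_leq sa_equal

lemma real_polynomial_function_poly:
  assumes "real_polynomial_function (a :: real \<Rightarrow> real)"
  obtains p where "\<And>t. a t = poly p t"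
proof -
  obtain c n where "a = (\<lambda>x. \<Sum>i\<le>n. c i * x ^ i)"
    using assms real_polynomial_function_iff_sum by blast
  then have "a t = poly (\<Sum>i\<le>n. monom (c i) i) t" for t
    by (simp add: poly_sum poly_monom)
  then show ?thesis using that by blast
qed

lemma real_polynomial_sgn_at_right:
  assumes "real_polynomial_function (a :: real \<Rightarrow> real)"
  shows "\<exists>s. \<forall>\<^sub>F t in at_right t0. sgn (a t) = s"
proof -
  obtain p where p: "\<And>t. a t = poly p t" using real_polynomial_function_poly[OF assms] by blast
  show ?thesis
  proof (cases "p = 0")
    case True
    then show ?thesis using p by (intro exI[of _ 0]) simp
  next
    case False
    define D where "D = {x. poly p x = 0 \<and> x > t0}"
    have D: "finite D" unfolding D_def using poly_roots_finite[OF False] by simp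
    define b where "b = Min (insert (t0 + 1) D)"
    have b: "b > t0" using D by (auto simp: b_def D_def)
    have nz: "poly p x \<noteq> 0" if "t0 < x" "x < b" for x
    proof
      assume "poly p x = 0"
      then have "b \<le> x" using D that by (auto simp: b_def D_def)
      then show False using that by simp
    qed
    define m where "m = (t0 + b) / 2"
    have m: "t0 < m" "m < b" using b by (auto simp: m_def)
    have "sgn (poly p t) = sgn (poly p m)" if "t0 < t" "t < b" for t
      using that m by (intro poly_sgn_const_between nz) auto
    then show ?thesis using b unfolding p eventually_at_right_field by blast
  qed
qed

text \<open>The germ form of o-minimality: finitely many polynomial signs stabilize on a common
  interval to the right of \<open>t0\<close>, and the predicate depends on nothing else.\<close>

lemma sa_eventually_at_right:
  assumes "sa (P :: real \<Rightarrow> bool)"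
  shows "(\<forall>\<^sub>F t in at_right t0. P t) \<or> (\<forall>\<^sub>F t in at_right t0. \<not> P t)"
proof -
  obtain A where A: "finite A" "\<And>a. a \<in> A \<Longrightarrow> real_polynomial_function a" "\<And>x y. same_signs A x y \<Longrightarrow> P x = P y"
    using assms unfolding sa_def by blast
  have "\<exists>s. \<forall>a\<in>A. \<forall>\<^sub>F t in at_right t0. sgn (a t) = s a"
    by (intro bchoice ballI real_polynomial_sgn_at_right A(2))
  then obtain s where "\<forall>a\<in>A. \<forall>\<^sub>F t in at_right t0. sgn (a t) = s a" by blast
  then have "\<forall>\<^sub>F t in at_right t0. \<forall>a\<in>A. sgn (a t) = s a"
    using A(1) by (simp add: eventually_ball_finite_distrib)
  then obtain b where b: "b > t0" "\<And>t. t0 < t \<Longrightarrow> t < b \<Longrightarrow> \<forall>a\<in>A. sgn (a t) = s a"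
    unfolding eventually_at_right_field by blast
  define m where "m = (t0 + b) / 2"
  have m: "t0 < m" "m < b" using b by (auto simp: m_def)
  have "P t = P m" if "t0 < t" "t < b" for t
    using b(2)[OF that] b(2)[OF m] by (intro A(3)) (simp add: same_signs_def)
  then show ?thesis using b(1) unfolding eventually_at_right_field by (cases "P m") blast+
qed

section \<open>Functions with semialgebraic graph\<close>

definition sa_fun :: "(real \<Rightarrow> 'b::euclidean_space) \<Rightarrow> bool" where
  "sa_fun u \<longleftrightarrow> sa (\<lambda>p. u (fst p) = snd p)"

text \<open>A value of \<open>u\<close> need not be polynomial in \<open>x\<close>. It is introduced
  as a quantified variable constrained by the graph, and elimination removes it again.\<close>

lemma sa_fun_subst:
  fixes u :: "real \<Rightarrow> 'b::euclidean_space"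
  assumes u: "sa_fun u" and P: "sa (\<lambda>z. P (fst z) (snd z))" and a: "polynomial_function a"
  shows "sa (\<lambda>x. P x (u (a x)))"
proof -
  have "polynomial_function (\<lambda>z. (a (fst z), snd z))"
    by (intro pf_intros polynomial_function_comp[OF _ a])
  from sa_comp[OF u[unfolded sa_fun_def] this]
  have "sa (\<lambda>z. u (a (fst z)) = snd z)" by simp
  then have "sa (\<lambda>x. \<exists>v. u (a x) = v \<and> P x v)" using P by (intro sa_ex sa_conj)
  then show ?thesis by simp
qed

lemma sa_fun_subst2:
  fixes u :: "real \<Rightarrow> 'b::euclidean_space"
  assumes u: "sa_fun u" and P: "sa (\<lambda>z. P (fst (fst z)) (snd (fst z)) (snd z))"
    and a: "polynomial_function a" "polynomial_function b"
  shows "sa (\<lambda>x. P x (u (a x)) (u (b x)))"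
proof (rule sa_fun_subst[OF u _ a(1), where P = "\<lambda>x v. P x v (u (b x))"])
  show "sa (\<lambda>z. P (fst z) (snd z) (u (b (fst z))))"
    by (rule sa_fun_subst[OF u _ polynomial_function_comp[OF polynomial_function_fst[OF polynomial_function_id] a(2)],
          where P = "\<lambda>z v. P (fst z) (snd z) v"]) (rule P)
qed

lemma sa_fun_uminus:
  assumes "sa_fun u" shows "sa_fun (\<lambda>t. u (- t))"
proof -
  have "polynomial_function (\<lambda>p::real \<times> 'a. (- fst p, snd p))" by (intro pf_intros)
  from sa_comp[OF assms[unfolded sa_fun_def] this] show ?thesis by (simp add: sa_fun_def)
qed

text \<open>The limit is the infimum of the eventual strict upper bounds. The dichotomy is kept
  abstract because it serves both semialgebraic germs and the values of the leading form along the
  flow.\<close>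

lemma tendsto_of_dichotomy:
  fixes u :: "'b \<Rightarrow> real"
  assumes F: "F \<noteq> bot" and bd: "\<forall>\<^sub>F t in F. \<bar>u t\<bar> \<le> B"
    and dich: "\<And>y c. y < c \<Longrightarrow> (\<forall>\<^sub>F t in F. u t < c) \<or> (\<forall>\<^sub>F t in F. y < u t)"
  shows "\<exists>L. (u \<longlongrightarrow> L) F"
proof -
  define X where "X = {c. \<forall>\<^sub>F t in F. u t < c}"
  have "\<forall>\<^sub>F t in F. u t < B + 1" using bd by eventually_elim simp
  then have ne: "X \<noteq> {}" by (auto simp: X_def)
  have "-B \<le> c" if "c \<in> X" for c
  proof -
    have "\<forall>\<^sub>F t in F. u t < c" using that by (simp add: X_def)
    then have "\<forall>\<^sub>F t in F. -B < c" using bd by eventually_elim linarith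
    then show ?thesis using F by (simp add: eventually_const)
  qed
  then have bb: "bdd_below X" by (auto simp: bdd_below_def)
  have "(u \<longlongrightarrow> Inf X) F"
  proof (rule order_tendstoI)
    fix y assume "y < Inf X"
    then obtain c where c: "y < c" "c < Inf X" using dense by blast
    then have "c \<notin> X" using cInf_lower[OF _ bb, of c] by linarith
    then show "\<forall>\<^sub>F t in F. y < u t" using dich[OF c(1)] by (simp add: X_def)
  next
    fix y assume "Inf X < y"
    then obtain c where c: "c \<in> X" "c < y" using cInf_lessD[OF ne] by blast
    then have "\<forall>\<^sub>F t in F. u t < c" by (simp add: X_def)
    then show "\<forall>\<^sub>F t in F. u t < y" by eventually_elim (use c in simp)
  qed
  then show ?thesis by blast
qed

lemma sa_fun_right_limit:
  fixes u :: "real \<Rightarrow> real"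
  assumes u: "sa_fun u" and bd: "\<And>t. \<bar>u t\<bar> \<le> B"
  shows "\<exists>L. (u \<longlongrightarrow> L) (at_right t0)"
proof (rule tendsto_of_dichotomy[where B = B])
  fix y c :: real assume "y < c"
  have "(\<forall>\<^sub>F t in at_right t0. u t < c) \<or> (\<forall>\<^sub>F t in at_right t0. \<not> u t < c)"
    by (intro sa_eventually_at_right sa_fun_subst[OF u, where P = "\<lambda>x v. v < c"] sa_intros pf_intros)
  moreover have "\<forall>\<^sub>F t in at_right t0. y < u t" if "\<forall>\<^sub>F t in at_right t0. \<not> u t < c"
    using that by eventually_elim (use \<open>y < c\<close> in simp)
  ultimately show "(\<forall>\<^sub>F t in at_right t0. u t < c) \<or> (\<forall>\<^sub>F t in at_right t0. y < u t)" by blast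
qed (use bd in \<open>simp_all add: always_eventually\<close>)

text \<open>Each point owns an interval to its right that is free of other points, and a rational
  chosen there determines the point.\<close>

lemma countable_right_isolated:
  fixes E :: "real set"
  assumes "\<And>t. t \<in> E \<Longrightarrow> \<exists>b>t. \<forall>s\<in>E. t < s \<longrightarrow> b \<le> s"
  shows "countable E"
proof -
  have "\<exists>q\<in>\<rat>. t < q \<and> (\<forall>s\<in>E. t < s \<longrightarrow> q < s)" if tE: "t \<in> E" for t
  proof -
    obtain b where b: "b > t" "\<forall>s\<in>E. t < s \<longrightarrow> b \<le> s" using assms[OF tE] by blast
    obtain q where "q \<in> \<rat>" "t < q" "q < b" using Rats_dense_in_real[OF b(1)] by blast
    then show ?thesis using b(2) by force
  qed
  then obtain q where q: "\<And>t. t \<in> E \<Longrightarrow> q t \<in> \<rat>" "\<And>t. t \<in> E \<Longrightarrow> t < q t"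
    "\<And>t s. t \<in> E \<Longrightarrow> s \<in> E \<Longrightarrow> t < s \<Longrightarrow> q t < s" by metis
  have "inj_on q E"
  proof (rule linorder_inj_onI')
    fix s t assume "s \<in> E" "t \<in> E" "s < t"
    then show "q s \<noteq> q t" using q(2)[of t] q(3)[of s t] by simp
  qed
  moreover have "countable (q ` E)" using countable_subset[OF _ countable_rat] q(1) by blast
  ultimately show ?thesis using countable_image_inj_on by blast
qed

lemma countable_right_discontinuities:
  fixes u :: "real \<Rightarrow> real"
  assumes "\<And>t0. \<exists>L. (u \<longlongrightarrow> L) (at_right t0)"
  shows "countable {t. \<not> (u \<longlongrightarrow> u t) (at_right t)}"
proof -
  \<comment> \<open>\<open>E n\<close> holds the points \<open>t\<close> near which, on the right,
    \<open>u\<close> keeps departing from \<open>u t\<close> by at least \<open>1 / (n + 1)\<close>.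
    A right limit at \<open>t0\<close> clears a right neighbourhood of \<open>t0\<close> of such
    points.\<close>
  define E where "E n = {t. \<not> (\<forall>\<^sub>F s in at_right t. \<bar>u s - u t\<bar> < 1 / real (Suc n))}" for n
  have "countable (E n)" for n
  proof (rule countable_right_isolated)
    fix t0
    obtain L where L: "(u \<longlongrightarrow> L) (at_right t0)" using assms by blast
    define e where "e = 1 / real (Suc n) / 2"
    have "e > 0" by (simp add: e_def)
    then have "\<forall>\<^sub>F s in at_right t0. dist (u s) L < e" using L by (simp add: tendsto_iff)
    then obtain b where b: "b > t0" "\<And>s. t0 < s \<Longrightarrow> s < b \<Longrightarrow> dist (u s) L < e"
      unfolding eventually_at_right_field by blast
    have "t \<notin> E n" if t: "t0 < t" "t < b" for t
    proof -
      have "\<bar>u s - u t\<bar> < 1 / real (Suc n)" if "t < s" "s < b" for s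
      proof -
        have "\<bar>u s - L\<bar> < e" "\<bar>u t - L\<bar> < e" using b(2)[of s] b(2)[of t] t that by (simp_all add: dist_real_def)
        moreover have "e + e = 1 / real (Suc n)" unfolding e_def by (rule field_sum_of_halves)
        ultimately show ?thesis by linarith
      qed
      then show ?thesis using t(2) unfolding E_def eventually_at_right_field by blast
    qed
    then show "\<exists>b>t0. \<forall>s\<in>E n. t0 < s \<longrightarrow> b \<le> s" using b(1) by (meson not_le)
  qed
  then have "countable (\<Union>n. E n)" by blast
  moreover have "{t. \<not> (u \<longlongrightarrow> u t) (at_right t)} \<subseteq> (\<Union>n. E n)"
  proof
    fix t assume "t \<in> {t. \<not> (u \<longlongrightarrow> u t) (at_right t)}"
    then obtain e where e: "e > 0" "\<not> (\<forall>\<^sub>F s in at_right t. dist (u s) (u t) < e)" by (auto simp: tendsto_iff)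
    obtain n where n: "1 / real (Suc n) < e" using e(1) nat_approx_posE by blast
    have "t \<in> E n"
    proof (rule ccontr)
      assume "t \<notin> E n"
      then have "\<forall>\<^sub>F s in at_right t. \<bar>u s - u t\<bar> < 1 / real (Suc n)" by (simp add: E_def)
      then have "\<forall>\<^sub>F s in at_right t. dist (u s) (u t) < e"
        by eventually_elim (use n in \<open>simp add: dist_real_def\<close>)
      then show False using e by blast
    qed
    then show "t \<in> (\<Union>n. E n)" by blast
  qed
  ultimately show ?thesis using countable_subset by blast
qed

text \<open>Semialgebraic predicates are eventually constant to the right of any point, so one-sided limits exist. This leaves
  countably many discontinuities, and the same dichotomy then gives continuity and monotonicity near \<open>0\<close>.\<close>

lemma sa_fun_countable_discontinuities:
  fixes u :: "real \<Rightarrow> real"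
  assumes u: "sa_fun u" and bd: "\<And>t. \<bar>u t\<bar> \<le> B"
  shows "countable {t. \<not> isCont u t}"
proof -
  define v where "v t = u (- t)" for t
  have r: "countable {t. \<not> (u \<longlongrightarrow> u t) (at_right t)}"
    by (intro countable_right_discontinuities sa_fun_right_limit[OF u bd])
  have "countable {t. \<not> (v \<longlongrightarrow> v t) (at_right t)}"
    unfolding v_def by (intro countable_right_discontinuities sa_fun_right_limit[OF sa_fun_uminus[OF u] bd])
  then have "countable (uminus ` {t. \<not> (v \<longlongrightarrow> v t) (at_right t)})" by blast
  moreover have "{t. \<not> (u \<longlongrightarrow> u t) (at_left t)} \<subseteq> uminus ` {t. \<not> (v \<longlongrightarrow> v t) (at_right t)}"
  proof
    fix t assume "t \<in> {t. \<not> (u \<longlongrightarrow> u t) (at_left t)}"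
    then have "\<not> (v \<longlongrightarrow> v (- t)) (at_right (- t))"
      by (simp add: v_def[abs_def] at_left_minus[of t] filterlim_filtermap)
    then show "t \<in> uminus ` {t. \<not> (v \<longlongrightarrow> v t) (at_right t)}"
      by (intro image_eqI[of _ _ "- t"]) auto
  qed
  ultimately have l: "countable {t. \<not> (u \<longlongrightarrow> u t) (at_left t)}" using countable_subset by blast
  have "{t. \<not> isCont u t} \<subseteq> {t. \<not> (u \<longlongrightarrow> u t) (at_left t)} \<union> {t. \<not> (u \<longlongrightarrow> u t) (at_right t)}"
    by (auto simp: isCont_def filterlim_split_at)
  then show ?thesis by (rule countable_subset) (intro countable_Un l r)
qed

text \<open>The usual condition on \<epsilon> and \<delta> is a first-order formula about the graph
  once distances are unfolded into polynomial inequalities.\<close>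

lemma sa_isCont:
  fixes u :: "real \<Rightarrow> real"
  assumes u: "sa_fun u"
  shows "sa (\<lambda>t. isCont u t)"
proof -
  have *: "isCont u t \<longleftrightarrow> (\<forall>e. 0 < e \<longrightarrow> (\<exists>d. 0 < d \<and> (\<forall>s. t - d < s \<and> s < t + d \<longrightarrow> u s < u t + e \<and> u t - e < u s)))" for t
  proof -
    have "dist s t < d \<longleftrightarrow> t - d < s \<and> s < t + d" for s t d :: real by (auto simp: dist_real_def)
    moreover have "dist a b < e \<longleftrightarrow> a < b + e \<and> b - e < a" for a b e :: real by (auto simp: dist_real_def)
    ultimately show ?thesis by (simp add: continuous_at_eps_delta)
  qed
  show ?thesis
    unfolding *
    by (intro sa_all sa_ex sa_imp sa_conj sa_lt pf_intros
        sa_fun_subst2[OF u, where P = "\<lambda>z v w. v < w + snd (fst (fst z)) \<and> w - snd (fst (fst z)) < v"])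
qed

text \<open>A comparison principle without derivatives: the last time at which the value is at most
  \<open>f a\<close> could be moved to the right if it were not \<open>b\<close>. It is meant for
  functions built from \<psi>, which is not known to be differentiable.\<close>

lemma nonincreasing_of_local:
  fixes f :: "real \<Rightarrow> real"
  assumes ab: "a \<le> b" and cont: "continuous_on {a..b} f"
    and loc: "\<And>t. a \<le> t \<Longrightarrow> t < b \<Longrightarrow> \<forall>\<^sub>F s in at_right t. f s \<le> f t"
  shows "f b \<le> f a"
proof -
  define T where "T = {t \<in> {a..b}. f t \<le> f a}"
  have "closed T" unfolding T_def
    using continuous_closed_preimage[OF cont closed_atLeastAtMost, of "{..f a}"]
    by (simp add: vimage_def Int_def)
  moreover have "bounded T" unfolding T_def by (rule bounded_subset[of "{a..b}"]) auto
  ultimately have "compact T" by (simp add: compact_eq_bounded_closed)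
  moreover have "a \<in> T" using ab by (simp add: T_def)
  ultimately obtain c where c: "c \<in> T" "\<And>t. t \<in> T \<Longrightarrow> t \<le> c"
    using compact_attains_sup[of T] by blast
  have "c = b"
  proof (rule ccontr)
    assume "c \<noteq> b"
    then have cb: "c < b" "a \<le> c" using c(1) by (auto simp: T_def)
    have "\<forall>\<^sub>F s in at_right c. f s \<le> f c \<and> s \<in> {c<..<b}"
      using loc[OF cb(2,1)] eventually_at_right_real[OF cb(1)] by eventually_elim simp
    from eventually_happens'[OF _ this] obtain s where s: "f s \<le> f c" "c < s" "s < b" by auto
    then have "s \<in> T" using c(1) by (auto simp: T_def)
    then show False using c(2) s by force
  qed
  then show ?thesis using c by (simp add: T_def)
qed

lemma sa_fun_eventually_monotone:
  fixes u :: "real \<Rightarrow> real"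
  assumes u: "sa_fun u" and bd: "\<And>t. \<bar>u t\<bar> \<le> B"
  shows "\<exists>b>0. \<exists>\<sigma>\<in>{-1, 1}. continuous_on {0<..<b} u \<and> (\<forall>s t. 0 < s \<and> s \<le> t \<and> t < b \<longrightarrow> \<sigma> * u s \<le> \<sigma> * u t)"
proof -
  have "\<forall>\<^sub>F t in at_right 0. isCont u t"
  proof (rule ccontr)
    assume "\<not> ?thesis"
    then have "\<forall>\<^sub>F t in at_right 0. \<not> isCont u t" using sa_eventually_at_right[OF sa_isCont[OF u]] by blast
    then obtain b where "b > 0" "\<And>t. 0 < t \<Longrightarrow> t < b \<Longrightarrow> \<not> isCont u t"
      unfolding eventually_at_right_field by blast
    then have "{0<..<b} \<subseteq> {t. \<not> isCont u t}" by auto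
    then have "countable {0<..<b}" using sa_fun_countable_discontinuities[OF u bd] countable_subset by blast
    then show False using uncountable_open_interval[of 0 b] \<open>b > 0\<close> by simp
  qed
  define inc where "inc \<sigma> t \<longleftrightarrow> (\<exists>d. 0 < d \<and> (\<forall>s. t < s \<and> s < t + d \<longrightarrow> \<sigma> * u t \<le> \<sigma> * u s))" for \<sigma> t :: real
  have sinc: "sa (inc \<sigma>)" for \<sigma>
    unfolding inc_def[abs_def]
    by (intro sa_all sa_ex sa_imp sa_conj sa_lt sa_leq pf_intros
        sa_fun_subst2[OF u, where P = "\<lambda>z v w. \<sigma> * v \<le> \<sigma> * w"])
  have evinc: "inc \<sigma> t" if ev: "\<forall>\<^sub>F s in at_right t. \<sigma> * u t \<le> \<sigma> * u s" for \<sigma> t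
  proof -
    obtain b where "b > t" "\<And>s. t < s \<Longrightarrow> s < b \<Longrightarrow> \<sigma> * u t \<le> \<sigma> * u s"
      using ev unfolding eventually_at_right_field by blast
    then show ?thesis unfolding inc_def by (intro exI[of _ "b - t"]) auto
  qed
  \<comment> \<open>The direction of growth may at first depend on \<open>t\<close>. The dichotomy
    applied to \<open>inc 1\<close>, now as a predicate of \<open>t\<close>, fixes one direction
    near \<open>0\<close>.\<close>
  have either: "inc 1 t \<or> inc (-1) t" for t
  proof -
    have "sa (\<lambda>s. u t \<le> u s)"
      by (intro sa_fun_subst[OF u, where P = "\<lambda>x v. u t \<le> v"] sa_leq pf_intros)
    then consider "\<forall>\<^sub>F s in at_right t. u t \<le> u s" | "\<forall>\<^sub>F s in at_right t. \<not> u t \<le> u s"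
      using sa_eventually_at_right by blast
    then show ?thesis
    proof cases
      case 1
      then show ?thesis using evinc[where \<sigma> = 1] by simp
    next
      case 2
      then have "\<forall>\<^sub>F s in at_right t. (-1) * u t \<le> (-1) * u s" by eventually_elim simp
      then show ?thesis using evinc by blast
    qed
  qed
  have "\<exists>\<sigma>\<in>{-1,1}. \<forall>\<^sub>F t in at_right 0. inc \<sigma> t"
  proof (cases "\<forall>\<^sub>F t in at_right 0. inc 1 t")
    case False
    then have "\<forall>\<^sub>F t in at_right 0. \<not> inc 1 t" using sa_eventually_at_right[OF sinc] by blast
    then have "\<forall>\<^sub>F t in at_right 0. inc (-1) t" by eventually_elim (use either in blast)
    then show ?thesis by blast
  qed blast
  then obtain \<sigma> where \<sigma>: "\<sigma> \<in> {-1, 1}" "\<forall>\<^sub>F t in at_right 0. inc \<sigma> t" by blast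
  have "\<forall>\<^sub>F t in at_right 0. isCont u t \<and> inc \<sigma> t"
    using \<open>\<forall>\<^sub>F t in at_right 0. isCont u t\<close> \<sigma>(2) by eventually_elim simp
  then obtain b where b: "b > 0" "\<And>t. 0 < t \<Longrightarrow> t < b \<Longrightarrow> isCont u t \<and> inc \<sigma> t"
    unfolding eventually_at_right_field by blast
  have "\<sigma> * u s \<le> \<sigma> * u t" if st: "0 < s" "s \<le> t" "t < b" for s t
  proof -
    have "- (\<sigma> * u t) \<le> - (\<sigma> * u s)"
    proof (rule nonincreasing_of_local[where f = "\<lambda>t. - (\<sigma> * u t)", OF st(2)])
      show "continuous_on {s..t} (\<lambda>t. - (\<sigma> * u t))"
        using b(2) st by (intro continuous_intros continuous_at_imp_continuous_on) auto
      fix r assume r: "s \<le> r" "r < t"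
      then have "inc \<sigma> r" using b(2)[of r] st by simp
      then obtain d where "0 < d" "\<And>s. r < s \<Longrightarrow> s < r + d \<Longrightarrow> \<sigma> * u r \<le> \<sigma> * u s" unfolding inc_def by blast
      then show "\<forall>\<^sub>F s in at_right r. - (\<sigma> * u s) \<le> - (\<sigma> * u r)"
        unfolding eventually_at_right_field by (intro exI[of _ "r + d"]) auto
    qed
    then show ?thesis by simp
  qed
  moreover have "continuous_on {0<..<b} u"
    using b(2) by (intro continuous_at_imp_continuous_on) auto
  ultimately show ?thesis using b(1) \<sigma>(1) by blast
qed

section \<open>A desingularizing function\<close>

text \<open>The lexicographically smallest element of each fibre.\<close>

lemma sa_compact_selection:
  fixes Q :: "real \<Rightarrow> 'a::euclidean_space \<Rightarrow> bool"
  assumes Q: "sa (\<lambda>p. Q (fst p) (snd p))" and cQ: "\<And>t. compact {x. Q t x}"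
  shows "\<exists>x. sa_fun x \<and> (\<forall>t. (\<exists>v. Q t v) \<longrightarrow> Q t (x t)) \<and> (\<forall>t. (\<forall>v. \<not> Q t v) \<longrightarrow> x t = 0)"
proof -
  \<comment> \<open>\<open>R\<close> shrinks the fibres to minimizers of the coordinates in
    \<open>B\<close>, one after the other. Compactness belongs to the invariant because the next
    minimum must be attained.\<close>
  have "\<exists>R. sa (\<lambda>p. R (fst p) (snd p)) \<and> (\<forall>t. compact {x. R t x}) \<and> (\<forall>t. (\<exists>v. Q t v) \<longrightarrow> (\<exists>v. R t v)) \<and>
      (\<forall>t v. R t v \<longrightarrow> Q t v) \<and> (\<forall>b\<in>B. \<forall>t v w. R t v \<longrightarrow> R t w \<longrightarrow> v \<bullet> b = w \<bullet> b)" if "finite B" for B :: "'a set"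
    using that
  proof (induction B rule: finite_induct)
    case empty
    show ?case by (rule exI[of _ Q]) (use Q cQ in auto)
  next
    case (insert b B)
    then obtain R where R: "sa (\<lambda>p. R (fst p) (snd p))" "\<And>t. compact {x. R t x}" "\<And>t. (\<exists>v. Q t v) \<Longrightarrow> (\<exists>v. R t v)"
      "\<And>t v. R t v \<Longrightarrow> Q t v" "\<And>b t v w. b \<in> B \<Longrightarrow> R t v \<Longrightarrow> R t w \<Longrightarrow> v \<bullet> b = w \<bullet> b" by blast
    define S where "S t x \<longleftrightarrow> R t x \<and> (\<forall>y. R t y \<longrightarrow> x \<bullet> b \<le> y \<bullet> b)" for t x
    have inf: "\<exists>x. S t x" if ne: "\<exists>v. R t v" for t
    proof -
      have "\<exists>x\<in>{x. R t x}. \<forall>y\<in>{x. R t x}. x \<bullet> b \<le> y \<bullet> b"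
        using ne by (intro continuous_attains_inf R(2) continuous_intros) auto
      then show ?thesis by (auto simp: S_def)
    qed
    have "polynomial_function (\<lambda>q::(real \<times> 'a) \<times> 'a. (fst (fst q), snd q))" by (intro pf_intros)
    from sa_comp[OF R(1) this] have R': "sa (\<lambda>q::(real \<times> 'a) \<times> 'a. R (fst (fst q)) (snd q))" by simp
    have S1: "sa (\<lambda>p. S (fst p) (snd p))"
      unfolding S_def by (intro sa_conj R(1) sa_all sa_imp R' sa_leq pf_intros)
    have S2: "compact {x. S t x}" for t
    proof (cases "\<exists>v. R t v")
      case True
      then obtain x0 where x0: "S t x0" using inf by blast
      have "{x. S t x} = {x. R t x} \<inter> {x. x \<bullet> b \<le> x0 \<bullet> b}"
        using x0 by (auto simp: S_def intro: order_trans)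
      moreover have "closed {x. x \<bullet> b \<le> x0 \<bullet> b}" by (intro closed_Collect_le continuous_intros)
      ultimately show ?thesis using compact_Int_closed[OF R(2)] by simp
    qed (simp add: S_def)
    have S3: "v \<bullet> c = w \<bullet> c" if "c \<in> insert b B" "S t v" "S t w" for c t v w
      using that R(5)[of c t v w] by (auto simp: S_def intro: antisym)
    have S4: "\<exists>v. S t v" if "\<exists>v. Q t v" for t using inf[OF R(3)[OF that]] .
    have S5: "Q t v" if "S t v" for t v using that R(4) by (simp add: S_def)
    show ?case
      by (intro exI[of _ S] conjI allI impI ballI S1 S2) (use S3 S4 S5 in blast)+
  qed
  from this[OF finite_Basis] obtain R where R: "sa (\<lambda>p. R (fst p) (snd p))" "\<And>t. (\<exists>v. Q t v) \<Longrightarrow> (\<exists>v. R t v)"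
      "\<And>t v. R t v \<Longrightarrow> Q t v" "\<And>b t v w. b \<in> Basis \<Longrightarrow> R t v \<Longrightarrow> R t w \<Longrightarrow> v \<bullet> b = w \<bullet> b" by blast
  have uniq: "v = w" if "R t v" "R t w" for t v w
    using R(4)[OF _ that] by (auto intro: euclidean_eqI)
  \<comment> \<open>The default \<open>0\<close> on empty fibres makes the selection total and keeps
    it bounded when the fibres are uniformly bounded.\<close>
  define x where "x t = (if \<exists>v. R t v then SOME v. R t v else 0)" for t
  have x1: "R t (x t)" if "\<exists>v. R t v" for t
    using someI_ex[OF that] that by (simp add: x_def)
  have "x t = v \<longleftrightarrow> R t v \<or> (\<not> (\<exists>w. R t w)) \<and> v = 0" for t v
    using x1 uniq by (auto simp: x_def)
  moreover have "polynomial_function (\<lambda>q::(real \<times> 'a) \<times> 'a. (fst (fst q), snd q))" by (intro pf_intros)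
  from sa_comp[OF R(1) this] have R': "sa (\<lambda>q::(real \<times> 'a) \<times> 'a. R (fst (fst q)) (snd q))" by simp
  have "sa (\<lambda>p. R (fst p) (snd p) \<or> (\<not> (\<exists>w. R (fst p) w)) \<and> snd p = 0)"
    by (intro sa_disj R(1) sa_conj sa_not sa_ex R' sa_equal pf_intros)
  ultimately have "sa_fun x" by (simp add: sa_fun_def)
  moreover have "Q t (x t)" if "\<exists>v. Q t v" for t using R(3) x1 R(2)[OF that] by blast
  moreover have "x t = 0" if "\<forall>v. \<not> Q t v" for t using that R(3) by (auto simp: x_def)
  ultimately show ?thesis by blast
qed

text \<open>The l^1 norm makes lengths additive: for coordinates monotone with signs
  \<open>\<sigma> c\<close>, increments of the signed sum are exactly the l^1 norms of increments of
  \<open>x\<close>.\<close>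

lemma sa_fun_eventually_monotone_vec:
  fixes x :: "real \<Rightarrow> 'a::euclidean_space"
  assumes x: "sa_fun x" and bd: "\<And>t. norm (x t) \<le> B"
  shows "\<exists>b>0. \<exists>\<psi>. continuous_on {0<..<b} x \<and> continuous_on {0<..<b} \<psi> \<and> (\<forall>t. \<bar>\<psi> t\<bar> \<le> real DIM('a) * B) \<and>
     (\<forall>s t. 0 < s \<and> s \<le> t \<and> t < b \<longrightarrow> norm (x t - x s) \<le> \<psi> t - \<psi> s)"
proof -
  have su: "sa_fun (\<lambda>t. x t \<bullet> c)" for c
    unfolding sa_fun_def
    by (intro sa_fun_subst[OF x, where P = "\<lambda>p v. v \<bullet> c = snd p"] sa_equal pf_intros)
  have bc: "\<bar>x t \<bullet> c\<bar> \<le> B" if "c \<in> Basis" for t c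
    using Basis_le_norm[OF that, of "x t"] bd[of t] by linarith
  define \<Phi> where "\<Phi> c b \<sigma> \<longleftrightarrow> b > 0 \<and> \<sigma> \<in> {-1,1} \<and> continuous_on {0<..<b} (\<lambda>t. x t \<bullet> c) \<and>
      (\<forall>s t. 0 < s \<and> s \<le> t \<and> t < b \<longrightarrow> \<sigma> * (x s \<bullet> c) \<le> \<sigma> * (x t \<bullet> c))" for c and b \<sigma> :: real
  have "\<exists>b \<sigma>. \<Phi> c b \<sigma>" if "c \<in> Basis" for c
    unfolding \<Phi>_def using sa_fun_eventually_monotone[OF su bc[OF that]] by blast
  then obtain \<beta> \<sigma> where \<Phi>: "\<And>c. c \<in> Basis \<Longrightarrow> \<Phi> c (\<beta> c) (\<sigma> c)" by metis
  then have \<beta>: "\<And>c. c \<in> Basis \<Longrightarrow> \<beta> c > (0::real)" and \<sigma>: "\<And>c. c \<in> Basis \<Longrightarrow> \<sigma> c \<in> {-1, 1::real}"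
    and ct: "\<And>c. c \<in> Basis \<Longrightarrow> continuous_on {0<..<\<beta> c} (\<lambda>t. x t \<bullet> c)"
    and mn: "\<And>c s t. c \<in> Basis \<Longrightarrow> 0 < s \<Longrightarrow> s \<le> t \<Longrightarrow> t < \<beta> c \<Longrightarrow> \<sigma> c * (x s \<bullet> c) \<le> \<sigma> c * (x t \<bullet> c)"
    unfolding \<Phi>_def by blast+
  define b where "b = Min (\<beta> ` Basis)"
  have b0: "b > 0" using \<beta> by (auto simp: b_def)
  have bb: "b \<le> \<beta> c" if "c \<in> Basis" for c using that by (simp add: b_def)
  define \<psi> where "\<psi> t = (\<Sum>c\<in>Basis. \<sigma> c * (x t \<bullet> c))" for t
  have ct': "continuous_on {0<..<b} (\<lambda>t. x t \<bullet> c)" if "c \<in> Basis" for c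
    by (rule continuous_on_subset[OF ct[OF that]]) (use bb[OF that] in auto)
  have "continuous_on {0<..<b} (\<lambda>t. \<Sum>c\<in>Basis. (x t \<bullet> c) *\<^sub>R c)"
    by (intro continuous_intros ct')
  then have "continuous_on {0<..<b} x" by (simp add: euclidean_representation)
  moreover have "continuous_on {0<..<b} \<psi>"
    unfolding \<psi>_def by (intro continuous_intros ct')
  moreover have "\<bar>\<psi> t\<bar> \<le> real DIM('a) * B" for t
  proof -
    have "\<bar>\<psi> t\<bar> \<le> (\<Sum>c\<in>(Basis::'a set). B)" unfolding \<psi>_def
    proof (rule order_trans[OF sum_abs], rule sum_mono)
      fix c :: 'a assume c: "c \<in> Basis"
      show "\<bar>\<sigma> c * (x t \<bullet> c)\<bar> \<le> B" using \<sigma>[OF c] bc[OF c, of t] by (auto simp: abs_mult)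
    qed
    then show ?thesis by simp
  qed
  moreover have "norm (x t - x s) \<le> \<psi> t - \<psi> s" if st: "0 < s" "s \<le> t" "t < b" for s t
  proof -
    have "norm (x t - x s) \<le> (\<Sum>c\<in>Basis. \<bar>(x t - x s) \<bullet> c\<bar>)" by (rule norm_le_l1)
    also have "\<dots> \<le> (\<Sum>c\<in>Basis. \<sigma> c * (x t \<bullet> c) - \<sigma> c * (x s \<bullet> c))"
    proof (rule sum_mono)
      fix c :: 'a assume c: "c \<in> Basis"
      show "\<bar>(x t - x s) \<bullet> c\<bar> \<le> \<sigma> c * (x t \<bullet> c) - \<sigma> c * (x s \<bullet> c)"
        using mn[OF c st(1,2)] bb[OF c] st(3) \<sigma>[OF c] by (auto simp: inner_diff_left)
    qed
    also have "\<dots> = \<psi> t - \<psi> s" by (simp add: \<psi>_def sum_subtractf)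
    finally show ?thesis .
  qed
  ultimately show ?thesis using b0 by blast
qed

text \<open>Select \<open>x t\<close> minimizing \<open>norm (V x)\<close> on the level \<open>G x = \<alpha> + t\<close>. Its coordinates are monotone near \<open>0\<close>, hence their
  sum with suitable signs is a bounded \<open>\<psi>\<close> with \<open>norm (x t - x s) \<le> \<psi> t - \<psi> s\<close>. The Taylor estimate along \<open>x\<close> then bounds
  \<open>t - s\<close>, and no exponent is needed.\<close>

lemma KL_inequality:
  fixes G :: "'a::euclidean_space \<Rightarrow> real" and V :: "'a \<Rightarrow> 'c::euclidean_space"
  assumes K: "compact K" "sa (\<lambda>x. x \<in> K)" and G: "polynomial_function G" and V: "polynomial_function V"
    and taylor: "\<And>x y. x \<in> K \<Longrightarrow> y \<in> K \<Longrightarrow> \<bar>G y - G x\<bar> \<le> norm (V x) * norm (y - x) + M * (norm (y - x))\<^sup>2"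
    and M: "M > 0"
  shows "\<exists>b>0. \<exists>\<psi> B. continuous_on {0<..<b} \<psi> \<and> (\<forall>s t. 0 < s \<and> s \<le> t \<and> t < b \<longrightarrow> \<psi> s \<le> \<psi> t) \<and> (\<forall>t. \<bar>\<psi> t\<bar> \<le> B) \<and>
     (\<forall>t\<in>{0<..<b}. \<forall>x\<in>K. G x = \<alpha> + t \<longrightarrow> V x \<noteq> 0) \<and>
     (\<forall>t\<in>{0<..<b}. \<forall>\<^sub>F s in at_left t. \<forall>x\<in>K. G x = \<alpha> + t \<longrightarrow> t - s \<le> 2 * norm (V x) * (\<psi> t - \<psi> s))"
proof -
  \<comment> \<open>Minimizers are the worst points of a level: an estimate at \<open>x t\<close>
    holds a fortiori at every other point. The square \<open>V x \<bullet> V x\<close> replaces the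
    norm because it is polynomial.\<close>
  define Q where "Q t x \<longleftrightarrow> x \<in> K \<and> G x = \<alpha> + t \<and> (\<forall>y. y \<in> K \<and> G y = \<alpha> + t \<longrightarrow> V x \<bullet> V x \<le> V y \<bullet> V y)" for t x
  have contG: "continuous_on UNIV G" and contV: "continuous_on UNIV V"
    using G V by (auto intro: continuous_on_polymonial_function)
  have lev: "compact (K \<inter> {x. G x = \<alpha> + t})" for t
    by (intro compact_Int_closed K closed_Collect_eq contG continuous_on_const)
  have exQ: "\<exists>x. Q t x" if ne: "x \<in> K" "G x = \<alpha> + t" for x t
  proof -
    have "\<exists>x\<in>K \<inter> {x. G x = \<alpha> + t}. \<forall>y\<in>K \<inter> {x. G x = \<alpha> + t}. V x \<bullet> V x \<le> V y \<bullet> V y"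
      using ne by (intro continuous_attains_inf lev continuous_on_inner continuous_on_subset[OF contV]) auto
    then show ?thesis by (auto simp: Q_def)
  qed
  have cQ: "compact {x. Q t x}" for t
  proof (cases "\<exists>x. Q t x")
    case True
    then obtain x0 where x0: "Q t x0" by blast
    have "{x. Q t x} = (K \<inter> {x. G x = \<alpha> + t}) \<inter> {x. V x \<bullet> V x \<le> V x0 \<bullet> V x0}"
      using x0 by (auto simp: Q_def intro: order_trans)
    moreover have "closed {x. V x \<bullet> V x \<le> V x0 \<bullet> V x0}"
      by (intro closed_Collect_le continuous_on_inner contV continuous_on_const)
    ultimately show ?thesis using compact_Int_closed[OF lev] by simp
  qed simp
  have sQ: "sa (\<lambda>p. Q (fst p) (snd p))"
    unfolding Q_def
    by (intro sa_conj sa_all sa_imp sa_comp[OF K(2)] sa_equal sa_leq pf_intros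
         polynomial_function_comp[OF _ G] polynomial_function_comp[OF _ V])
  obtain x where x: "sa_fun x" "\<And>t. (\<exists>v. Q t v) \<Longrightarrow> Q t (x t)" "\<And>t. (\<forall>v. \<not> Q t v) \<Longrightarrow> x t = 0"
    using sa_compact_selection[of Q, OF sQ cQ] by blast
  obtain B0 where B0: "\<And>y. y \<in> K \<Longrightarrow> norm y \<le> B0" using compact_imp_bounded[OF K(1)] by (auto simp: bounded_iff)
  have bd: "norm (x t) \<le> \<bar>B0\<bar>" for t
  proof (cases "\<exists>v. Q t v")
    case True
    then have "x t \<in> K" using x(2) by (simp add: Q_def)
    then show ?thesis using B0 by force
  next
    case False
    then show ?thesis using x(3) by simp
  qed
  obtain b \<psi> where b: "b > 0" and cx: "continuous_on {0<..<b} x" and c\<psi>: "continuous_on {0<..<b} \<psi>"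
    and bd\<psi>: "\<And>t. \<bar>\<psi> t\<bar> \<le> real DIM('a) * \<bar>B0\<bar>"
    and inc: "\<And>s t. 0 < s \<Longrightarrow> s \<le> t \<Longrightarrow> t < b \<Longrightarrow> norm (x t - x s) \<le> \<psi> t - \<psi> s"
    using sa_fun_eventually_monotone_vec[OF x(1) bd] by blast
  have sN: "sa (\<lambda>t. \<exists>v. Q t v)"
    by (intro sa_ex sQ)
  show ?thesis
  proof (cases "\<forall>\<^sub>F t in at_right 0. \<exists>v. Q t v")
    \<comment> \<open>No level just above \<open>\<alpha>\<close> meets \<open>K\<close>, so the
      constant \<open>0\<close> serves as \<open>\<psi>\<close>.\<close>
    case False
    then have "\<forall>\<^sub>F t in at_right 0. \<not> (\<exists>v. Q t v)" using sa_eventually_at_right[OF sN] by blast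
    then obtain b' where b': "b' > 0" "\<And>t. 0 < t \<Longrightarrow> t < b' \<Longrightarrow> \<not> (\<exists>v. Q t v)"
      unfolding eventually_at_right_field by blast
    have no: "False" if "0 < t" "t < b'" "x \<in> K" "G x = \<alpha> + t" for t x using b'(2) exQ that by blast
    show ?thesis
    proof (rule exI[of _ b'], rule conjI[OF b'(1)], intro exI[of _ "\<lambda>_. 0"] exI[of _ 0] conjI ballI)
      show "\<forall>\<^sub>F s in at_left t. \<forall>x\<in>K. G x = \<alpha> + t \<longrightarrow> t - s \<le> 2 * norm (V x) * (0 - 0)" if "t \<in> {0<..<b'}" for t
        using no[of t] that by (intro always_eventually) auto
    qed (use b' no in auto)
  next
    case True
    have sV: "sa (\<lambda>t. V (x t) = 0)"
      by (intro sa_fun_subst[OF x(1), where P = "\<lambda>_ v. V v = 0"] sa_equal pf_intros polynomial_function_comp[OF _ V])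
    have est: "\<bar>t - s\<bar> \<le> norm (V (x t)) * norm (x s - x t) + M * (norm (x s - x t))\<^sup>2"
      if "Q t (x t)" "Q s (x s)" for s t
      using taylor[of "x t" "x s"] that by (simp add: Q_def abs_minus_commute)
    have near: "\<forall>\<^sub>F s in at t. norm (x s - x t) < e" if t: "0 < t" "t < b" and e: "e > 0" for t e
    proof -
      have "isCont x t" using cx t by (simp add: continuous_on_eq_continuous_at)
      then have "\<forall>\<^sub>F s in at t. dist (x s) (x t) < e" using e by (simp add: isCont_def tendsto_iff)
      then show ?thesis by (simp add: dist_norm)
    qed
    \<comment> \<open>A Sard-type argument. If \<open>V\<close> vanished along the selection,
      \<open>t - s\<close> would be at most quadratic in the increment of \<open>x\<close>, hence at
      most a small multiple of the increment of \<open>\<psi>\<close>. Over a whole interval this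
      contradicts its length.\<close>
    have not0: "\<not> (\<forall>\<^sub>F t in at_right 0. V (x t) = 0)"
    proof
      assume "\<forall>\<^sub>F t in at_right 0. V (x t) = 0"
      with True have "\<forall>\<^sub>F t in at_right 0. Q t (x t) \<and> V (x t) = 0"
        by eventually_elim (use x(2) in blast)
      then obtain b1 where b1: "b1 > 0" "\<And>t. 0 < t \<Longrightarrow> t < b1 \<Longrightarrow> Q t (x t) \<and> V (x t) = 0"
        unfolding eventually_at_right_field by blast
      define d where "d = min b b1"
      have d: "d > 0" "d \<le> b" "d \<le> b1" using b b1 by (auto simp: d_def)
      define a c where "a = d / 3" and "c = 2 * d / 3"
      have ac: "0 < a" "a < c" "c < d" using d by (auto simp: a_def c_def)
      have \<psi>ac: "0 \<le> \<psi> c - \<psi> a" using inc[of a c] ac d by (smt (verit) norm_ge_zero)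
      \<comment> \<open>Small enough that \<open>k\<close> times the total increase of
        \<open>\<psi>\<close> stays below \<open>c - a\<close>. The added \<open>1\<close> keeps the
        denominator positive.\<close>
      define k where "k = (c - a) / (2 * (\<psi> c - \<psi> a + 1))"
      have k: "k > 0" using ac \<psi>ac by (simp add: k_def)
      have "c - k * \<psi> c \<le> a - k * \<psi> a"
      proof (rule nonincreasing_of_local[where f = "\<lambda>t. t - k * \<psi> t"])
        show "a \<le> c" using ac by simp
        show "continuous_on {a..c} (\<lambda>t. t - k * \<psi> t)"
          by (intro continuous_intros continuous_on_subset[OF c\<psi>]) (use ac d in auto)
        fix t assume t: "a \<le> t" "t < c"
        have t': "0 < t" "t < b" "t < d" using t ac d by auto
        have "\<forall>\<^sub>F s in at_right t. norm (x s - x t) < k / M"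
          using near[OF t'(1,2), of "k / M"] k M by (simp add: eventually_at_split)
        moreover have "\<forall>\<^sub>F s in at_right t. s \<in> {t<..<d}" by (rule eventually_at_right_real) (use t' in simp)
        ultimately show "\<forall>\<^sub>F s in at_right t. s - k * \<psi> s \<le> t - k * \<psi> t"
        proof eventually_elim
          case (elim s)
          define n where "n = norm (x s - x t)"
          have "\<bar>t - s\<bar> \<le> norm (V (x t)) * norm (x s - x t) + M * (norm (x s - x t))\<^sup>2"
            by (rule est) (use b1(2)[of t] b1(2)[of s] t' elim d in auto)
          moreover have "V (x t) = 0" using b1(2)[of t] t' d by auto
          ultimately have "s - t \<le> M * n * n" using elim by (simp add: n_def power2_eq_square)
          also have "\<dots> \<le> k * n"
            using elim M by (intro mult_right_mono) (auto simp: n_def field_simps)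
          also have "\<dots> \<le> k * (\<psi> s - \<psi> t)"
            using inc[of t s] elim t' d k by (intro mult_left_mono) (auto simp: n_def)
          finally show ?case by (simp add: algebra_simps)
        qed
      qed
      then have "c - a \<le> k * (\<psi> c - \<psi> a)" by (simp add: algebra_simps)
      also have "\<dots> < k * (2 * (\<psi> c - \<psi> a + 1))" using k \<psi>ac by (intro mult_strict_left_mono) auto
      also have "\<dots> = c - a" using \<psi>ac by (simp add: k_def)
      finally show False by simp
    qed
    then have "\<forall>\<^sub>F t in at_right 0. V (x t) \<noteq> 0" using sa_eventually_at_right[OF sV] by blast
    with True have "\<forall>\<^sub>F t in at_right 0. Q t (x t) \<and> V (x t) \<noteq> 0"
      by eventually_elim (use x(2) in blast)
    then obtain b1 where b1: "b1 > 0" "\<And>t. 0 < t \<Longrightarrow> t < b1 \<Longrightarrow> Q t (x t) \<and> V (x t) \<noteq> 0"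
      unfolding eventually_at_right_field by blast
    define d where "d = min b b1"
    have d: "d > 0" "d \<le> b" "d \<le> b1" using b b1 by (auto simp: d_def)
    have minV: "norm (V (x t)) \<le> norm (V y)" if "0 < t" "t < d" "y \<in> K" "G y = \<alpha> + t" for t y
      using b1(2)[of t] that d by (auto simp: Q_def norm_le)
    show ?thesis
    proof (rule exI[of _ d], rule conjI[OF d(1)], intro exI[of _ \<psi>] exI[of _ "real DIM('a) * \<bar>B0\<bar>"] conjI ballI)
      show "continuous_on {0<..<d} \<psi>" by (rule continuous_on_subset[OF c\<psi>]) (use d in auto)
      show "\<forall>s t. 0 < s \<and> s \<le> t \<and> t < d \<longrightarrow> \<psi> s \<le> \<psi> t"
      proof (intro allI impI)
        fix s t assume "0 < s \<and> s \<le> t \<and> t < d"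
        then have "norm (x t - x s) \<le> \<psi> t - \<psi> s" using inc d by simp
        then show "\<psi> s \<le> \<psi> t" using norm_ge_zero[of "x t - x s"] by linarith
      qed
      show "\<forall>t. \<bar>\<psi> t\<bar> \<le> real DIM('a) * \<bar>B0\<bar>" using bd\<psi> by blast
      fix t assume t: "t \<in> {0<..<d}"
      show "G y = \<alpha> + t \<longrightarrow> V y \<noteq> 0" if "y \<in> K" for y
        using minV[of t y] that t b1(2)[of t] d by auto
      \<comment> \<open>Within this distance the quadratic Taylor term is at most the linear one,
        which accounts for the factor \<open>2\<close> in the conclusion.\<close>
      define e where "e = norm (V (x t)) / M"
      have e: "e > 0" using b1(2)[of t] t d M by (simp add: e_def)
      have "\<forall>\<^sub>F s in at_left t. norm (x s - x t) < e"
        using near[of t e] t d e by (simp add: eventually_at_split)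
      moreover have "\<forall>\<^sub>F s in at_left t. s \<in> {0<..<t}" by (rule eventually_at_left_real) (use t in simp)
      ultimately show "\<forall>\<^sub>F s in at_left t. \<forall>y\<in>K. G y = \<alpha> + t \<longrightarrow> t - s \<le> 2 * norm (V y) * (\<psi> t - \<psi> s)"
      proof eventually_elim
        case (elim s)
        define n where "n = norm (x s - x t)"
        have s: "0 < s" "s < t" using elim by auto
        have n: "n \<le> \<psi> t - \<psi> s" using inc[of s t] s t d by (simp add: n_def norm_minus_commute)
        show ?case
        proof (intro ballI impI)
          fix y assume y: "y \<in> K" "G y = \<alpha> + t"
          have "\<bar>t - s\<bar> \<le> norm (V (x t)) * norm (x s - x t) + M * (norm (x s - x t))\<^sup>2"
            by (rule est) (use b1(2)[of t] b1(2)[of s] t s d in auto)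
          then have "t - s \<le> norm (V (x t)) * n + M * n * n" by (simp add: n_def power2_eq_square)
          also have "M * n * n \<le> norm (V (x t)) * n"
            using elim M by (intro mult_right_mono) (auto simp: n_def e_def field_simps)
          finally have "t - s \<le> 2 * norm (V (x t)) * n" by (simp add: mult.commute mult.left_commute)
          also have "\<dots> \<le> 2 * norm (V y) * (\<psi> t - \<psi> s)"
            using minV[of t y] y t n by (intro mult_mono) (auto simp: n_def)
          finally show "t - s \<le> 2 * norm (V y) * (\<psi> t - \<psi> s)" .
        qed
      qed
    qed
  qed
qed

section \<open>Gradients and Taylor estimates of polynomials\<close>

lemma real_polynomial_function_gradient:
  fixes g :: "'a::euclidean_space \<Rightarrow> real"
  assumes "real_polynomial_function g"
  shows "\<exists>D. polynomial_function D \<and> (\<forall>x. (g has_derivative (\<lambda>h. D x \<bullet> h)) (at x))"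
  using assms
proof (induction rule: real_polynomial_function.induct)
  case (linear f)
  have "f h = adjoint f 1 \<bullet> h" for h
    using adjoint_works[OF bounded_linear.linear[OF linear], of h 1] by (simp add: inner_commute)
  then have "(f has_derivative (\<lambda>h. adjoint f 1 \<bullet> h)) (at x)" for x
    using bounded_linear_imp_has_derivative[OF linear] by (metis (no_types, lifting) ext)
  then show ?case by (intro exI[of _ "\<lambda>x. adjoint f 1"]) (auto intro: pf_intros)
next
  case (const c)
  show ?case by (intro exI[of _ "\<lambda>x. 0"]) (auto intro: pf_intros)
next
  case (add f g)
  then obtain D E where D: "polynomial_function D" "\<And>x. (f has_derivative (\<lambda>h. D x \<bullet> h)) (at x)"
    and E: "polynomial_function E" "\<And>x. (g has_derivative (\<lambda>h. E x \<bullet> h)) (at x)" by blast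
  have "((\<lambda>x. f x + g x) has_derivative (\<lambda>h. (D x + E x) \<bullet> h)) (at x)" for x
    using has_derivative_add[OF D(2) E(2), of x] by (simp add: inner_add_left)
  then show ?case using D(1) E(1) by (intro exI[of _ "\<lambda>x. D x + E x"]) (auto intro: pf_intros)
next
  case (mult f g)
  then obtain D E where D: "polynomial_function D" "\<And>x. (f has_derivative (\<lambda>h. D x \<bullet> h)) (at x)"
    and E: "polynomial_function E" "\<And>x. (g has_derivative (\<lambda>h. E x \<bullet> h)) (at x)" by blast
  have "((\<lambda>x. f x * g x) has_derivative (\<lambda>h. (f x *\<^sub>R E x + g x *\<^sub>R D x) \<bullet> h)) (at x)" for x
    using has_derivative_mult[OF D(2) E(2), of x] by (simp add: inner_add_left mult.commute)
  moreover have "polynomial_function (\<lambda>x. f x *\<^sub>R E x + g x *\<^sub>R D x)"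
    using mult.hyps D(1) E(1) by (intro pf_intros) (auto simp: real_polynomial_function_eq)
  ultimately show ?case by blast
qed

lemma real_polynomial_function_Lipschitz:
  fixes g :: "'a::euclidean_space \<Rightarrow> real"
  assumes "real_polynomial_function g"
  shows "\<exists>L\<ge>0. \<forall>x\<in>cball 0 R. \<forall>y\<in>cball 0 R. \<bar>g x - g y\<bar> \<le> L * norm (x - y)"
proof -
  obtain D where D: "polynomial_function D" "\<And>x. (g has_derivative (\<lambda>h. D x \<bullet> h)) (at x)"
    using real_polynomial_function_gradient[OF assms] by blast
  have "bounded (D ` cball 0 R)"
    using D(1) by (intro compact_imp_bounded compact_continuous_image compact_cball continuous_on_polymonial_function)
  then obtain L where L: "L > 0" "\<And>x. x \<in> cball 0 R \<Longrightarrow> norm (D x) \<le> L" by (auto simp: bounded_pos)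
  have "norm (g x - g y) \<le> L * norm (x - y)" if "x \<in> cball 0 R" "y \<in> cball 0 R" for x y
  proof (rule differentiable_bound[OF convex_cball])
    show "(g has_derivative (\<lambda>h. D z \<bullet> h)) (at z within cball 0 R)" for z
      using D(2) has_derivative_at_withinI by blast
    show "onorm (\<lambda>h. D z \<bullet> h) \<le> L" if "z \<in> cball 0 R" for z
    proof (rule onorm_le)
      fix h :: 'a
      have "norm (D z) * norm h \<le> L * norm h" using L(2)[OF that] by (intro mult_right_mono) auto
      then show "norm (D z \<bullet> h) \<le> L * norm h" using Cauchy_Schwarz_ineq2[of "D z" h] by simp
    qed
  qed (use that in auto)
  then show ?thesis using L(1) by (intro exI[of _ L]) auto
qed

lemma polynomial_function_Lipschitz:
  fixes D :: "'a::euclidean_space \<Rightarrow> 'b::euclidean_space"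
  assumes "polynomial_function D"
  shows "\<exists>L\<ge>0. \<forall>x\<in>cball 0 R. \<forall>y\<in>cball 0 R. norm (D x - D y) \<le> L * norm (x - y)"
proof -
  have "\<forall>b\<in>Basis. \<exists>L\<ge>0. \<forall>x\<in>cball 0 R. \<forall>y\<in>cball 0 R. \<bar>D x \<bullet> b - D y \<bullet> b\<bar> \<le> L * norm (x - y)"
    using assms by (intro ballI real_polynomial_function_Lipschitz) (simp add: polynomial_function_iff_Basis_inner)
  then obtain L where L: "\<And>b. b \<in> Basis \<Longrightarrow> L b \<ge> 0"
    "\<And>b x y. b \<in> Basis \<Longrightarrow> x \<in> cball 0 R \<Longrightarrow> y \<in> cball 0 R \<Longrightarrow> \<bar>D x \<bullet> b - D y \<bullet> b\<bar> \<le> L b * norm (x - y)"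
    by metis
  have "norm (D x - D y) \<le> (\<Sum>b\<in>Basis. L b) * norm (x - y)" if "x \<in> cball 0 R" "y \<in> cball 0 R" for x y
  proof -
    have "norm (D x - D y) \<le> (\<Sum>b\<in>Basis. \<bar>(D x - D y) \<bullet> b\<bar>)" by (rule norm_le_l1)
    also have "\<dots> \<le> (\<Sum>b\<in>Basis. L b * norm (x - y))"
      using L(2)[OF _ that] by (intro sum_mono) (simp add: inner_diff_left)
    finally show ?thesis by (simp add: sum_distrib_right)
  qed
  then show ?thesis using L(1) by (intro exI[of _ "\<Sum>b\<in>Basis. L b"]) (auto intro: sum_nonneg)
qed

lemma gradient_taylor:
  fixes g :: "'a::euclidean_space \<Rightarrow> real"
  assumes D: "polynomial_function D" "\<And>x. (g has_derivative (\<lambda>h. D x \<bullet> h)) (at x)"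
  shows "\<exists>L\<ge>0. \<forall>x\<in>cball 0 R. \<forall>y\<in>cball 0 R. \<bar>g y - g x - D x \<bullet> (y - x)\<bar> \<le> L * (norm (y - x))\<^sup>2"
proof -
  obtain L where L: "L \<ge> 0" "\<And>x y. x \<in> cball 0 R \<Longrightarrow> y \<in> cball 0 R \<Longrightarrow> norm (D x - D y) \<le> L * norm (x - y)"
    using polynomial_function_Lipschitz[OF D(1)] by blast
  have "\<bar>g y - g x - D x \<bullet> (y - x)\<bar> \<le> L * (norm (y - x))\<^sup>2" if xy: "x \<in> cball 0 R" "y \<in> cball 0 R" for x y
  proof -
    \<comment> \<open>Intersecting with the ball around \<open>x\<close> bounds the change of
      \<open>D\<close> on \<open>S\<close> by \<open>L * norm (y - x)\<close>. The mean value bound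
      supplies the second factor \<open>norm (y - x)\<close>.\<close>
    define S where "S = cball 0 R \<inter> cball x (norm (y - x))"
    have "norm ((g y - D x \<bullet> y) - (g x - D x \<bullet> x)) \<le> (L * norm (y - x)) * norm (y - x)"
    proof (rule differentiable_bound[where S = S])
      show "convex S" unfolding S_def by (intro convex_Int convex_cball)
      show "((\<lambda>w. g w - D x \<bullet> w) has_derivative (\<lambda>h. (D w - D x) \<bullet> h)) (at w within S)" for w
      proof -
        have "((\<lambda>w. g w - D x \<bullet> w) has_derivative (\<lambda>h. D w \<bullet> h - D x \<bullet> h)) (at w)"
          by (intro has_derivative_diff D(2) bounded_linear_imp_has_derivative bounded_linear_inner_right)
        then have "((\<lambda>w. g w - D x \<bullet> w) has_derivative (\<lambda>h. (D w - D x) \<bullet> h)) (at w)"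
          by (simp only: inner_diff_left)
        then show ?thesis by (rule has_derivative_at_withinI)
      qed
      show "onorm (\<lambda>h. (D w - D x) \<bullet> h) \<le> L * norm (y - x)" if w: "w \<in> S" for w
      proof (rule onorm_le)
        fix h :: 'a
        have "norm (D w - D x) \<le> L * norm (w - x)" using w xy by (intro L(2)) (auto simp: S_def)
        also have "\<dots> \<le> L * norm (y - x)"
          using w L(1) by (intro mult_left_mono) (auto simp: S_def dist_norm norm_minus_commute)
        finally have "norm (D w - D x) * norm h \<le> L * norm (y - x) * norm h" by (intro mult_right_mono) auto
        then show "norm ((D w - D x) \<bullet> h) \<le> L * norm (y - x) * norm h"
          using Cauchy_Schwarz_ineq2[of "D w - D x" h] by simp
      qed
    qed (use xy in \<open>auto simp: S_def dist_norm norm_minus_commute\<close>)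
    then show ?thesis by (simp add: power2_eq_square inner_diff_right algebra_simps)
  qed
  then show ?thesis using L(1) by blast
qed

text \<open>At unit vectors this is the spherical gradient of a function with Euclidean gradient
  \<open>D\<close>. The formula is used on the whole space, where it stays polynomial if
  \<open>D\<close> is.\<close>

definition tangential :: "('a::euclidean_space \<Rightarrow> 'a) \<Rightarrow> 'a \<Rightarrow> 'a" where
  "tangential D x = D x - (D x \<bullet> x) *\<^sub>R x"

text \<open>A chord of the sphere is tangential up to second order, as
  \<open>x \<bullet> (y - x) = - (norm (y - x))^2 / 2\<close>. Discarding the radial part of the
  gradient therefore costs only a quadratic term.\<close>

lemma tangential_taylor:
  fixes g :: "'a::euclidean_space \<Rightarrow> real"
  assumes D: "polynomial_function D" "\<And>x. (g has_derivative (\<lambda>h. D x \<bullet> h)) (at x)"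
  shows "\<exists>M\<ge>0. \<forall>x\<in>sphere 0 1. \<forall>y\<in>sphere 0 1. \<bar>g y - g x\<bar> \<le> norm (tangential D x) * norm (y - x) + M * (norm (y - x))\<^sup>2"
proof -
  obtain L where L: "L \<ge> 0" "\<And>x y. x \<in> cball 0 1 \<Longrightarrow> y \<in> cball 0 1 \<Longrightarrow> \<bar>g y - g x - D x \<bullet> (y - x)\<bar> \<le> L * (norm (y - x))\<^sup>2"
    using gradient_taylor[OF D, of 1] by blast
  have "bounded (D ` sphere 0 1)"
    using D(1) by (intro compact_imp_bounded compact_continuous_image compact_sphere continuous_on_polymonial_function)
  then obtain B where B: "B > 0" "\<And>x. x \<in> sphere 0 1 \<Longrightarrow> norm (D x) \<le> B" by (auto simp: bounded_pos)
  have "\<bar>g y - g x\<bar> \<le> norm (tangential D x) * norm (y - x) + (L + B) * (norm (y - x))\<^sup>2"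
    if xy: "x \<in> sphere 0 1" "y \<in> sphere 0 1" for x y
  proof -
    have nx: "x \<bullet> x = 1" "y \<bullet> y = 1" using xy by (simp_all add: dot_square_norm)
    have "(norm (y - x))\<^sup>2 = 2 - 2 * (x \<bullet> y)"
      unfolding power2_norm_eq_inner using nx by (simp add: inner_diff_left inner_diff_right inner_commute)
    moreover have "x \<bullet> (y - x) = x \<bullet> y - 1" using nx by (simp add: inner_diff_right)
    ultimately have "x \<bullet> (y - x) = - ((norm (y - x))\<^sup>2 / 2)" by (simp add: field_simps)
    then have ip: "\<bar>x \<bullet> (y - x)\<bar> \<le> (norm (y - x))\<^sup>2" by simp
    have "D x \<bullet> (y - x) = tangential D x \<bullet> (y - x) + (D x \<bullet> x) * (x \<bullet> (y - x))"
      by (simp add: tangential_def inner_diff_left)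
    moreover have "\<bar>tangential D x \<bullet> (y - x)\<bar> \<le> norm (tangential D x) * norm (y - x)"
      by (rule Cauchy_Schwarz_ineq2)
    moreover have "\<bar>(D x \<bullet> x) * (x \<bullet> (y - x))\<bar> \<le> B * (norm (y - x))\<^sup>2"
    proof -
      have "\<bar>D x \<bullet> x\<bar> \<le> B" using Cauchy_Schwarz_ineq2[of "D x" x] B(2)[OF xy(1)] xy(1) by simp
      then show ?thesis unfolding abs_mult using ip B(1) by (intro mult_mono) auto
    qed
    moreover have "\<bar>g y - g x - D x \<bullet> (y - x)\<bar> \<le> L * (norm (y - x))\<^sup>2" using L(2) xy by simp
    ultimately show ?thesis by (simp add: distrib_right)
  qed
  then show ?thesis using L(1) B(1) by (intro exI[of _ "L + B"]) auto
qed

text \<open>The extra variable \<open>v\<close> will absorb a decaying forcing term.\<close>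

lemma sphere_KL:
  fixes g :: "'a::euclidean_space \<Rightarrow> real"
  assumes g: "polynomial_function g" and D: "polynomial_function D" "\<And>x. (g has_derivative (\<lambda>h. D x \<bullet> h)) (at x)"
  shows "\<exists>b>0. \<exists>\<psi> B. continuous_on {0<..<b} \<psi> \<and> (\<forall>s t. 0 < s \<and> s \<le> t \<and> t < b \<longrightarrow> \<psi> s \<le> \<psi> t) \<and> (\<forall>t. \<bar>\<psi> t\<bar> \<le> B) \<and>
     (\<forall>t\<in>{0<..<b}. \<forall>x\<in>sphere 0 1. g x = \<alpha> + t \<longrightarrow> tangential D x \<noteq> 0) \<and>
     (\<forall>t\<in>{0<..<b}. \<forall>\<^sub>F s in at_left t. \<forall>x\<in>sphere 0 1. \<forall>v\<in>{-1..1}. g x + v\<^sup>2 = \<alpha> + t \<longrightarrow>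
         t - s \<le> 2 * norm (tangential D x, 2 * v) * (\<psi> t - \<psi> s))"
proof -
  obtain M where M: "M \<ge> 0" "\<And>x y. x \<in> sphere 0 1 \<Longrightarrow> y \<in> sphere 0 1 \<Longrightarrow> \<bar>g y - g x\<bar> \<le> norm (tangential D x) * norm (y - x) + M * (norm (y - x))\<^sup>2"
    using tangential_taylor[OF D] by blast
  \<comment> \<open>The range of \<open>v\<close> is cut to an interval to make \<open>K\<close>
    compact. The application uses only small values of \<open>v\<close>.\<close>
  define K where "K = sphere (0::'a) 1 \<times> {-1..1::real}"
  define G where "G z = g (fst z) + snd z * snd z" for z :: "'a \<times> real"
  define V where "V z = (tangential D (fst z), 2 * snd z)" for z :: "'a \<times> real"
  have T: "polynomial_function (tangential D)"
    unfolding tangential_def[abs_def] by (intro pf_intros D(1))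
  have "\<exists>b>0. \<exists>\<psi> B. continuous_on {0<..<b} \<psi> \<and> (\<forall>s t. 0 < s \<and> s \<le> t \<and> t < b \<longrightarrow> \<psi> s \<le> \<psi> t) \<and> (\<forall>t. \<bar>\<psi> t\<bar> \<le> B) \<and>
     (\<forall>t\<in>{0<..<b}. \<forall>x\<in>K. G x = \<alpha> + t \<longrightarrow> V x \<noteq> 0) \<and>
     (\<forall>t\<in>{0<..<b}. \<forall>\<^sub>F s in at_left t. \<forall>x\<in>K. G x = \<alpha> + t \<longrightarrow> t - s \<le> 2 * norm (V x) * (\<psi> t - \<psi> s))"
  proof (rule KL_inequality[where M = "M + 1"])
    show "compact K" unfolding K_def by (intro compact_Times compact_sphere compact_Icc)
    have "x \<in> K \<longleftrightarrow> fst x \<bullet> fst x = 1 \<and> -1 \<le> snd x \<and> snd x \<le> 1" for x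
      by (cases x) (auto simp: K_def norm_eq_sqrt_inner real_sqrt_eq_1_iff)
    moreover have "sa (\<lambda>x::'a \<times> real. fst x \<bullet> fst x = 1 \<and> -1 \<le> snd x \<and> snd x \<le> 1)"
      by (intro sa_conj sa_equal sa_leq pf_intros)
    ultimately show "sa (\<lambda>x. x \<in> K)" by simp
    show "polynomial_function G" unfolding G_def[abs_def] by (intro pf_intros polynomial_function_comp[OF _ g])
    show "polynomial_function V" unfolding V_def[abs_def] by (intro pf_intros polynomial_function_comp[OF _ T])
    show "M + 1 > 0" using M(1) by simp
    fix x y assume xy: "x \<in> K" "y \<in> K"
    define d1 where "d1 = norm (fst y - fst x)"
    define d2 where "d2 = \<bar>snd y - snd x\<bar>"
    have nn: "norm (y - x) = sqrt (d1\<^sup>2 + d2\<^sup>2)" by (simp add: norm_prod_def d1_def d2_def)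
    have nV: "norm (V x) = sqrt ((norm (tangential D (fst x)))\<^sup>2 + (2 * snd x)\<^sup>2)" by (simp add: norm_prod_def V_def)
    have "\<bar>g (fst y) - g (fst x)\<bar> \<le> norm (tangential D (fst x)) * d1 + M * d1\<^sup>2"
      unfolding d1_def using xy by (intro M(2)) (auto simp: K_def)
    moreover have "\<bar>snd y * snd y - snd x * snd x\<bar> \<le> \<bar>2 * snd x\<bar> * d2 + d2\<^sup>2"
    proof -
      have "snd y * snd y - snd x * snd x = 2 * snd x * (snd y - snd x) + (snd y - snd x)\<^sup>2"
        by (simp add: power2_eq_square algebra_simps)
      then have "\<bar>snd y * snd y - snd x * snd x\<bar> \<le> \<bar>2 * snd x * (snd y - snd x)\<bar> + \<bar>(snd y - snd x)\<^sup>2\<bar>"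
        by (simp only: abs_triangle_ineq)
      then show ?thesis by (simp add: d2_def abs_mult)
    qed
    ultimately have "\<bar>G y - G x\<bar> \<le> (norm (tangential D (fst x)) * d1 + \<bar>2 * snd x\<bar> * d2) + (M * d1\<^sup>2 + d2\<^sup>2)"
      unfolding G_def by linarith
    also have "norm (tangential D (fst x)) * d1 + \<bar>2 * snd x\<bar> * d2 \<le> norm (V x) * norm (y - x)"
    proof -
      have "(norm (tangential D (fst x)), \<bar>2 * snd x\<bar>) \<bullet> (d1, d2) \<le> norm (norm (tangential D (fst x)), \<bar>2 * snd x\<bar>) * norm (d1, d2)"
        by (rule norm_cauchy_schwarz)
      then show ?thesis unfolding nn nV by (simp add: norm_prod_def)
    qed
    also have "M * d1\<^sup>2 + d2\<^sup>2 \<le> (M + 1) * (norm (y - x))\<^sup>2"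
      using M(1) by (simp add: nn algebra_simps)
    finally show "\<bar>G y - G x\<bar> \<le> norm (V x) * norm (y - x) + (M + 1) * (norm (y - x))\<^sup>2" by simp
  qed
  then obtain b \<psi> B where *: "b > 0" "continuous_on {0<..<b} \<psi>" "\<forall>s t. 0 < s \<and> s \<le> t \<and> t < b \<longrightarrow> \<psi> s \<le> \<psi> t" "\<forall>t. \<bar>\<psi> t\<bar> \<le> B"
    and V0: "\<And>t x. t \<in> {0<..<b} \<Longrightarrow> x \<in> K \<Longrightarrow> G x = \<alpha> + t \<Longrightarrow> V x \<noteq> 0"
    and ev: "\<And>t. t \<in> {0<..<b} \<Longrightarrow> \<forall>\<^sub>F s in at_left t. \<forall>x\<in>K. G x = \<alpha> + t \<longrightarrow> t - s \<le> 2 * norm (V x) * (\<psi> t - \<psi> s)"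
    by blast
  \<comment> \<open>The slice \<open>v = 0\<close> shows that the values of \<open>g\<close> just
    above \<open>\<alpha>\<close> are regular, which is the isolation of critical values.\<close>
  have "tangential D x \<noteq> 0" if "t \<in> {0<..<b}" "x \<in> sphere 0 1" "g x = \<alpha> + t" for t x
    using V0[OF that(1), of "(x, 0)"] that by (auto simp: K_def G_def V_def zero_prod_def)
  moreover have "\<forall>\<^sub>F s in at_left t. \<forall>x\<in>sphere 0 1. \<forall>v\<in>{-1..1}. g x + v\<^sup>2 = \<alpha> + t \<longrightarrow>
         t - s \<le> 2 * norm (tangential D x, 2 * v) * (\<psi> t - \<psi> s)" if "t \<in> {0<..<b}" for t
    using ev[OF that]
  proof eventually_elim
    case (elim s)
    show ?case
    proof (intro ballI impI)
      fix x v assume "x \<in> sphere (0::'a) 1" "v \<in> {-1..1::real}" "g x + v\<^sup>2 = \<alpha> + t"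
      then show "t - s \<le> 2 * norm (tangential D x, 2 * v) * (\<psi> t - \<psi> s)"
        using elim[rule_format, of "(x, v)"] by (simp add: K_def G_def V_def power2_eq_square)
    qed
  qed
  ultimately have "(\<forall>t\<in>{0<..<b}. \<forall>x\<in>sphere 0 1. g x = \<alpha> + t \<longrightarrow> tangential D x \<noteq> 0) \<and>
     (\<forall>t\<in>{0<..<b}. \<forall>\<^sub>F s in at_left t. \<forall>x\<in>sphere 0 1. \<forall>v\<in>{-1..1}. g x + v\<^sup>2 = \<alpha> + t \<longrightarrow>
         t - s \<le> 2 * norm (tangential D x, 2 * v) * (\<psi> t - \<psi> s))" by blast
  with * show ?thesis by blast
qed

section \<open>Perturbed gradient flows on the sphere\<close>

lemma has_vector_derivative_at_right_bound:
  assumes "(f has_vector_derivative f') (at t)" "e > 0"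
  shows "\<forall>\<^sub>F \<tau> in at_right t. norm (f \<tau> - f t - (\<tau> - t) *\<^sub>R f') \<le> e * (\<tau> - t)"
proof -
  obtain d where d: "d > 0" "\<And>y. norm (y - t) < d \<Longrightarrow> norm (f y - f t - (y - t) *\<^sub>R f') \<le> e * norm (y - t)"
    using assms unfolding has_vector_derivative_def has_derivative_within_alt by blast
  show ?thesis
    unfolding eventually_at_right_field
  proof (intro exI[of _ "t + d"] conjI allI impI)
    show "t < t + d" using d by simp
    fix y assume "t < y" "y < t + d"
    then show "norm (f y - f t - (y - t) *\<^sub>R f') \<le> e * (y - t)" using d(2)[of y] by simp
  qed
qed

lemma sphere_level_lower_bound:
  fixes g :: "'a::euclidean_space \<Rightarrow> real" and T :: "'a \<Rightarrow> 'a"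
  assumes g: "continuous_on (sphere 0 1) g" and T: "continuous_on (sphere 0 1) T"
    and nc: "\<And>x. x \<in> sphere 0 1 \<Longrightarrow> c \<le> g x \<Longrightarrow> g x \<le> d \<Longrightarrow> T x \<noteq> 0"
  shows "\<exists>m>0. \<forall>x\<in>sphere 0 1. c \<le> g x \<and> g x \<le> d \<longrightarrow> m \<le> norm (T x)"
proof -
  define S where "S = {x \<in> sphere 0 1. g x \<in> {c..d}}"
  have "closed (sphere 0 1 \<inter> g -` {c..d})"
    by (intro continuous_closed_preimage g closed_sphere closed_atLeastAtMost)
  moreover have "sphere 0 1 \<inter> g -` {c..d} = S" by (auto simp: S_def)
  moreover have "bounded S" by (rule bounded_subset[OF bounded_sphere[of 0 1]]) (auto simp: S_def)
  ultimately have cS: "compact S" by (simp add: compact_eq_bounded_closed)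
  show ?thesis
  proof (cases "S = {}")
    case True
    then show ?thesis by (intro exI[of _ 1]) (auto simp: S_def)
  next
    case False
    have "continuous_on S (\<lambda>x. norm (T x))"
      by (intro continuous_intros continuous_on_subset[OF T]) (auto simp: S_def)
    then obtain x0 where x0: "x0 \<in> S" "\<And>x. x \<in> S \<Longrightarrow> norm (T x0) \<le> norm (T x)"
      using continuous_attains_inf[OF cS False] by blast
    have "norm (T x0) > 0" using x0(1) nc by (auto simp: S_def)
    then show ?thesis using x0(2) by (intro exI[of _ "norm (T x0)"]) (auto simp: S_def)
  qed
qed

text \<open>The flow in polar coordinates \<open>z = r \<theta>\<close>, with the time scale \<open>w = r\<^sup>p\<^sup>-\<^sup>2\<close> kept as a positive factor.\<close>

locale sphere_flow =
  fixes g :: "'a::euclidean_space \<Rightarrow> real" and D :: "'a \<Rightarrow> 'a"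
    and r w a :: "real \<Rightarrow> real" and \<theta> e :: "real \<Rightarrow> 'a" and t0 p K \<delta> :: real
  assumes g: "polynomial_function g" and D: "polynomial_function D"
    and gD: "\<And>x. (g has_derivative (\<lambda>h. D x \<bullet> h)) (at x)"
    and norm_\<theta>: "\<And>t. t \<ge> t0 \<Longrightarrow> norm (\<theta> t) = 1"
    and r_pos: "\<And>t. t \<ge> t0 \<Longrightarrow> r t > 0" and w_pos: "\<And>t. t \<ge> t0 \<Longrightarrow> w t > 0"
    and d\<theta>: "\<And>t. t \<ge> t0 \<Longrightarrow> (\<theta> has_vector_derivative - (w t *\<^sub>R (tangential D (\<theta> t) + e t))) (at t)"
    and dr: "\<And>t. t \<ge> t0 \<Longrightarrow> (r has_real_derivative - (w t * r t * (p * g (\<theta> t) + a t))) (at t)"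
    and e_orth: "\<And>t. t \<ge> t0 \<Longrightarrow> e t \<bullet> \<theta> t = 0"
    and e_bound: "\<And>t. t \<ge> t0 \<Longrightarrow> norm (e t) \<le> K * r t powr \<delta>"
    and a_bound: "\<And>t. t \<ge> t0 \<Longrightarrow> \<bar>a t\<bar> \<le> K * r t powr \<delta>"
    and K_nonneg: "K \<ge> 0" and \<delta>_pos: "\<delta> > 0" and p_pos: "p > 0"
    and r_lim: "(r \<longlongrightarrow> 0) at_top"
begin

abbreviation "T \<equiv> tangential D"

lemma T_poly: "polynomial_function T"
  unfolding tangential_def[abs_def] by (intro pf_intros D)

lemma cont_g: "continuous_on S g" and cont_T: "continuous_on S T" and cont_D: "continuous_on S D"
  using g T_poly D by (auto intro: continuous_on_polymonial_function)

lemma \<eta>_lim: "((\<lambda>t. r t powr \<delta>) \<longlongrightarrow> 0) at_top"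
proof -
  have "((\<lambda>t. r t powr \<delta>) \<longlongrightarrow> 0 powr \<delta>) at_top"
  proof (intro tendsto_powr' r_lim tendsto_const)
    have "\<forall>\<^sub>F t in at_top. 0 \<le> r t"
      using eventually_ge_at_top[of t0] by eventually_elim (simp add: less_imp_le[OF r_pos])
    then show "0 \<noteq> (0::real) \<or> 0 < \<delta> \<and> (\<forall>\<^sub>F t in at_top. 0 \<le> r t)" using \<delta>_pos by simp
  qed
  then show ?thesis using \<delta>_pos by simp
qed

lemma eventually_\<eta>_small: "c > 0 \<Longrightarrow> \<forall>\<^sub>F t in at_top. K * r t powr \<delta> < c"
  using order_tendstoD(2)[OF tendsto_mult_left[OF \<eta>_lim, of K], of c] by simp

lemma eventually_e_small:
  assumes "c > 0" shows "\<forall>\<^sub>F t in at_top. norm (e t) < c"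
  using eventually_\<eta>_small[OF assms] eventually_ge_at_top[of t0]
  by eventually_elim (use e_bound in force)

lemma eventually_a_small:
  assumes "c > 0" shows "\<forall>\<^sub>F t in at_top. \<bar>a t\<bar> < c"
  using eventually_\<eta>_small[OF assms] eventually_ge_at_top[of t0]
  by eventually_elim (use a_bound in force)

lemma T_orth: "norm x = 1 \<Longrightarrow> T x \<bullet> x = 0"
  by (simp add: tangential_def inner_diff_left dot_square_norm)

lemma g_bounded: "\<exists>B>0. \<forall>x\<in>sphere 0 1. \<bar>g x\<bar> \<le> B"
proof -
  have "bounded (g ` sphere 0 1)" by (intro compact_imp_bounded compact_continuous_image compact_sphere cont_g)
  then show ?thesis by (auto simp: bounded_pos)
qed

lemma \<theta>_sphere: "t \<ge> t0 \<Longrightarrow> \<theta> t \<in> sphere 0 1"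
  by (simp add: norm_\<theta>)

text \<open>\<open>D\<close> and \<open>T\<close> differ along the trajectory by a multiple of
  \<open>\<theta>\<close>, to which both \<open>T\<close> and \<open>e\<close> are orthogonal, so
  only the tangential part contributes.\<close>

lemma dv:
  assumes t: "t \<ge> t0"
  shows "((\<lambda>t. g (\<theta> t)) has_real_derivative - (w t * ((norm (T (\<theta> t)))\<^sup>2 + T (\<theta> t) \<bullet> e t))) (at t)"
proof -
  have 1: "((\<lambda>t. g (\<theta> t)) has_derivative (\<lambda>h. D (\<theta> t) \<bullet> (h *\<^sub>R - (w t *\<^sub>R (T (\<theta> t) + e t))))) (at t)"
    using has_derivative_compose[OF d\<theta>[OF t, unfolded has_vector_derivative_def] gD] .
  have "D (\<theta> t) = T (\<theta> t) + (D (\<theta> t) \<bullet> \<theta> t) *\<^sub>R \<theta> t" by (simp add: tangential_def)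
  then have "D (\<theta> t) \<bullet> (T (\<theta> t) + e t) = (T (\<theta> t) + (D (\<theta> t) \<bullet> \<theta> t) *\<^sub>R \<theta> t) \<bullet> (T (\<theta> t) + e t)" by simp
  then have "D (\<theta> t) \<bullet> (T (\<theta> t) + e t) = (norm (T (\<theta> t)))\<^sup>2 + T (\<theta> t) \<bullet> e t"
    using T_orth[OF norm_\<theta>[OF t]] e_orth[OF t]
    by (simp add: inner_add_left inner_add_right power2_norm_eq_inner inner_commute[of "\<theta> t"])
  then have eq: "D (\<theta> t) \<bullet> (h *\<^sub>R - (w t *\<^sub>R (T (\<theta> t) + e t))) = - (w t * ((norm (T (\<theta> t)))\<^sup>2 + T (\<theta> t) \<bullet> e t)) * h" for h
    by simp
  show ?thesis unfolding has_field_derivative_def using 1 by (simp only: eq)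
qed

text \<open>Half of the dissipation survives wherever the error is at most half of the tangential
  gradient.\<close>

lemma dv_le:
  assumes t: "t \<ge> t0" and m: "norm (T (\<theta> t)) \<ge> m" "norm (e t) \<le> m / 2"
  shows "- (w t * ((norm (T (\<theta> t)))\<^sup>2 + T (\<theta> t) \<bullet> e t)) \<le> - (w t * (norm (T (\<theta> t)))\<^sup>2 / 2)"
proof -
  have "\<bar>T (\<theta> t) \<bullet> e t\<bar> \<le> norm (T (\<theta> t)) * norm (e t)" by (rule Cauchy_Schwarz_ineq2)
  also have "\<dots> \<le> norm (T (\<theta> t)) * (norm (T (\<theta> t)) / 2)"
    using m by (intro mult_left_mono) auto
  finally have "\<bar>T (\<theta> t) \<bullet> e t\<bar> \<le> (norm (T (\<theta> t)))\<^sup>2 / 2" by (simp add: power2_eq_square)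
  then have "(norm (T (\<theta> t)))\<^sup>2 / 2 \<le> (norm (T (\<theta> t)))\<^sup>2 + T (\<theta> t) \<bullet> e t" by linarith
  from mult_left_mono[OF this less_imp_le[OF w_pos[OF t]]] show ?thesis by simp
qed

text \<open>Compares \<open>g \<circ> \<theta>\<close> with \<open>ln r\<close>: while the tangential gradient is bounded below, the former would
  have to decrease at a rate proportional to the latter, which tends to \<open>-\<infinity>\<close>.\<close>

lemma tangential_not_bounded_below:
  assumes m: "m > 0" shows "\<not> (\<forall>\<^sub>F t in at_top. norm (T (\<theta> t)) \<ge> m)"
proof
  assume "\<forall>\<^sub>F t in at_top. norm (T (\<theta> t)) \<ge> m"
  moreover have "\<forall>\<^sub>F t in at_top. norm (e t) < m / 2" using m by (intro eventually_e_small) simp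
  moreover have "\<forall>\<^sub>F t in at_top. \<bar>a t\<bar> < 1" by (intro eventually_a_small) simp
  ultimately have "\<forall>\<^sub>F t in at_top. norm (T (\<theta> t)) \<ge> m \<and> norm (e t) < m / 2 \<and> \<bar>a t\<bar> < 1 \<and> t \<ge> t0"
    using eventually_ge_at_top[of t0] by eventually_elim simp
  then obtain t1 where t1: "\<And>t. t \<ge> t1 \<Longrightarrow> norm (T (\<theta> t)) \<ge> m \<and> norm (e t) < m / 2 \<and> \<bar>a t\<bar> < 1 \<and> t \<ge> t0"
    unfolding eventually_at_top_linorder by blast
  obtain B where B: "B > 0" "\<And>x. x \<in> sphere 0 1 \<Longrightarrow> \<bar>g x\<bar> \<le> B" using g_bounded by blast
  \<comment> \<open>\<open>P\<close> bounds the logarithmic decay rate of \<open>r\<close> per unit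
    of \<open>w\<close>. The constant \<open>c\<close> balances \<open>c * w * P\<close> against the
    least dissipation \<open>w * m^2 / 2\<close>, so that \<open>F\<close> cannot increase.\<close>
  define P where "P = p * B + 1"
  have P: "P > 0" using B(1) p_pos by (simp add: P_def add_pos_pos)
  define c where "c = m\<^sup>2 / (2 * P)"
  have c: "c > 0" using m P by (simp add: c_def)
  define F where "F t = g (\<theta> t) - c * ln (r t)" for t
  have F: "F t \<le> F t1" if "t \<ge> t1" for t
  proof (rule DERIV_nonpos_imp_nonincreasing[OF that])
    fix s assume s: "t1 \<le> s" "s \<le> t"
    have s0: "s \<ge> t0" using t1 s by blast
    have "((\<lambda>t. g (\<theta> t) - c * ln (r t)) has_real_derivative
       - (w s * ((norm (T (\<theta> s)))\<^sup>2 + T (\<theta> s) \<bullet> e s)) - c * (1 / r s * - (w s * r s * (p * g (\<theta> s) + a s)))) (at s)"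
      by (intro DERIV_diff dv[OF s0] DERIV_cmult DERIV_chain2[where f = ln and g = r, OF DERIV_ln_divide[OF r_pos[OF s0]]] dr[OF s0])
    moreover have "- (w s * ((norm (T (\<theta> s)))\<^sup>2 + T (\<theta> s) \<bullet> e s)) - c * (1 / r s * - (w s * r s * (p * g (\<theta> s) + a s))) \<le> 0"
    proof -
      have 1: "- (w s * ((norm (T (\<theta> s)))\<^sup>2 + T (\<theta> s) \<bullet> e s)) \<le> - (w s * (norm (T (\<theta> s)))\<^sup>2 / 2)"
        using t1[OF s(1)] by (intro dv_le[OF s0]) auto
      have "m\<^sup>2 \<le> (norm (T (\<theta> s)))\<^sup>2" using t1[OF s(1)] m by (intro power_mono) auto
      then have 2: "w s * (m\<^sup>2 / 2) \<le> w s * (norm (T (\<theta> s)))\<^sup>2 / 2" using w_pos[OF s0] by simp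
      have "p * g (\<theta> s) \<le> p * B" using B(2)[OF \<theta>_sphere[OF s0]] p_pos by (intro mult_left_mono) auto
      then have "p * g (\<theta> s) + a s \<le> P" using t1[OF s(1)] unfolding P_def by linarith
      then have "c * w s * (p * g (\<theta> s) + a s) \<le> c * w s * P" using c w_pos[OF s0] by (intro mult_left_mono) auto
      moreover have "c * w s * P = w s * (m\<^sup>2 / 2)" using P by (simp add: c_def)
      moreover have "c * (1 / r s * - (w s * r s * (p * g (\<theta> s) + a s))) = - (c * w s * (p * g (\<theta> s) + a s))"
        using r_pos[OF s0] by simp
      ultimately show ?thesis using 1 2 by linarith
    qed
    ultimately show "\<exists>y. (F has_real_derivative y) (at s) \<and> y \<le> 0" unfolding F_def by blast
  qed
  have "\<forall>\<^sub>F t in at_top. r t < exp (- ((B + F t1 + 1) / c))"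
    by (rule order_tendstoD(2)[OF r_lim]) simp
  then have "\<forall>\<^sub>F t in at_top. r t < exp (- ((B + F t1 + 1) / c)) \<and> t \<ge> t1"
    using eventually_ge_at_top[of t1] by eventually_elim simp
  \<comment> \<open>At such a time monotonicity of \<open>F\<close> pushes
    \<open>g (\<theta> t)\<close> below its lower bound \<open>- B\<close>.\<close>
  from eventually_happens'[OF _ this] obtain t where t: "r t < exp (- ((B + F t1 + 1) / c))" "t \<ge> t1" by auto
  have t0: "t \<ge> t0" using t1 t by blast
  have "ln (r t) < - ((B + F t1 + 1) / c)" using t(1) r_pos[OF t0] by (metis exp_gt_zero ln_exp ln_less_cancel_iff)
  then have "c * ln (r t) < c * (- ((B + F t1 + 1) / c))" using c by (intro mult_strict_left_mono) auto
  then have "c * ln (r t) < - (B + F t1 + 1)" using c by simp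
  moreover have "g (\<theta> t) - c * ln (r t) \<le> F t1" using F[OF t(2)] by (simp add: F_def)
  moreover have "\<bar>g (\<theta> t)\<bar> \<le> B" using B(2)[OF \<theta>_sphere[OF t0]] .
  ultimately show False by linarith
qed

text \<open>Isolation from above suffices: it is applied at a value \<open>y\<close> below which the
  trajectory keeps returning, and the barrier is placed just above \<open>y\<close>.\<close>

lemma critical_values_right_isolated:
  "\<exists>b>0. \<forall>x\<in>sphere 0 1. \<alpha> < g x \<and> g x < \<alpha> + b \<longrightarrow> T x \<noteq> 0"
proof -
  obtain b where b: "b > 0" "\<And>t x. t \<in> {0<..<b} \<Longrightarrow> x \<in> sphere 0 1 \<Longrightarrow> g x = \<alpha> + t \<Longrightarrow> T x \<noteq> 0"
    using sphere_KL[OF g D gD, of \<alpha>] by blast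
  have "T x \<noteq> 0" if "x \<in> sphere 0 1" "\<alpha> < g x" "g x < \<alpha> + b" for x
    using b(2)[of "g x - \<alpha>" x] that by auto
  then show ?thesis using b(1) by blast
qed

text \<open>An interval of regular values can only be crossed downwards.\<close>

lemma value_converges: "\<exists>L. ((\<lambda>t. g (\<theta> t)) \<longlongrightarrow> L) at_top"
proof -
  define v where "v t = g (\<theta> t)" for t
  obtain B where B: "B > 0" "\<And>x. x \<in> sphere 0 1 \<Longrightarrow> \<bar>g x\<bar> \<le> B" using g_bounded by blast
  have vB: "\<bar>v t\<bar> \<le> B" if "t \<ge> t0" for t using B(2)[OF \<theta>_sphere[OF that]] by (simp add: v_def)
  have "\<exists>L. (v \<longlongrightarrow> L) at_top"
  proof (rule tendsto_of_dichotomy)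
    show "\<forall>\<^sub>F t in at_top. \<bar>v t\<bar> \<le> B" using eventually_ge_at_top[of t0] by eventually_elim (rule vB)
    fix y c :: real assume yc: "y < c"
    have "\<forall>\<^sub>F t in at_top. v t < c" if "\<not> (\<forall>\<^sub>F t in at_top. y < v t)"
    proof -
      have fr: "\<exists>\<^sub>F t in at_top. v t \<le> y" using that by (simp add: frequently_def not_le)
      obtain b where b: "b > 0" "\<And>x. x \<in> sphere 0 1 \<Longrightarrow> y < g x \<Longrightarrow> g x < y + b \<Longrightarrow> T x \<noteq> 0"
        using critical_values_right_isolated[of y] by blast
      define h where "h = min b (c - y)"
      have h: "h > 0" "h \<le> b" "h \<le> c - y" using b yc by (auto simp: h_def)
      \<comment> \<open>The band from \<open>c1\<close> to \<open>c2\<close> lies above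
        \<open>y\<close>, below \<open>c\<close> and inside the regular interval. Being closed, it
        admits a positive lower bound for the tangential gradient by compactness.\<close>
      define c1 c2 where "c1 = y + h / 3" and "c2 = y + 2 * h / 3"
      have cc: "y < c1" "c1 < c2" "c2 < y + b" "c2 < c" using h by (auto simp: c1_def c2_def)
      have "\<exists>m>0. \<forall>x\<in>sphere 0 1. c1 \<le> g x \<and> g x \<le> c2 \<longrightarrow> m \<le> norm (T x)"
        by (intro sphere_level_lower_bound cont_g cont_T b(2)) (use cc in auto)
      then obtain m where m: "m > 0" "\<And>x. x \<in> sphere 0 1 \<Longrightarrow> c1 \<le> g x \<Longrightarrow> g x \<le> c2 \<Longrightarrow> m \<le> norm (T x)" by blast
      have "\<forall>\<^sub>F t in at_top. norm (e t) < m / 2 \<and> t \<ge> t0"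
        using m by (intro eventually_conj eventually_e_small eventually_ge_at_top) simp
      then obtain t1 where t1: "\<And>t. t \<ge> t1 \<Longrightarrow> norm (e t) < m / 2 \<and> t \<ge> t0"
        unfolding eventually_at_top_linorder by blast
      have "\<exists>\<^sub>F t in at_top. v t \<le> y \<and> t \<ge> t1"
        using frequently_eventually_frequently[OF fr eventually_ge_at_top[of t1]] .
      then obtain t where t: "v t \<le> y" "t \<ge> t1" using frequently_ex by blast
      \<comment> \<open>Decrease of \<open>v\<close> is known only while \<open>v\<close> lies in
        the band. Clamping to the band gives a function that is locally nonincreasing at every time
        and starts at the floor \<open>c1\<close>.\<close>
      define f where "f s = min c2 (max c1 (v s))" for s
      have contv: "isCont v s" if "s \<ge> t0" for s
        using DERIV_isCont[OF dv[OF that]] by (simp add: v_def[abs_def])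
      have fle: "f s \<le> f t" if ts: "t \<le> s" for s
      proof (rule nonincreasing_of_local[OF ts])
        show "continuous_on {t..s} f"
          unfolding f_def using t t1
          by (intro continuous_intros continuous_at_imp_continuous_on ballI contv) force
        fix u assume u: "t \<le> u" "u < s"
        have u0: "u \<ge> t0" "norm (e u) < m / 2" using t1[of u] u t by auto
        have vlim: "(v \<longlongrightarrow> v u) (at_right u)"
          using contv[OF u0(1)] by (simp add: isCont_def filterlim_at_split)
        consider "v u < c1" | "v u > c2" | "c1 \<le> v u" "v u \<le> c2" by linarith
        then show "\<forall>\<^sub>F s in at_right u. f s \<le> f u"
        proof cases
          case 1
          then have "\<forall>\<^sub>F s in at_right u. v s < c1" using order_tendstoD(2)[OF vlim] by blast
          then show ?thesis by eventually_elim (use 1 cc in \<open>simp add: f_def\<close>)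
        next
          case 2
          then show ?thesis using cc by (intro always_eventually) (simp add: f_def)
        next
          case 3
          have T: "m \<le> norm (T (\<theta> u))" using m(2)[OF \<theta>_sphere[OF u0(1)]] 3 by (simp add: v_def)
          have "- (w u * ((norm (T (\<theta> u)))\<^sup>2 + T (\<theta> u) \<bullet> e u)) \<le> - (w u * (norm (T (\<theta> u)))\<^sup>2 / 2)"
            using T u0 by (intro dv_le) auto
          also have "\<dots> < 0"
          proof -
            have "norm (T (\<theta> u)) > 0" using T m(1) by linarith
            then show ?thesis using w_pos[OF u0(1)] by simp
          qed
          finally obtain d where d: "d > 0" "\<And>h. h > 0 \<Longrightarrow> h < d \<Longrightarrow> v u > v (u + h)"
            using DERIV_neg_dec_right[OF dv[OF u0(1)]] unfolding v_def by blast
          have "v s < v u" if "u < s" "s < u + d" for s using d(2)[of "s - u"] that by simp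
          then show ?thesis
            unfolding eventually_at_right_field using d(1) 
            by (intro exI[of _ "u + d"]) (force simp: f_def)
        qed
      qed
      have "f t = c1" using t cc by (simp add: f_def)
      have "v s < c2" if ts: "t \<le> s" for s
      proof -
        have "f s \<le> c1" using fle[OF ts] \<open>f t = c1\<close> by simp
        then show ?thesis using cc by (auto simp: f_def min_def max_def split: if_splits)
      qed
      then have "v s < c" if "t \<le> s" for s using that cc by (meson less_trans)
      then show ?thesis unfolding eventually_at_top_linorder by blast
    qed
    then show "(\<forall>\<^sub>F t in at_top. v t < c) \<or> (\<forall>\<^sub>F t in at_top. y < v t)" by blast
  qed simp
  then show ?thesis unfolding v_def by blast
qed

text \<open>Otherwise \<open>\<bar>g x - L\<bar> + norm (T x)\<close> has a positive minimum on the
  compact sphere, and convergence of the values to \<open>L\<close> would keep the tangential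
  gradient away from \<open>0\<close>.\<close>

lemma limit_value_critical:
  assumes L: "((\<lambda>t. g (\<theta> t)) \<longlongrightarrow> L) at_top"
  shows "\<exists>x\<in>sphere 0 1. T x = 0 \<and> g x = L"
proof (rule ccontr)
  assume no: "\<not> ?thesis"
  define S :: "'a set" where "S = sphere 0 1"
  have "\<theta> t0 \<in> S" using \<theta>_sphere by (simp add: S_def)
  then have ne: "S \<noteq> {}" by blast
  have "\<exists>x0\<in>S. \<forall>x\<in>S. \<bar>g x0 - L\<bar> + norm (T x0) \<le> \<bar>g x - L\<bar> + norm (T x)"
    unfolding S_def by (intro continuous_attains_inf continuous_intros cont_g cont_T) (use ne in \<open>auto simp: S_def\<close>)
  then obtain x0 where x0: "x0 \<in> S" "\<And>x. x \<in> S \<Longrightarrow> \<bar>g x0 - L\<bar> + norm (T x0) \<le> \<bar>g x - L\<bar> + norm (T x)" by blast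
  define m where "m = \<bar>g x0 - L\<bar> + norm (T x0)"
  have "m \<noteq> 0" using no x0(1) by (auto simp: m_def S_def add_nonneg_eq_0_iff)
  then have m: "m > 0" by (simp add: m_def order_less_le)
  have "\<forall>\<^sub>F t in at_top. dist (g (\<theta> t)) L < m / 2" by (rule tendstoD[OF L]) (use m in simp)
  then have "\<forall>\<^sub>F t in at_top. norm (T (\<theta> t)) \<ge> m / 2"
    using eventually_ge_at_top[of t0]
  proof eventually_elim
    case (elim t)
    have "m \<le> \<bar>g (\<theta> t) - L\<bar> + norm (T (\<theta> t))" unfolding m_def using \<theta>_sphere[OF elim(2)] by (intro x0(2)) (simp add: S_def)
    then show ?case using elim(1) by (simp add: dist_real_def)
  qed
  then show False using tangential_not_bounded_below[of "m / 2"] m by simp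
qed

text \<open>A negative limit makes \<open>p * g (\<theta> t) + a t\<close> eventually nonpositive,
  so \<open>r\<close> is nondecreasing from then on and cannot tend to \<open>0\<close>.\<close>

lemma limit_value_nonneg:
  assumes L: "((\<lambda>t. g (\<theta> t)) \<longlongrightarrow> L) at_top"
  shows "L \<ge> 0"
proof (rule ccontr)
  assume "\<not> L \<ge> 0"
  then have neg: "L < L / 2" "L / 2 < 0" by auto
  have "\<forall>\<^sub>F t in at_top. g (\<theta> t) < L / 2" using order_tendstoD(2)[OF L neg(1)] .
  moreover have "\<forall>\<^sub>F t in at_top. \<bar>a t\<bar> < - (p * (L / 2))"
    using neg p_pos by (intro eventually_a_small) (simp add: mult_pos_neg)
  ultimately have "\<forall>\<^sub>F t in at_top. g (\<theta> t) < L / 2 \<and> \<bar>a t\<bar> < - (p * (L / 2)) \<and> t \<ge> t0"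
    using eventually_ge_at_top[of t0] by eventually_elim simp
  then obtain t1 where t1: "\<And>t. t \<ge> t1 \<Longrightarrow> g (\<theta> t) < L / 2 \<and> \<bar>a t\<bar> < - (p * (L / 2)) \<and> t \<ge> t0"
    unfolding eventually_at_top_linorder by blast
  have mono: "r t1 \<le> r t" if "t \<ge> t1" for t
  proof (rule DERIV_nonneg_imp_nondecreasing[OF that])
    fix s assume s: "t1 \<le> s" "s \<le> t"
    have s0: "s \<ge> t0" using t1 s by blast
    have "p * g (\<theta> s) < p * (L / 2)" using t1[OF s(1)] p_pos by (intro mult_strict_left_mono) auto
    then have "p * g (\<theta> s) + a s \<le> 0" using t1[OF s(1)] by linarith
    then have "- (w s * r s * (p * g (\<theta> s) + a s)) \<ge> 0"
      using w_pos[OF s0] r_pos[OF s0] by (simp add: mult_nonneg_nonpos)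
    then show "\<exists>y. (r has_real_derivative y) (at s) \<and> 0 \<le> y" using dr[OF s0] by blast
  qed
  have "r t1 > 0" using t1[of t1] r_pos by simp
  then have "\<forall>\<^sub>F t in at_top. r t < r t1 \<and> t \<ge> t1"
    by (intro eventually_conj order_tendstoD(2)[OF r_lim] eventually_ge_at_top)
  from eventually_happens'[OF _ this] obtain t where "r t < r t1" "t \<ge> t1" by auto
  then show False using mono[of t] by simp
qed

text \<open>A trajectory leaving a ball of regular points loses a fixed amount of \<open>g\<close>, and a trajectory
  staying in it is excluded by the comparison with \<open>ln r\<close>.\<close>

lemma limit_point_critical:
  assumes L: "((\<lambda>t. g (\<theta> t)) \<longlongrightarrow> L) at_top"
    and q: "\<And>\<rho> t1. \<rho> > 0 \<Longrightarrow> \<exists>t\<ge>t1. dist (\<theta> t) q < \<rho>"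
  shows "T q = 0"
proof (rule ccontr)
  assume nz: "T q \<noteq> 0"
  define m where "m = norm (T q) / 2"
  have m: "m > 0" using nz by (simp add: m_def)
  have "isCont T q" using cont_T[of UNIV] by (simp add: continuous_on_eq_continuous_at)
  then obtain R where R: "R > 0" "\<And>x. dist x q < R \<Longrightarrow> dist (T x) (T q) < m"
    using m unfolding continuous_at_eps_delta by blast
  define \<rho> where "\<rho> = R / 3"
  have \<rho>: "\<rho> > 0" using R by (simp add: \<rho>_def)
  have Tm: "m \<le> norm (T x)" if "dist x q \<le> 2 * \<rho>" for x
  proof -
    have "dist (T x) (T q) < m" using that R by (intro R(2)) (simp add: \<rho>_def)
    moreover have "norm (T q) \<le> norm (T x) + norm (T q - T x)" by (rule norm_triangle_sub)
    moreover have "norm (T q) = 2 * m" by (simp add: m_def)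
    ultimately show ?thesis by (simp add: dist_norm norm_minus_commute)
  qed
  \<comment> \<open>From some time on the values vary by at most \<open>2 * h\<close>, and the
    direction moves by at most \<open>3 / m\<close> times as much, that is
    \<open>\<rho> / 2\<close>. This is too little to get from distance \<open>\<rho>\<close> to
    distance \<open>2 * \<rho>\<close>.\<close>
  define h where "h = m * \<rho> / 12"
  have h: "h > 0" using m \<rho> by (simp add: h_def)
  have "\<forall>\<^sub>F t in at_top. dist (g (\<theta> t)) L < h" using L h by (simp add: tendsto_iff)
  moreover have "\<forall>\<^sub>F t in at_top. norm (e t) < m / 2" using m by (intro eventually_e_small) simp
  ultimately have "\<forall>\<^sub>F t in at_top. dist (g (\<theta> t)) L < h \<and> norm (e t) < m / 2 \<and> t \<ge> t0"
    using eventually_ge_at_top[of t0] by eventually_elim simp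
  then obtain t1 where t1: "\<And>t. t \<ge> t1 \<Longrightarrow> dist (g (\<theta> t)) L < h \<and> norm (e t) < m / 2 \<and> t \<ge> t0"
    unfolding eventually_at_top_linorder by blast
  obtain t where t: "t \<ge> t1" "dist (\<theta> t) q < \<rho>" using q[OF \<rho>] by blast
  have cont\<theta>: "continuous_on S \<theta>" if "\<And>s. s \<in> S \<Longrightarrow> s \<ge> t0" for S
    using has_vector_derivative_continuous[OF d\<theta>] that by (intro continuous_at_imp_continuous_on) blast
  have stay: "dist (\<theta> s) q < 2 * \<rho>" if s: "s \<ge> t" for s
  proof (rule ccontr)
    assume out: "\<not> ?thesis"
    define X where "X = {u \<in> {t..s}. dist (\<theta> u) q \<in> {2 * \<rho>..}}"
    have cd: "continuous_on {t..s} (\<lambda>u. dist (\<theta> u) q)"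
      by (intro continuous_intros cont\<theta>) (use t1 t in force)
    have "closed X" unfolding X_def
      using continuous_closed_preimage[OF cd closed_atLeastAtMost closed_atLeast, of "2 * \<rho>"]
      by (simp add: vimage_def Int_def)
    moreover have "bounded X" unfolding X_def by (rule bounded_subset[of "{t..s}"]) auto
    ultimately have "compact X" by (simp add: compact_eq_bounded_closed)
    moreover have "s \<in> X" using s out by (simp add: X_def)
    ultimately obtain u where u: "u \<in> X" "\<And>x. x \<in> X \<Longrightarrow> u \<le> x" using compact_attains_inf[of X] by blast
    have tu: "t < u" using u(1) t \<rho> by (cases "t = u") (auto simp: X_def)
    have inside: "dist (\<theta> x) q \<le> 2 * \<rho>" if "t < x" "x < u" for x
    proof (rule ccontr)
      assume "\<not> dist (\<theta> x) q \<le> 2 * \<rho>"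
      then have "x \<in> X" using that u(1) by (auto simp: X_def)
      then show False using u(2)[of x] that by simp
    qed
    \<comment> \<open>In the ball the speed is at most \<open>3 / 2 * w * N\<close>, and
      \<open>m \<le> N\<close> bounds this by \<open>3 / m\<close> times the guaranteed dissipation
      \<open>w * N^2 / 2\<close>.\<close>
    have "norm (\<theta> u - \<theta> t) \<le> (- (3 / m) * g (\<theta> u)) - (- (3 / m) * g (\<theta> t))"
    proof (rule differentiable_bound_general[OF tu, where f' = "\<lambda>x. - (w x *\<^sub>R (T (\<theta> x) + e x))"
          and \<phi>' = "\<lambda>x. - (3 / m) * - (w x * ((norm (T (\<theta> x)))\<^sup>2 + T (\<theta> x) \<bullet> e x))"])
      show "continuous_on {t..u} \<theta>" by (rule cont\<theta>) (use t1 t in force)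
      show "continuous_on {t..u} (\<lambda>x. - (3 / m) * g (\<theta> x))"
        by (intro continuous_intros continuous_on_compose2[OF cont_g[of UNIV]] cont\<theta> subset_UNIV) (use t1 t in force)
      fix x assume x: "t < x" "x < u"
      have x0: "x \<ge> t0" "norm (e x) < m / 2" using t1[of x] t x by auto
      show "(\<theta> has_vector_derivative - (w x *\<^sub>R (T (\<theta> x) + e x))) (at x)" by (rule d\<theta>[OF x0(1)])
      have "((\<lambda>x. - (3 / m) * g (\<theta> x)) has_real_derivative - (3 / m) * - (w x * ((norm (T (\<theta> x)))\<^sup>2 + T (\<theta> x) \<bullet> e x))) (at x)"
        by (intro DERIV_cmult dv x0)
      then show "((\<lambda>x. - (3 / m) * g (\<theta> x)) has_vector_derivative - (3 / m) * - (w x * ((norm (T (\<theta> x)))\<^sup>2 + T (\<theta> x) \<bullet> e x))) (at x)"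
        by (simp only: has_real_derivative_iff_has_vector_derivative)
      define N where "N = norm (T (\<theta> x))"
      have N: "m \<le> N" unfolding N_def by (intro Tm inside x)
      have "norm (T (\<theta> x) + e x) \<le> N + m / 2" unfolding N_def using norm_triangle_ineq[of "T (\<theta> x)" "e x"] x0 by linarith
      also have "\<dots> \<le> 3 / 2 * N" using N by simp
      also have "\<dots> \<le> 3 / 2 * N * (N / m)" using N m by (simp add: field_simps)
      finally have "w x * norm (T (\<theta> x) + e x) \<le> w x * (3 / 2 * N * (N / m))"
        using w_pos[OF x0(1)] by (intro mult_left_mono) auto
      also have "\<dots> = (3 / m) * (w x * N\<^sup>2 / 2)" by (simp add: power2_eq_square)
      also have "\<dots> \<le> (3 / m) * (w x * ((norm (T (\<theta> x)))\<^sup>2 + T (\<theta> x) \<bullet> e x))"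
        using dv_le[OF x0(1), of m] N x0 m unfolding N_def by (intro mult_left_mono) auto
      finally show "norm (- (w x *\<^sub>R (T (\<theta> x) + e x))) \<le> - (3 / m) * - (w x * ((norm (T (\<theta> x)))\<^sup>2 + T (\<theta> x) \<bullet> e x))"
        using w_pos[OF x0(1)] by simp
    qed
    also have "\<dots> = 3 / m * (g (\<theta> t) - g (\<theta> u))" by (simp add: algebra_simps)
    also have "\<dots> \<le> 3 / m * (2 * h)"
    proof (rule mult_left_mono)
      have "dist (g (\<theta> t)) L < h" "dist (g (\<theta> u)) L < h" using t1 t tu by auto
      then show "g (\<theta> t) - g (\<theta> u) \<le> 2 * h" by (simp add: dist_real_def)
    qed (use m in simp)
    also have "\<dots> = \<rho> / 2" using m by (simp add: h_def)
    finally have "dist (\<theta> u) (\<theta> t) \<le> \<rho> / 2" by (simp add: dist_norm)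
    moreover have "2 * \<rho> \<le> dist (\<theta> u) q" using u(1) by (simp add: X_def)
    moreover have "dist (\<theta> u) q \<le> dist (\<theta> u) (\<theta> t) + dist (\<theta> t) q" by (rule dist_triangle)
    ultimately show False using t \<rho> by linarith
  qed
  have "\<forall>\<^sub>F s in at_top. m \<le> norm (T (\<theta> s))"
    using eventually_ge_at_top[of t] by eventually_elim (use stay Tm in force)
  then show False using tangential_not_bounded_below[OF m] by blast
qed

text \<open>The limit set is a nested intersection of closures of tails. These are compact and
  connected, so the intersection is connected and lies in a single component. Compactness of the
  sphere makes the trajectory approach it.\<close>

lemma approaches_component:
  assumes L: "((\<lambda>t. g (\<theta> t)) \<longlongrightarrow> L) at_top"
  shows "\<exists>C\<in>components {x \<in> sphere 0 1. T x = 0 \<and> g x = L}. \<forall>\<rho>>0. \<forall>\<^sub>F t in at_top. \<exists>q\<in>C. dist (\<theta> t) q < \<rho>"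
proof -
  define A where "A n = closure (\<theta> ` {t0 + real n..})" for n :: nat
  define \<Omega> where "\<Omega> = (\<Inter>n. A n)"
  have cont\<theta>: "continuous_on {t0 + real n..} \<theta>" for n
    using has_vector_derivative_continuous[OF d\<theta>] by (intro continuous_at_imp_continuous_on) auto
  have As: "A n \<subseteq> sphere 0 1" for n
    unfolding A_def by (rule closure_minimal) (use \<theta>_sphere in auto)
  have Ac: "compact (A n)" for n
    using bounded_subset[OF bounded_sphere As] by (simp add: compact_eq_bounded_closed A_def)
  have Acon: "connected (A n)" for n
    unfolding A_def by (intro connected_imp_connected_closure connected_continuous_image cont\<theta>) (simp add: is_interval_connected)
  have Amono: "A n \<subseteq> A m" if "m \<le> n" for m n
    unfolding A_def using that by (intro closure_mono image_mono) auto
  have con: "connected \<Omega>"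
    unfolding \<Omega>_def by (rule connected_nest[of A, OF Ac Acon]) (use Amono in blast)
  have near: "\<exists>t\<ge>t1. dist (\<theta> t) q < \<rho>" if q: "q \<in> \<Omega>" and \<rho>: "\<rho> > 0" for q \<rho> t1
  proof -
    obtain n :: nat where n: "t1 - t0 \<le> real n" using real_arch_simple by blast
    have "q \<in> closure (\<theta> ` {t0 + real n..})" using q by (auto simp: \<Omega>_def A_def)
    then obtain t where "t \<ge> t0 + real n" "dist (\<theta> t) q < \<rho>" using \<rho> unfolding closure_approachable by auto
    then show ?thesis using n by (intro exI[of _ t]) auto
  qed
  have approach: "\<forall>\<^sub>F t in at_top. \<exists>q\<in>\<Omega>. dist (\<theta> t) q < \<rho>" if \<rho>: "\<rho> > 0" for \<rho>
  proof (rule ccontr)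
    assume "\<not> ?thesis"
    then have "\<forall>N. \<exists>t\<ge>N. \<forall>q\<in>\<Omega>. \<rho> \<le> dist (\<theta> t) q"
      unfolding eventually_at_top_linorder by (simp add: not_less)
    then have "\<forall>n::nat. \<exists>t. t \<ge> t0 + real n \<and> (\<forall>q\<in>\<Omega>. \<rho> \<le> dist (\<theta> t) q)" by blast
    then obtain s where s: "\<And>n::nat. s n \<ge> t0 + real n" "\<And>n q. q \<in> \<Omega> \<Longrightarrow> \<rho> \<le> dist (\<theta> (s n)) q"
      by metis
    have "\<theta> (s n) \<in> sphere 0 1" for n using s(1)[of n] by (intro \<theta>_sphere) simp
    then obtain x \<phi> where x: "strict_mono (\<phi> :: nat \<Rightarrow> nat)" "((\<lambda>n. \<theta> (s n)) \<circ> \<phi>) \<longlonglongrightarrow> x"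
      using seq_compactE[OF compact_imp_seq_compact[OF compact_sphere], of "\<lambda>n. \<theta> (s n)" 0 1] by blast
    note x = x(1) x(2)[unfolded o_def]
    have "x \<in> A n" for n
    proof (rule Lim_in_closed_set[OF _ _ _ x(2)])
      show "closed (A n)" by (simp add: A_def)
      show "\<forall>\<^sub>F k in sequentially. \<theta> (s (\<phi> k)) \<in> A n"
        using eventually_ge_at_top[of n]
      proof eventually_elim
        case (elim k)
        have "n \<le> \<phi> k" using elim seq_suble[OF x(1), of k] by linarith
        then have "s (\<phi> k) \<ge> t0 + real n" using s(1)[of "\<phi> k"] by (meson add_left_mono of_nat_le_iff order_trans)
        then show ?case unfolding A_def by (intro closure_subset[THEN subsetD] imageI) simp
      qed
    qed simp
    then have "x \<in> \<Omega>" by (simp add: \<Omega>_def)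
    moreover have "\<forall>\<^sub>F n in sequentially. dist (\<theta> (s (\<phi> n))) x < \<rho>" using x(2) \<rho> by (simp add: tendsto_iff)
    then obtain n where "dist (\<theta> (s (\<phi> n))) x < \<rho>" by (meson eventually_happens' sequentially_bot)
    ultimately show False using s(2)[of x "\<phi> n"] by simp
  qed
  have ne: "\<Omega> \<noteq> {}"
  proof
    assume "\<Omega> = {}"
    then have "\<forall>\<^sub>F t in at_top::real filter. False" using approach[of 1] by simp
    then show False by simp
  qed
  have sub: "\<Omega> \<subseteq> {x \<in> sphere 0 1. T x = 0 \<and> g x = L}"
  proof
    fix q assume q: "q \<in> \<Omega>"
    have 1: "q \<in> sphere 0 1" using q As[of 0] by (auto simp: \<Omega>_def)
    have 2: "T q = 0" by (rule limit_point_critical[OF L near[OF q]])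
    have "g q = L"
    proof (rule ccontr)
      assume neq: "g q \<noteq> L"
      define h where "h = dist (g q) L / 2"
      have h: "h > 0" using neq by (simp add: h_def)
      have "isCont g q" using cont_g[of UNIV] by (simp add: continuous_on_eq_continuous_at)
      then obtain R where R: "R > 0" "\<And>x. dist x q < R \<Longrightarrow> dist (g x) (g q) < h"
        using h unfolding continuous_at_eps_delta by blast
      have "\<forall>\<^sub>F t in at_top. dist (g (\<theta> t)) L < h" using L h by (simp add: tendsto_iff)
      then obtain t1 where t1: "\<And>t. t \<ge> t1 \<Longrightarrow> dist (g (\<theta> t)) L < h" unfolding eventually_at_top_linorder by blast
      obtain t where t: "t \<ge> t1" "dist (\<theta> t) q < R" using near[OF q R(1)] by blast
      have "dist (g q) L \<le> dist (g (\<theta> t)) (g q) + dist (g (\<theta> t)) L" by (metis dist_commute dist_triangle)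
      then show False using R(2)[OF t(2)] t1[OF t(1)] by (simp add: h_def)
    qed
    then show "q \<in> {x \<in> sphere 0 1. T x = 0 \<and> g x = L}" using 1 2 by simp
  qed
  obtain C where C: "C \<in> components {x \<in> sphere 0 1. T x = 0 \<and> g x = L}" "\<Omega> \<subseteq> C"
    using exists_component_superset[OF sub _ con] sub ne by blast
  show ?thesis
  proof (intro bexI[OF _ C(1)] allI impI)
    fix \<rho> :: real assume "\<rho> > 0"
    from approach[OF this] show "\<forall>\<^sub>F t in at_top. \<exists>q\<in>C. dist (\<theta> t) q < \<rho>"
      by eventually_elim (use C(2) in blast)
  qed
qed

end

text \<open>\<open>Y\<close> is nonincreasing and bounded below, so its remaining decrease tends to
  \<open>0\<close> and bounds all later displacements. The limit is found along integer times and
  then passed to all times.\<close>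

lemma converges_of_monotone_length:
  fixes \<theta> :: "real \<Rightarrow> 'a::{real_normed_vector, complete_space}"
  assumes len: "\<And>s t. t1 \<le> s \<Longrightarrow> s \<le> t \<Longrightarrow> norm (\<theta> t - \<theta> s) \<le> Y s - Y t"
    and bd: "\<And>t. t1 \<le> t \<Longrightarrow> B \<le> Y t"
  shows "\<exists>l. (\<theta> \<longlongrightarrow> l) at_top"
proof -
  define y where "y = Inf (Y ` {t1..})"
  have bb: "bdd_below (Y ` {t1..})" using bd by (auto simp: bdd_below_def)
  have yY: "y \<le> Y t" if "t1 \<le> t" for t unfolding y_def using that by (intro cInf_lower bb) auto
  have mono: "Y t \<le> Y s" if "t1 \<le> s" "s \<le> t" for s t
    using len[OF that] norm_ge_zero[of "\<theta> t - \<theta> s"] by linarith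
  have small: "\<exists>T\<ge>t1. \<forall>t\<ge>T. Y t - y < e" if e: "e > 0" for e
  proof -
    have "Inf (Y ` {t1..}) < y + e" using e by (simp add: y_def)
    then obtain T where T: "T \<ge> t1" "Y T < y + e" using cInf_lessD[of "Y ` {t1..}"] by auto
    show ?thesis
    proof (intro exI[of _ T] conjI allI impI)
      fix t assume "t \<ge> T"
      then have "Y t \<le> Y T" using mono T by blast
      then show "Y t - y < e" using T by simp
    qed (rule T(1))
  qed
  have le: "norm (\<theta> t - \<theta> s) \<le> Y s - y" if "t1 \<le> s" "s \<le> t" for s t
    using len[OF that] yY[of t] that by linarith
  have le2: "norm (\<theta> t - \<theta> s) \<le> max (Y s - y) (Y t - y)" if "t1 \<le> s" "t1 \<le> t" for s t
    using le[of s t] le[of t s] that by (cases "s \<le> t") (auto simp: norm_minus_commute)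
  have "Cauchy (\<lambda>n. \<theta> (real n))"
  proof (rule metric_CauchyI)
    fix e :: real assume "e > 0"
    from small[OF this] obtain T where T: "T \<ge> t1" "\<And>t. t \<ge> T \<Longrightarrow> Y t - y < e" by blast
    obtain M where M: "T \<le> real M" using real_arch_simple by blast
    have "dist (\<theta> (real m)) (\<theta> (real n)) < e" if mn: "m \<ge> M" "n \<ge> M" for m n
    proof -
      have "T \<le> real m" "T \<le> real n" using mn M by (auto intro: order_trans)
      then show ?thesis using le2[of "real n" "real m"] T(1) T(2)[of "real m"] T(2)[of "real n"]
        by (simp add: dist_norm)
    qed
    then show "\<exists>M. \<forall>m\<ge>M. \<forall>n\<ge>M. dist (\<theta> (real m)) (\<theta> (real n)) < e" by blast
  qed
  then obtain l where l: "(\<lambda>n. \<theta> (real n)) \<longlonglongrightarrow> l" using Cauchy_convergent_iff convergent_def by blast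
  have "(\<theta> \<longlongrightarrow> l) at_top"
  proof (rule tendstoI)
    fix e :: real assume e: "e > 0"
    from small[of "e/2"] e obtain T where T: "T \<ge> t1" "\<And>t. t \<ge> T \<Longrightarrow> Y t - y < e / 2" by auto
    have "dist (\<theta> t) l < e" if t: "t \<ge> T" for t
    proof -
      have "\<forall>\<^sub>F n in sequentially. t \<le> real n" 
        using filterlim_real_sequentially by (simp add: filterlim_at_top)
      then have "\<forall>\<^sub>F n in sequentially. norm (\<theta> (real n) - \<theta> t) \<le> Y t - y"
        by eventually_elim (use le T t in force)
      moreover have "(\<lambda>n. norm (\<theta> (real n) - \<theta> t)) \<longlonglongrightarrow> norm (l - \<theta> t)" by (intro tendsto_intros l)
      ultimately have "norm (l - \<theta> t) \<le> Y t - y" by (intro tendsto_upperbound) auto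
      then show ?thesis using T(2)[OF t] e by (simp add: dist_norm norm_minus_commute)
    qed
    then show "\<forall>\<^sub>F t in at_top. dist (\<theta> t) l < e" unfolding eventually_at_top_linorder by blast
  qed
  then show ?thesis by blast
qed

section \<open>Limit direction and decay rate\<close>

context sphere_flow
begin

lemma T_limit_zero:
  assumes l: "(\<theta> \<longlongrightarrow> l) at_top" shows "T l = 0"
proof (rule ccontr)
  assume nz: "T l \<noteq> 0"
  have "isCont T l" using cont_T[of UNIV] by (simp add: continuous_on_eq_continuous_at)
  then have "((\<lambda>t. norm (T (\<theta> t))) \<longlongrightarrow> norm (T l)) at_top" by (intro tendsto_norm isCont_tendsto_compose[OF _ l])
  then have "\<forall>\<^sub>F t in at_top. norm (T l) / 2 < norm (T (\<theta> t))" by (rule order_tendstoD(1)) (use nz in simp)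
  then have "\<forall>\<^sub>F t in at_top. norm (T l) / 2 \<le> norm (T (\<theta> t))" by eventually_elim simp
  then show False using tangential_not_bounded_below[of "norm (T l) / 2"] nz by simp
qed

lemma d\<eta>:
  assumes t: "t \<ge> t0"
  shows "((\<lambda>t. r t powr \<delta>) has_real_derivative - (\<delta> * w t * r t powr \<delta> * (p * g (\<theta> t) + a t))) (at t)"
proof -
  have d: "((\<lambda>t. r t powr \<delta>) has_real_derivative \<delta> * r t powr (\<delta> - of_nat 1) * - (w t * r t * (p * g (\<theta> t) + a t))) (at t)"
    by (rule DERIV_fun_powr[OF dr[OF t] r_pos[OF t]])
  have e1: "\<delta> * r t powr (\<delta> - of_nat 1) * - (w t * r t * (p * g (\<theta> t) + a t)) =
      - (\<delta> * w t * (r t powr (\<delta> - of_nat 1) * r t) * (p * g (\<theta> t) + a t))" by simp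
  have e2: "r t powr (\<delta> - of_nat 1) * r t = r t powr \<delta>"
    using r_pos[OF t] by (simp add: powr_diff)
  show ?thesis using d unfolding e1 e2 .
qed

text \<open>The forcing decays like \<open>\<eta> = r powr \<delta>\<close>. With \<open>v = A \<eta>\<close> for a large constant \<open>A\<close>, the pair \<open>(\<theta>, v)\<close>
  behaves like a gradient trajectory of \<open>g x + v\<^sup>2\<close>, to which the desingularizing function \<open>\<psi>\<close> applies.\<close>

lemma direction_converges:
  assumes L: "((\<lambda>t. g (\<theta> t)) \<longlongrightarrow> L) at_top" and Lpos: "L > 0"
  shows "\<exists>l. (\<theta> \<longlongrightarrow> l) at_top"
proof -
  obtain b \<psi> B where b: "b > 0" and c\<psi>: "continuous_on {0<..<b} \<psi>" and m\<psi>: "\<And>s t. 0 < s \<Longrightarrow> s \<le> t \<Longrightarrow> t < b \<Longrightarrow> \<psi> s \<le> \<psi> t"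
    and B: "\<And>t. \<bar>\<psi> t\<bar> \<le> B"
    and KL: "\<And>t. t \<in> {0<..<b} \<Longrightarrow> \<forall>\<^sub>F s in at_left t. \<forall>x\<in>sphere 0 1. \<forall>v\<in>{-1..1}. g x + v\<^sup>2 = L + t \<longrightarrow>
         t - s \<le> 2 * norm (T x, 2 * v) * (\<psi> t - \<psi> s)"
    using sphere_KL[OF g D gD, of L] by blast
  \<comment> \<open>Eventually \<open>p * g (\<theta> t) \<ge> 2 * \<kappa>\<close> and
    \<open>\<bar>a t\<bar> < \<kappa>\<close>, so \<open>\<kappa>\<close> bounds from below the
    logarithmic decay rate of \<open>r\<close> per unit of \<open>w\<close>.\<close>
  define \<kappa> where "\<kappa> = p * L / 4"
  have \<kappa>: "\<kappa> > 0" using Lpos p_pos by (simp add: \<kappa>_def)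
  \<comment> \<open>The root gives \<open>K^2 \<le> A^2 * (\<delta> * \<kappa>)\<close>, so the
    decay of \<open>(A * \<eta>)^2\<close> absorbs the cross term of the error. The added
    \<open>1\<close> ensures \<open>\<eta> \<le> A * \<eta>\<close>.\<close>
  define A where "A = 1 + sqrt (K\<^sup>2 / (\<delta> * \<kappa>))"
  have A1: "A \<ge> 1" using \<delta>_pos \<kappa> by (simp add: A_def)
  have A2: "K\<^sup>2 \<le> A\<^sup>2 * (\<delta> * \<kappa>)"
  proof -
    have "K\<^sup>2 / (\<delta> * \<kappa>) = (sqrt (K\<^sup>2 / (\<delta> * \<kappa>)))\<^sup>2" using \<delta>_pos \<kappa> by simp
    also have "\<dots> \<le> A\<^sup>2" unfolding A_def using \<delta>_pos \<kappa> by (intro power_mono) auto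
    finally show ?thesis using \<delta>_pos \<kappa> by (simp add: pos_divide_le_eq)
  qed
  define \<eta> where "\<eta> t = r t powr \<delta>" for t
  define H where "H t = g (\<theta> t) + (A * \<eta> t)\<^sup>2 - L" for t
  define N where "N t = norm (T (\<theta> t), 2 * (A * \<eta> t))" for t
  have N2: "(N t)\<^sup>2 = (norm (T (\<theta> t)))\<^sup>2 + 4 * (A\<^sup>2 * (\<eta> t)\<^sup>2)" for t
    by (simp add: N_def norm_prod_def power_mult_distrib)
  \<comment> \<open>The two entries compare the two squares that make up \<open>N^2\<close> with
    what is left of the dissipation of \<open>H\<close> after the cross term is absorbed.\<close>
  define c where "c = min (1/2) (\<delta> * \<kappa> / 4)"
  have c: "c > 0" "c \<le> 1/2" "4 * c \<le> \<delta> * \<kappa>" using \<delta>_pos \<kappa> by (auto simp: c_def min_def)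
  have \<eta>0: "(\<eta> \<longlongrightarrow> 0) at_top" unfolding \<eta>_def by (rule \<eta>_lim)
  have Hlim: "(H \<longlongrightarrow> 0) at_top"
  proof -
    have "(H \<longlongrightarrow> L + (A * 0)\<^sup>2 - L) at_top" unfolding H_def by (intro tendsto_intros L \<eta>0)
    then show ?thesis by simp
  qed
  have ev: "\<forall>\<^sub>F t in at_top. L / 2 < g (\<theta> t) \<and> \<bar>a t\<bar> < \<kappa> \<and> H t < b \<and> \<eta> t < 1 / A \<and> t \<ge> t0"
  proof (intro eventually_conj eventually_ge_at_top eventually_a_small \<kappa>)
    show "\<forall>\<^sub>F t in at_top. L / 2 < g (\<theta> t)" by (rule order_tendstoD(1)[OF L]) (use Lpos in simp)
    show "\<forall>\<^sub>F t in at_top. H t < b" by (rule order_tendstoD(2)[OF Hlim b])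
    show "\<forall>\<^sub>F t in at_top. \<eta> t < 1 / A" by (rule order_tendstoD(2)[OF \<eta>0]) (use A1 in simp)
  qed
  obtain t1 where t1: "\<And>t. t \<ge> t1 \<Longrightarrow> L / 2 < g (\<theta> t) \<and> \<bar>a t\<bar> < \<kappa> \<and> H t < b \<and> \<eta> t < 1 / A \<and> t \<ge> t0"
    using ev unfolding eventually_at_top_linorder by blast
  have \<eta>pos: "\<eta> t > 0" if "t \<ge> t1" for t using r_pos[of t] t1[OF that] by (simp add: \<eta>_def)
  \<comment> \<open>The auxiliary coordinate never vanishes, so \<open>N\<close> is positive even at
    critical directions. This makes \<open>H\<close> strictly decreasing and permits division by
    \<open>N\<close>.\<close>
  have Npos: "N t > 0" if "t \<ge> t1" for t
    using \<eta>pos[OF that] A1 by (auto simp: N_def zero_prod_def)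
  define q where "q t = p * g (\<theta> t) + a t" for t
  have q: "q t \<ge> \<kappa>" if "t \<ge> t1" for t
  proof -
    have "p * (L / 2) \<le> p * g (\<theta> t)" using t1[OF that] p_pos by (intro mult_left_mono) auto
    then have "2 * \<kappa> \<le> p * g (\<theta> t)" by (simp add: \<kappa>_def mult.commute)
    then show ?thesis using t1[OF that] unfolding q_def by linarith
  qed
  define H' where "H' t = - (w t * ((norm (T (\<theta> t)))\<^sup>2 + T (\<theta> t) \<bullet> e t)) + 2 * A\<^sup>2 * \<eta> t * - (\<delta> * w t * \<eta> t * q t)" for t
  have dH: "(H has_real_derivative H' t) (at t)" if t: "t \<ge> t1" for t
  proof -
    have t0: "t \<ge> t0" using t1[OF t] by blast
    have "((\<lambda>t. (A * \<eta> t)\<^sup>2) has_real_derivative 2 * A\<^sup>2 * \<eta> t * - (\<delta> * w t * \<eta> t * q t)) (at t)"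
      using DERIV_power[OF DERIV_cmult[OF d\<eta>[OF t0], of A], of 2]
      by (simp add: \<eta>_def q_def power2_eq_square algebra_simps)
    from DERIV_diff[OF DERIV_add[OF dv[OF t0] this] DERIV_const[of L]]
    show ?thesis by (simp add: H_def[abs_def] H'_def)
  qed
  have e\<eta>: "norm (e t) \<le> K * \<eta> t" if "t \<ge> t1" for t using e_bound t1[OF that] by (simp add: \<eta>_def)
  have H'le: "H' t \<le> - (w t * (c * (N t)\<^sup>2))" if t: "t \<ge> t1" for t
  proof -
    define n where "n = norm (T (\<theta> t))"
    have "\<bar>T (\<theta> t) \<bullet> e t\<bar> \<le> n * (K * \<eta> t)"
      unfolding n_def using Cauchy_Schwarz_ineq2[of "T (\<theta> t)" "e t"] mult_left_mono[OF e\<eta>[OF t], of "norm (T (\<theta> t))"] by simp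
    also have "\<dots> \<le> n\<^sup>2 / 2 + K\<^sup>2 * (\<eta> t)\<^sup>2 / 2"
      using sum_squares_bound[of n "K * \<eta> t"] by (simp add: power_mult_distrib)
    also have "\<dots> \<le> n\<^sup>2 / 2 + A\<^sup>2 * (\<delta> * \<kappa>) * (\<eta> t)\<^sup>2 / 2"
      using mult_right_mono[OF A2, of "(\<eta> t)\<^sup>2"] by simp
    finally have 1: "\<bar>T (\<theta> t) \<bullet> e t\<bar> \<le> n\<^sup>2 / 2 + A\<^sup>2 * (\<delta> * \<kappa>) * (\<eta> t)\<^sup>2 / 2" .
    have "A\<^sup>2 * (\<eta> t)\<^sup>2 * (\<delta> * \<kappa>) \<le> A\<^sup>2 * (\<eta> t)\<^sup>2 * (\<delta> * q t)"
      using q[OF t] \<delta>_pos by (intro mult_left_mono) auto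
    then have 2: "A\<^sup>2 * (\<delta> * \<kappa>) * (\<eta> t)\<^sup>2 \<le> A\<^sup>2 * \<delta> * q t * (\<eta> t)\<^sup>2" by (simp add: ac_simps)
    have 3: "c * n\<^sup>2 \<le> n\<^sup>2 / 2" using mult_right_mono[OF c(2), of "n\<^sup>2"] by simp
    have "4 * c * (A\<^sup>2 * (\<eta> t)\<^sup>2) \<le> \<delta> * \<kappa> * (A\<^sup>2 * (\<eta> t)\<^sup>2)" using c(3) by (intro mult_right_mono) auto
    then have 4: "c * (4 * (A\<^sup>2 * (\<eta> t)\<^sup>2)) \<le> A\<^sup>2 * (\<delta> * \<kappa>) * (\<eta> t)\<^sup>2" by (simp add: ac_simps)
    have "c * (N t)\<^sup>2 = c * n\<^sup>2 + c * (4 * (A\<^sup>2 * (\<eta> t)\<^sup>2))" by (simp add: N2 n_def distrib_left)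
    moreover have "A\<^sup>2 * (\<delta> * \<kappa>) * (\<eta> t)\<^sup>2 \<ge> 0" using \<delta>_pos \<kappa> by simp
    ultimately have "c * (N t)\<^sup>2 \<le> n\<^sup>2 + T (\<theta> t) \<bullet> e t + 2 * (A\<^sup>2 * \<delta> * q t * (\<eta> t)\<^sup>2)"
      using 1 2 3 4 by linarith
    from mult_left_mono[OF this, of "w t"] have "w t * (c * (N t)\<^sup>2) \<le> w t * (n\<^sup>2 + T (\<theta> t) \<bullet> e t + 2 * (A\<^sup>2 * \<delta> * q t * (\<eta> t)\<^sup>2))"
      using w_pos[of t] t1[OF t] by simp
    also have "\<dots> = - H' t" by (simp add: H'_def n_def power2_eq_square algebra_simps)
    finally show ?thesis by simp
  qed
  have H'neg: "H' t < 0" if "t \<ge> t1" for t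
  proof -
    have "w t * (c * (N t)\<^sup>2) > 0" using w_pos[of t] t1[OF that] Npos[OF that] c by simp
    then show ?thesis using H'le[OF that] by linarith
  qed
  have Hmono: "H t < H s" if "t1 \<le> s" "s < t" for s t
    by (rule DERIV_neg_imp_decreasing[OF that(2)]) (use dH H'neg that in \<open>meson order_trans\<close>)
  \<comment> \<open>A strictly decreasing function with limit \<open>0\<close> is positive, so
    \<open>H\<close> stays in the interval on which \<open>\<psi>\<close> is controlled.\<close>
  have Hpos: "H t > 0" if t: "t \<ge> t1" for t
  proof -
    have "\<forall>\<^sub>F s in at_top. H s \<le> H (t + 1)"
      using eventually_gt_at_top[of "t + 1"] by eventually_elim (use Hmono[of "t + 1"] t in force)
    then have "0 \<le> H (t + 1)" by (intro tendsto_upperbound[OF Hlim]) auto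
    then show ?thesis using Hmono[of t "t + 1"] t by simp
  qed
  have Hb: "H t \<in> {0<..<b}" if "t \<ge> t1" for t using Hpos[OF that] t1[OF that] by simp
  have contH: "isCont H t" if "t \<ge> t1" for t using DERIV_isCont[OF dH[OF that]] .
  have cont\<theta>: "isCont \<theta> t" if "t \<ge> t1" for t
    using has_vector_derivative_continuous[OF d\<theta>] t1[OF that] by blast
  \<comment> \<open>\<open>2 + K\<close> collects \<open>1\<close> for the gradient,
    \<open>K\<close> for the error and \<open>1\<close> for the first-order remainder of
    \<open>\<theta>\<close>. Of the factor \<open>4\<close>, one \<open>2\<close> comes from halving
    the rate of decrease of \<open>H\<close>, the other from the Kurdyka-Lojasiewicz
    estimate.\<close>
  define C where "C = 4 * (2 + K) / c"
  have local: "\<forall>\<^sub>F \<tau> in at_right t. norm (\<theta> \<tau> - \<theta> t) \<le> C * (\<psi> (H t) - \<psi> (H \<tau>))" if t: "t \<ge> t1" for t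
  proof -
    have t0: "t \<ge> t0" using t1[OF t] by blast
    have wN: "w t * N t > 0" "w t > 0" using w_pos[OF t0] Npos[OF t] by auto
    have f\<theta>: "\<forall>\<^sub>F \<tau> in at_right t. norm (\<theta> \<tau> - \<theta> t) \<le> (2 + K) * (w t * N t) * (\<tau> - t)"
    proof -
      have n1: "norm (T (\<theta> t)) \<le> N t" "\<eta> t \<le> N t"
      proof -
        show "norm (T (\<theta> t)) \<le> N t" unfolding N_def by (rule norm_fst_le)
        have "\<bar>2 * (A * \<eta> t)\<bar> \<le> N t" unfolding N_def using norm_snd_le[of "2 * (A * \<eta> t)" "T (\<theta> t)"] by simp
        moreover have "1 * \<eta> t \<le> A * \<eta> t" using A1 \<eta>pos[OF t] by (intro mult_right_mono) auto
        ultimately show "\<eta> t \<le> N t" using \<eta>pos[OF t] by linarith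
      qed
      have "norm (e t) \<le> K * N t" using e\<eta>[OF t] mult_left_mono[OF n1(2) K_nonneg] by linarith
      then have "norm (T (\<theta> t) + e t) \<le> (1 + K) * N t"
        using norm_triangle_ineq[of "T (\<theta> t)" "e t"] n1(1) by (simp add: distrib_right)
      then have nd: "norm (- (w t *\<^sub>R (T (\<theta> t) + e t))) \<le> w t * ((1 + K) * N t)"
        using wN by (simp add: mult_left_mono)
      from has_vector_derivative_at_right_bound[OF d\<theta>[OF t0] wN(1)]
      show ?thesis
        using eventually_at_right_less[of t]
      proof eventually_elim
        case (elim \<tau>)
        have "norm (\<theta> \<tau> - \<theta> t) \<le> norm (\<theta> \<tau> - \<theta> t - (\<tau> - t) *\<^sub>R - (w t *\<^sub>R (T (\<theta> t) + e t))) + norm ((\<tau> - t) *\<^sub>R - (w t *\<^sub>R (T (\<theta> t) + e t)))"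
          by (metis norm_triangle_sub norm_minus_commute add.commute)
        also have "norm ((\<tau> - t) *\<^sub>R - (w t *\<^sub>R (T (\<theta> t) + e t))) \<le> (\<tau> - t) * (w t * ((1 + K) * N t))"
          using nd elim(2) by (simp only: norm_scaleR) (simp add: mult_left_mono)
        finally show ?case using elim(1) by (simp add: algebra_simps)
      qed
    qed
    define k where "k = w t * (c * (N t)\<^sup>2)"
    have k: "k > 0" using wN c Npos[OF t] by (simp add: k_def)
    have fH: "\<forall>\<^sub>F \<tau> in at_right t. k / 2 * (\<tau> - t) \<le> H t - H \<tau>"
    proof -
      have "(H has_vector_derivative H' t) (at t)" using dH[OF t] by (simp only: has_real_derivative_iff_has_vector_derivative)
      from has_vector_derivative_at_right_bound[OF this, of "k / 2"] k
      have "\<forall>\<^sub>F \<tau> in at_right t. norm (H \<tau> - H t - (\<tau> - t) *\<^sub>R H' t) \<le> k / 2 * (\<tau> - t)" by simp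
      then show ?thesis
        using eventually_at_right_less[of t]
      proof eventually_elim
        case (elim \<tau>)
        have "(\<tau> - t) * H' t \<le> (\<tau> - t) * (- k)" using H'le[OF t] elim(2) unfolding k_def by (intro mult_left_mono) auto
        moreover have "H \<tau> - H t - (\<tau> - t) * H' t \<le> k / 2 * (\<tau> - t)"
          using elim(1) unfolding real_norm_def real_scaleR_def by linarith
        moreover have "(\<tau> - t) * (- k) = - (k * (\<tau> - t))" "k / 2 * (\<tau> - t) = k * (\<tau> - t) / 2" by simp_all
        ultimately show ?case by linarith
      qed
    qed
    \<comment> \<open>The Kurdyka-Lojasiewicz estimate holds for levels close to \<open>H t\<close>
      from below. Strict decrease of \<open>H\<close> pulls it back to times close to
      \<open>t\<close> from the right.\<close>
    have "filterlim H (at_left (H t)) (at_right t)"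
      unfolding at_within_def[of "H t"]
    proof (rule filterlim_inf[THEN iffD2], rule conjI)
      show "filterlim H (nhds (H t)) (at_right t)"
        using contH[OF t] by (simp add: isCont_def filterlim_at_split)
      have "\<forall>\<^sub>F \<tau> in at_right t. H \<tau> < H t"
        using eventually_at_right_less[of t] by eventually_elim (use Hmono t in blast)
      then show "filterlim H (principal ({..<H t} - {H t})) (at_right t)"
        by (simp add: filterlim_principal)
    qed
    then have fKL: "\<forall>\<^sub>F \<tau> in at_right t. \<forall>x\<in>sphere 0 1. \<forall>v\<in>{-1..1}. g x + v\<^sup>2 = L + H t \<longrightarrow>
         H t - H \<tau> \<le> 2 * norm (T x, 2 * v) * (\<psi> (H t) - \<psi> (H \<tau>))"
      using KL[OF Hb[OF t]] unfolding filterlim_iff by blast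
    have v1: "A * \<eta> t \<in> {-1..1}"
    proof -
      have "A * \<eta> t < 1" using t1[OF t] A1 by (simp add: field_simps)
      moreover have "A * \<eta> t > 0" using A1 \<eta>pos[OF t] by simp
      ultimately show ?thesis by simp
    qed
    show ?thesis
      using f\<theta> fH fKL
    proof eventually_elim
      case (elim \<tau>)
      have KL': "H t - H \<tau> \<le> 2 * N t * (\<psi> (H t) - \<psi> (H \<tau>))"
        using elim(3) \<theta>_sphere[OF t0] v1 unfolding N_def by (simp add: H_def)
      have "norm (\<theta> \<tau> - \<theta> t) \<le> (2 + K) * (w t * N t) * (\<tau> - t)" by (rule elim(1))
      also have "\<dots> = 2 * (2 + K) / (c * N t) * (k / 2 * (\<tau> - t))"
        using c(1) Npos[OF t] by (simp add: k_def power2_eq_square field_simps)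
      also have "\<dots> \<le> 2 * (2 + K) / (c * N t) * (2 * N t * (\<psi> (H t) - \<psi> (H \<tau>)))"
        using elim(2) KL' K_nonneg c(1) Npos[OF t] by (intro mult_left_mono) auto
      also have "\<dots> = C * (\<psi> (H t) - \<psi> (H \<tau>))"
        using c(1) Npos[OF t] by (simp add: C_def field_simps)
      finally show ?case .
    qed
  qed
  have C: "C > 0" using c K_nonneg by (simp add: C_def)
  have "norm (\<theta> t - \<theta> s) \<le> C * \<psi> (H s) - C * \<psi> (H t)" if st: "t1 \<le> s" "s \<le> t" for s t
  proof -
    \<comment> \<open>The comparison principle chains the local length bounds, since
      \<open>\<psi>\<close> need not be differentiable.\<close>
    have "norm (\<theta> t - \<theta> s) + C * \<psi> (H t) \<le> norm (\<theta> s - \<theta> s) + C * \<psi> (H s)"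
    proof (rule nonincreasing_of_local[OF st(2), where f = "\<lambda>t. norm (\<theta> t - \<theta> s) + C * \<psi> (H t)"])
      have cH: "continuous_on {s..t} H" using contH st by (intro continuous_at_imp_continuous_on) auto
      have c\<theta>: "continuous_on {s..t} \<theta>" using cont\<theta> st by (intro continuous_at_imp_continuous_on) auto
      have "H ` {s..t} \<subseteq> {0<..<b}" using Hb st by auto
      then show "continuous_on {s..t} (\<lambda>t. norm (\<theta> t - \<theta> s) + C * \<psi> (H t))"
        by (intro continuous_intros c\<theta> continuous_on_compose2[OF c\<psi> cH])
      fix u assume u: "s \<le> u" "u < t"
      have "u \<ge> t1" using u st by simp
      from local[OF this]
      show "\<forall>\<^sub>F \<tau> in at_right u. norm (\<theta> \<tau> - \<theta> s) + C * \<psi> (H \<tau>) \<le> norm (\<theta> u - \<theta> s) + C * \<psi> (H u)"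
      proof eventually_elim
        case (elim \<tau>)
        have "norm (\<theta> \<tau> - \<theta> s) \<le> norm (\<theta> \<tau> - \<theta> u) + norm (\<theta> u - \<theta> s)"
          using norm_triangle_ineq[of "\<theta> \<tau> - \<theta> u" "\<theta> u - \<theta> s"] by simp
        then show ?case using elim by (simp add: right_diff_distrib)
      qed
    qed
    then show ?thesis by simp
  qed
  moreover have "- (C * B) \<le> C * \<psi> (H t)" if "t1 \<le> t" for t
  proof -
    have "C * (- B) \<le> C * \<psi> (H t)" using B[of "H t"] C by (intro mult_left_mono) auto
    then show ?thesis by simp
  qed
  ultimately show ?thesis by (rule converges_of_monotone_length)
qed

text \<open>With \<open>w = r powr k\<close> the powers of \<open>r\<close> cancel:
  \<open>r powr - k\<close> has derivative \<open>k * (p * g (\<theta> t) + a t)\<close>, which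
  tends to \<open>k * p * L\<close>. L'Hospital's rule at infinity turns this into the mean rate of
  growth.\<close>

lemma radius_rate:
  assumes L: "((\<lambda>t. g (\<theta> t)) \<longlongrightarrow> L) at_top" and k: "k > 0" and w: "\<And>t. t \<ge> t0 \<Longrightarrow> w t = r t powr k"
  shows "((\<lambda>t. r t powr - k / t) \<longlongrightarrow> k * p * L) at_top"
proof (rule lhospital_at_top_at_top[where f' = "\<lambda>t. k * (p * g (\<theta> t) + a t)" and g' = "\<lambda>_. 1"])
  show "LIM x at_top. (x::real) :> at_top" by (rule filterlim_ident)
  show "\<forall>\<^sub>F x in at_top. (1::real) \<noteq> 0" by simp
  show "\<forall>\<^sub>F x in at_top. ((\<lambda>x. x) has_real_derivative 1) (at x)" by simp
  show "\<forall>\<^sub>F x in at_top. ((\<lambda>t. r t powr - k) has_real_derivative k * (p * g (\<theta> x) + a x)) (at x)"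
    using eventually_ge_at_top[of t0]
  proof eventually_elim
    case (elim t)
    have d: "((\<lambda>t. r t powr - k) has_real_derivative - k * r t powr (- k - of_nat 1) * - (w t * r t * (p * g (\<theta> t) + a t))) (at t)"
      by (rule DERIV_fun_powr[OF dr[OF elim] r_pos[OF elim]])
    have e1: "- k * r t powr (- k - of_nat 1) * - (w t * r t * (p * g (\<theta> t) + a t)) =
       k * (r t powr (- k - of_nat 1) * (r t powr k * r t)) * (p * g (\<theta> t) + a t)" by (simp add: w[OF elim])
    have e2: "r t powr (- k - of_nat 1) * (r t powr k * r t) = 1"
      using r_pos[OF elim] by (simp add: powr_diff powr_minus)
    show ?case using d unfolding e1 e2 by simp
  qed
  have "(a \<longlongrightarrow> 0) at_top"
    by (rule tendstoI) (use eventually_a_small in simp)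
  then have "((\<lambda>t. k * (p * g (\<theta> t) + a t) / 1) \<longlongrightarrow> k * (p * L + 0) / 1) at_top"
    by (intro tendsto_intros L) auto
  then show "((\<lambda>x. k * (p * g (\<theta> x) + a x) / 1) \<longlongrightarrow> k * p * L) at_top" by (simp add: mult.assoc)
qed

lemma radius_rate_eq:
  assumes "t \<ge> t0" "t > 0" "k > 0"
  shows "t powr (1 / k) * r t = (r t powr - k / t) powr (- 1 / k)"
proof -
  have "(r t powr - k / t) powr (- 1 / k) = (r t powr - k) powr (- 1 / k) / t powr (- 1 / k)"
    by (intro powr_divide)
  also have "(r t powr - k) powr (- 1 / k) = r t"
    using assms r_pos[of t] by (simp add: powr_powr)
  also have "t powr (- 1 / k) = inverse (t powr (1 / k))"
    using powr_minus[of t "1 / k"] by simp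
  finally show ?thesis by (simp add: field_simps)
qed

lemma radius_asymptotics_pos:
  assumes L: "((\<lambda>t. g (\<theta> t)) \<longlongrightarrow> L) at_top" and k: "k > 0" and w: "\<And>t. t \<ge> t0 \<Longrightarrow> w t = r t powr k"
    and Lpos: "L > 0"
  shows "((\<lambda>t. t powr (1 / k) * r t) \<longlongrightarrow> (k * p * L) powr (- 1 / k)) at_top"
proof -
  have "((\<lambda>t. (r t powr - k / t) powr (- 1 / k)) \<longlongrightarrow> (k * p * L) powr (- 1 / k)) at_top"
    using k p_pos Lpos by (intro tendsto_powr radius_rate[OF L k w] tendsto_const) auto
  moreover have "\<forall>\<^sub>F t in at_top. (r t powr - k / t) powr (- 1 / k) = t powr (1 / k) * r t"
    using eventually_ge_at_top[of t0] eventually_gt_at_top[of 0]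
    by eventually_elim (use radius_rate_eq k in simp)
  ultimately show ?thesis using tendsto_cong by fast
qed

text \<open>The limit \<open>0\<close> of \<open>r powr - k / t\<close> becomes divergence under the
  power \<open>- 1 / k\<close>, which reverses order on positive numbers.\<close>

lemma radius_asymptotics_zero:
  assumes L: "((\<lambda>t. g (\<theta> t)) \<longlongrightarrow> 0) at_top" and k: "k > 0" and w: "\<And>t. t \<ge> t0 \<Longrightarrow> w t = r t powr k"
  shows "filterlim (\<lambda>t. t powr (1 / k) * r t) at_top at_top"
proof -
  have "((\<lambda>t. r t powr - k / t) \<longlongrightarrow> 0) at_top" using radius_rate[OF L k w] by simp
  show ?thesis
    unfolding filterlim_at_top_gt[where c = 0]
  proof (intro allI impI)
    fix Z :: real assume Z: "Z > 0"
    have "\<forall>\<^sub>F t in at_top. r t powr - k / t < Z powr (- k)"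
      by (rule order_tendstoD(2)[OF \<open>((\<lambda>t. r t powr - k / t) \<longlongrightarrow> 0) at_top\<close>]) (use Z in simp)
    then show "\<forall>\<^sub>F t in at_top. Z \<le> t powr (1 / k) * r t"
      using eventually_ge_at_top[of t0] eventually_gt_at_top[of 0]
    proof eventually_elim
      case (elim t)
      have "(Z powr (- k)) powr (- 1 / k) \<le> (r t powr - k / t) powr (- 1 / k)"
        using elim r_pos[of t] k by (intro powr_mono2') auto
      then show ?case using radius_rate_eq[of t k] elim k Z by (simp add: powr_powr)
    qed
  qed
qed

end

section \<open>Leading part of a power series\<close>

lemma finite_mdeg: "finite {\<alpha> :: 'n::finite \<Rightarrow> nat. mdeg \<alpha> = j}"
proof (rule finite_subset)
  show "{\<alpha> :: 'n \<Rightarrow> nat. mdeg \<alpha> = j} \<subseteq> PiE UNIV (\<lambda>_. {..j})"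
    by (auto simp: mdeg_def intro: member_le_sum)
  show "finite (PiE UNIV (\<lambda>_::'n. {..j}))" by (intro finite_PiE) auto
qed

lemma monom_vec_bound: "\<bar>monom_vec \<alpha> x\<bar> \<le> norm x ^ mdeg \<alpha>"
proof -
  have "\<bar>monom_vec \<alpha> x\<bar> = (\<Prod>i\<in>UNIV. \<bar>x $ i\<bar> ^ \<alpha> i)" by (simp add: monom_vec_def abs_prod power_abs)
  also have "\<dots> \<le> (\<Prod>i\<in>UNIV. norm x ^ \<alpha> i)"
    by (intro prod_mono) (auto intro: power_mono component_le_norm_cart)
  also have "\<dots> = norm x ^ mdeg \<alpha>" by (simp add: mdeg_def power_sum)
  finally show ?thesis .
qed

text \<open>Only the size of the derivative matters, so no formula for it is recorded. The bound is
  that of a power of \<open>norm x\<close> of the same degree, and it passes through the product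
  rule.\<close>

lemma monom_vec_derivative:
  "\<exists>L. (monom_vec \<alpha> has_derivative L) (at x) \<and> (\<forall>h. \<bar>L h\<bar> \<le> real (mdeg \<alpha>) * norm x ^ (mdeg \<alpha> - 1) * norm h)"
proof -
  have "\<exists>L. ((\<lambda>x. \<Prod>i\<in>I. (x $ i) ^ \<alpha> i) has_derivative L) (at x) \<and>
     (\<forall>h. \<bar>L h\<bar> \<le> real (sum \<alpha> I) * norm x ^ (sum \<alpha> I - 1) * norm h)" if "finite I" for I
    using that
  proof (induction I rule: finite_induct)
    case empty
    show ?case by (intro exI[of _ "\<lambda>_. 0"]) simp
  next
    case (insert i I)
    then obtain L where L: "((\<lambda>x. \<Prod>i\<in>I. (x $ i) ^ \<alpha> i) has_derivative L) (at x)"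
      "\<And>h. \<bar>L h\<bar> \<le> real (sum \<alpha> I) * norm x ^ (sum \<alpha> I - 1) * norm h" by blast
    define P where "P = (\<Prod>i\<in>I. (x $ i) ^ \<alpha> i)"
    define m where "m = \<alpha> i"
    define s where "s = sum \<alpha> I"
    have "((\<lambda>x. x $ i) has_derivative (\<lambda>h. h $ i)) (at x)"
      by (rule bounded_linear_imp_has_derivative) (rule bounded_linear_vec_nth)
    from has_derivative_power[OF this, of m]
    have "((\<lambda>x. (x $ i) ^ m) has_derivative (\<lambda>h. real m * (h $ i) * (x $ i) ^ (m - 1))) (at x)" by simp
    from has_derivative_mult[OF this L(1)]
    have "((\<lambda>x. (x $ i) ^ m * (\<Prod>i\<in>I. (x $ i) ^ \<alpha> i)) has_derivative
        (\<lambda>h. (x $ i) ^ m * L h + real m * (h $ i) * (x $ i) ^ (m - 1) * P)) (at x)" by (simp add: P_def)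
    moreover have "\<bar>(x $ i) ^ m * L h + real m * (h $ i) * (x $ i) ^ (m - 1) * P\<bar> \<le> real (m + s) * norm x ^ (m + s - 1) * norm h" for h
    proof -
      have xi: "\<bar>x $ i\<bar> \<le> norm x" "\<bar>h $ i\<bar> \<le> norm h" by (rule component_le_norm_cart)+
      have "\<bar>P\<bar> = (\<Prod>i\<in>I. \<bar>x $ i\<bar> ^ \<alpha> i)" by (simp add: P_def abs_prod power_abs)
      also have "\<dots> \<le> (\<Prod>i\<in>I. norm x ^ \<alpha> i)"
        by (intro prod_mono) (auto intro: power_mono component_le_norm_cart)
      finally have P: "\<bar>P\<bar> \<le> norm x ^ s" by (simp add: power_sum s_def)
      have "\<bar>(x $ i) ^ m * L h\<bar> \<le> norm x ^ m * (real s * norm x ^ (s - 1) * norm h)"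
        unfolding abs_mult power_abs s_def using xi L(2) by (intro mult_mono power_mono) auto
      \<comment> \<open>For \<open>s = 0\<close> the truncated exponent \<open>s - 1\<close> does no
        harm because the factor \<open>real s\<close> vanishes. The same holds for \<open>m\<close>
        below.\<close>
      also have "\<dots> = real s * norm x ^ (m + s - 1) * norm h"
        by (cases s) (simp_all add: power_add)
      finally have 1: "\<bar>(x $ i) ^ m * L h\<bar> \<le> real s * norm x ^ (m + s - 1) * norm h" .
      have "\<bar>real m * (h $ i) * (x $ i) ^ (m - 1) * P\<bar> \<le> real m * norm h * norm x ^ (m - 1) * norm x ^ s"
        unfolding abs_mult power_abs using xi P by (intro mult_mono power_mono) auto
      also have "\<dots> = real m * norm x ^ (m + s - 1) * norm h"
        by (cases m) (simp_all add: power_add)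
      finally have "\<bar>real m * (h $ i) * (x $ i) ^ (m - 1) * P\<bar> \<le> real m * norm x ^ (m + s - 1) * norm h" .
      with 1 have "\<bar>(x $ i) ^ m * L h + real m * (h $ i) * (x $ i) ^ (m - 1) * P\<bar>
         \<le> real m * norm x ^ (m + s - 1) * norm h + real s * norm x ^ (m + s - 1) * norm h" by linarith
      then show ?thesis by (simp add: distrib_right)
    qed
    ultimately show ?case using insert.hyps by (auto simp: m_def s_def)
  qed
  from this[OF finite] show ?thesis by (simp add: monom_vec_def[abs_def] mdeg_def)
qed

definition coeff_norm :: "(('n::finite \<Rightarrow> nat) \<Rightarrow> real) \<Rightarrow> nat \<Rightarrow> real" where
  "coeff_norm c j = (\<Sum>\<alpha>\<in>{\<alpha>. mdeg \<alpha> = j}. \<bar>c \<alpha>\<bar>)"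

lemma coeff_norm_nonneg: "coeff_norm c j \<ge> 0"
  by (simp add: coeff_norm_def sum_nonneg)

lemma hom_part_bound: "\<bar>hom_part c j x\<bar> \<le> coeff_norm c j * norm x ^ j"
proof -
  have "\<bar>hom_part c j x\<bar> \<le> (\<Sum>\<alpha>\<in>{\<alpha>. mdeg \<alpha> = j}. \<bar>c \<alpha> * monom_vec \<alpha> x\<bar>)"
    unfolding hom_part_def by (rule sum_abs)
  also have "\<dots> \<le> (\<Sum>\<alpha>\<in>{\<alpha>. mdeg \<alpha> = j}. \<bar>c \<alpha>\<bar> * norm x ^ j)"
    using monom_vec_bound[of _ x] by (intro sum_mono) (auto simp: abs_mult intro!: mult_left_mono)
  finally show ?thesis by (simp add: coeff_norm_def sum_distrib_right)
qed

lemma hom_part_derivative: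
  "\<exists>L. (hom_part c j has_derivative L) (at x) \<and> (\<forall>h. \<bar>L h\<bar> \<le> coeff_norm c j * real j * norm x ^ (j - 1) * norm h)"
proof -
  obtain L where L: "\<And>\<alpha>. (monom_vec \<alpha> has_derivative L \<alpha>) (at x)"
    "\<And>\<alpha> h. \<bar>L \<alpha> h\<bar> \<le> real (mdeg \<alpha>) * norm x ^ (mdeg \<alpha> - 1) * norm h"
    using monom_vec_derivative[of _ x] by metis
  have "((\<lambda>x. \<Sum>\<alpha>\<in>{\<alpha>. mdeg \<alpha> = j}. c \<alpha> * monom_vec \<alpha> x) has_derivative (\<lambda>h. \<Sum>\<alpha>\<in>{\<alpha>. mdeg \<alpha> = j}. c \<alpha> * L \<alpha> h)) (at x)"
    by (intro has_derivative_sum has_derivative_mult_right L(1))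
  then have "(hom_part c j has_derivative (\<lambda>h. \<Sum>\<alpha>\<in>{\<alpha>. mdeg \<alpha> = j}. c \<alpha> * L \<alpha> h)) (at x)"
    unfolding hom_part_def[abs_def] .
  moreover have "\<bar>\<Sum>\<alpha>\<in>{\<alpha>. mdeg \<alpha> = j}. c \<alpha> * L \<alpha> h\<bar> \<le> coeff_norm c j * real j * norm x ^ (j - 1) * norm h" for h
  proof -
    have "\<bar>\<Sum>\<alpha>\<in>{\<alpha>. mdeg \<alpha> = j}. c \<alpha> * L \<alpha> h\<bar> \<le> (\<Sum>\<alpha>\<in>{\<alpha>. mdeg \<alpha> = j}. \<bar>c \<alpha> * L \<alpha> h\<bar>)" by (rule sum_abs)
    also have "\<dots> \<le> (\<Sum>\<alpha>\<in>{\<alpha>. mdeg \<alpha> = j}. \<bar>c \<alpha>\<bar> * (real j * norm x ^ (j - 1) * norm h))"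
    proof (rule sum_mono)
      fix \<alpha> :: "'a \<Rightarrow> nat" assume "\<alpha> \<in> {\<alpha>. mdeg \<alpha> = j}"
      then show "\<bar>c \<alpha> * L \<alpha> h\<bar> \<le> \<bar>c \<alpha>\<bar> * (real j * norm x ^ (j - 1) * norm h)"
        using L(2)[of \<alpha> h] by (auto simp: abs_mult intro!: mult_left_mono)
    qed
    finally show ?thesis by (simp add: coeff_norm_def sum_distrib_right mult.assoc)
  qed
  ultimately show ?thesis by blast
qed

lemma hom_part_scale: "hom_part c j (s *\<^sub>R x) = s ^ j * hom_part c j x"
proof -
  have "monom_vec \<alpha> (s *\<^sub>R x) = s ^ mdeg \<alpha> * monom_vec \<alpha> x" for \<alpha> and x :: "real^'a"
    by (simp add: monom_vec_def mdeg_def power_mult_distrib prod.distrib power_sum)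
  then show ?thesis by (simp add: hom_part_def sum_distrib_left mult.left_commute)
qed

lemma hom_part_polynomial: "real_polynomial_function (hom_part c j)"
  unfolding hom_part_def[abs_def] monom_vec_def[abs_def]
  by (intro real_polynomial_function_sum finite_mdeg real_polynomial_function.intros(4) real_polynomial_function.intros(2)
      real_polynomial_function_prod finite real_polynomial_function_power real_polynomial_function.intros(1) bounded_linear_vec_nth)

text \<open>The sets of exponents of degree below \<open>N\<close> are finite and eventually contain
  any given finite set, so the unordered sum is also the limit of the partial sums by
  degree.\<close>

lemma hom_part_sums:
  assumes "(\<lambda>\<alpha>. norm (c \<alpha> * monom_vec \<alpha> x)) summable_on UNIV"
  shows "(\<lambda>j. hom_part c j x) sums (\<Sum>\<^sub>\<infinity>\<alpha>. c \<alpha> * monom_vec \<alpha> x)"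
proof -
  define F where "F \<alpha> = c \<alpha> * monom_vec \<alpha> x" for \<alpha>
  define A where "A N = {\<alpha> :: 'a \<Rightarrow> nat. mdeg \<alpha> < N}" for N
  have AU: "A N = (\<Union>j<N. {\<alpha>. mdeg \<alpha> = j})" for N by (auto simp: A_def)
  have fA: "finite (A N)" for N unfolding AU using finite_mdeg by blast
  have "(F has_sum infsum F UNIV) UNIV"
    using abs_summable_summable[OF assms] unfolding F_def by (rule has_sum_infsum)
  then have lim: "(sum F \<longlongrightarrow> infsum F UNIV) (finite_subsets_at_top UNIV)" by (simp add: has_sum_def)
  have "filterlim A (finite_subsets_at_top UNIV) sequentially"
    unfolding filterlim_finite_subsets_at_top
  proof (intro allI impI)
    fix X :: "('a \<Rightarrow> nat) set" assume X: "finite X \<and> X \<subseteq> UNIV"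
    define M where "M = Max (insert 0 (mdeg ` X))"
    have M: "mdeg \<alpha> \<le> M" if "\<alpha> \<in> X" for \<alpha> using X that by (simp add: M_def)
    show "\<forall>\<^sub>F N in sequentially. finite (A N) \<and> X \<subseteq> A N \<and> A N \<subseteq> UNIV"
      using eventually_gt_at_top[of M]
    proof eventually_elim
      case (elim N)
      then have "X \<subseteq> A N" using M by (force simp: A_def)
      then show ?case using fA by simp
    qed
  qed
  from filterlim_compose[OF lim this] have "(\<lambda>N. sum F (A N)) \<longlonglongrightarrow> infsum F UNIV" .
  moreover have "sum F (A N) = (\<Sum>j<N. hom_part c j x)" for N
    unfolding AU F_def hom_part_def by (subst sum.UNION_disjoint) (auto simp: finite_mdeg)
  ultimately show ?thesis by (simp add: sums_def F_def[abs_def])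
qed

text \<open>At the point with all coordinates equal to \<open>s\<close>, every monomial of degree
  \<open>j\<close> takes the value \<open>s ^ j\<close>, so absolute convergence there bounds the
  coefficient sums.\<close>

lemma coeff_norm_summable:
  fixes c :: "('n::finite \<Rightarrow> nat) \<Rightarrow> real"
  assumes r0: "r0 > 0" and sm: "\<And>x :: real^'n. norm x < r0 \<Longrightarrow> (\<lambda>\<alpha>. norm (c \<alpha> * monom_vec \<alpha> x)) summable_on UNIV"
  shows "\<exists>s>0. s \<le> r0 \<and> summable (\<lambda>j. coeff_norm c j * s ^ j)"
proof -
  define n where "n = real CARD('n)"
  have n: "n \<ge> 1" unfolding n_def using one_le_card_finite by simp
  \<comment> \<open>The norm of the diagonal point is at most the sum of its coordinates, which is
    \<open>r0 / 2\<close>.\<close>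
  define s where "s = r0 / (2 * n)"
  have s: "s > 0" "s \<le> r0" using r0 n by (auto simp: s_def field_simps intro: order_trans[of _ "r0 * n"])
  define x :: "real^'n" where "x = (\<chi> i. s)"
  have "norm x \<le> (\<Sum>i\<in>UNIV. \<bar>x $ i\<bar>)" by (rule norm_le_l1_cart)
  also have "\<dots> = r0 / 2" using s n by (simp add: x_def s_def n_def)
  finally have nx: "norm x < r0" using r0 by simp
  have mx: "monom_vec \<alpha> x = s ^ mdeg \<alpha>" for \<alpha> by (simp add: monom_vec_def x_def mdeg_def power_sum)
  define F where "F \<alpha> = \<bar>c \<alpha>\<bar> * s ^ mdeg \<alpha>" for \<alpha>
  have F: "F summable_on UNIV" using sm[OF nx] s by (simp add: F_def[abs_def] mx abs_mult)
  have "summable (\<lambda>j. coeff_norm c j * s ^ j)"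
  proof (rule summableI_nonneg_bounded)
    show "0 \<le> coeff_norm c j * s ^ j" for j using s coeff_norm_nonneg[of c j] by simp
    fix N
    have "(\<Sum>j<N. coeff_norm c j * s ^ j) = (\<Sum>j<N. \<Sum>\<alpha>\<in>{\<alpha>. mdeg \<alpha> = j}. F \<alpha>)"
      by (simp add: coeff_norm_def sum_distrib_right F_def)
    also have "\<dots> = sum F (\<Union>j<N. {\<alpha>. mdeg \<alpha> = j})"
      by (subst sum.UNION_disjoint) (auto simp: finite_mdeg)
    also have "\<dots> \<le> infsum F UNIV"
      using s by (intro finite_sum_le_infsum F) (auto simp: finite_mdeg F_def)
    finally show "(\<Sum>j<N. coeff_norm c j * s ^ j) \<le> infsum F UNIV" .
  qed
  then show ?thesis using s by blast
qed

text \<open>Termwise differentiation with a majorant. Halving the radius \<open>s\<close> pays for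
  the factor \<open>j\<close> that differentiation of terms of degree \<open>j\<close> produces,
  because \<open>j \<le> 2 ^ j\<close>.\<close>

lemma analytic_tail:
  fixes c :: "('n::finite \<Rightarrow> nat) \<Rightarrow> real" and f :: "real^'n \<Rightarrow> real"
  assumes r0: "r0 > 0"
    and ser: "\<And>x. norm x < r0 \<Longrightarrow> (\<lambda>\<alpha>. norm (c \<alpha> * monom_vec \<alpha> x)) summable_on UNIV"
      "\<And>x. norm x < r0 \<Longrightarrow> f x = (\<Sum>\<^sub>\<infinity>\<alpha>. c \<alpha> * monom_vec \<alpha> x)"
    and low: "\<And>\<alpha>. mdeg \<alpha> < p \<Longrightarrow> c \<alpha> = 0"
  shows "\<exists>\<rho>>0. \<exists>K\<ge>0. \<forall>x. norm x < \<rho> \<longrightarrow> \<bar>f x - hom_part c p x\<bar> \<le> K * norm x ^ (p + 1) \<and>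
     (\<exists>v. ((\<lambda>x. f x - hom_part c p x) has_derivative (\<lambda>h. v \<bullet> h)) (at x) \<and> norm v \<le> K * norm x ^ p)"
proof -
  obtain s where s: "s > 0" "s \<le> r0" "summable (\<lambda>j. coeff_norm c j * s ^ j)"
    using coeff_norm_summable[OF r0 ser(1)] by blast
  define \<rho> where "\<rho> = s / 2"
  have \<rho>: "\<rho> > 0" "\<rho> \<le> r0" using s by (auto simp: \<rho>_def)
  define q where "q = p + 1"
  define u where "u j = hom_part c (j + q)" for j
  \<comment> \<open>With \<open>norm x ^ q\<close> or \<open>norm x ^ p\<close> split off,
    \<open>M j\<close> majorizes both the terms and their derivatives, so the single sum
    \<open>K\<close> gives both bounds.\<close>
  define M where "M j = real (j + q) * coeff_norm c (j + q) * \<rho> ^ j" for j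
  have M0: "M j \<ge> 0" for j using \<rho> coeff_norm_nonneg[of c "j + q"] by (simp add: M_def)
  have sumM: "summable M"
  proof (rule summable_comparison_test')
    show "summable (\<lambda>j. coeff_norm c (j + q) * s ^ (j + q) * (1 / \<rho> ^ q))"
      by (intro summable_mult2 summable_ignore_initial_segment[OF s(3)])
    fix j :: nat assume "j \<ge> 0"
    have "real (j + q) \<le> 2 ^ (j + q)" using of_nat_less_two_power[of "j + q", where 'a = real] by linarith
    then have "real (j + q) * \<rho> ^ (j + q) \<le> 2 ^ (j + q) * \<rho> ^ (j + q)" using \<rho> by (intro mult_right_mono) auto
    also have "\<dots> = s ^ (j + q)" by (simp add: \<rho>_def flip: power_mult_distrib)
    finally have "real (j + q) * \<rho> ^ j * \<rho> ^ q \<le> s ^ (j + q)" by (simp add: power_add mult.assoc)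
    then have "real (j + q) * \<rho> ^ j \<le> s ^ (j + q) / \<rho> ^ q" using \<rho> by (simp add: pos_le_divide_eq)
    from mult_left_mono[OF this coeff_norm_nonneg[of c "j + q"]]
    show "norm (M j) \<le> coeff_norm c (j + q) * s ^ (j + q) * (1 / \<rho> ^ q)"
      using M0[of j] by (simp add: M_def mult.commute mult.left_commute)
  qed
  have ub: "\<bar>u j x\<bar> \<le> M j * norm x ^ q" if x: "norm x < \<rho>" for j x
  proof -
    have "\<bar>u j x\<bar> \<le> coeff_norm c (j + q) * (norm x ^ j * norm x ^ q)"
      unfolding u_def using hom_part_bound[of c "j + q" x] by (simp add: power_add)
    also have "\<dots> \<le> coeff_norm c (j + q) * (\<rho> ^ j * norm x ^ q)"
      using x coeff_norm_nonneg[of c "j + q"] by (intro mult_left_mono mult_right_mono power_mono) auto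
    also have "\<dots> = 1 * (coeff_norm c (j + q) * \<rho> ^ j * norm x ^ q)" by simp
    also have "\<dots> \<le> real (j + q) * (coeff_norm c (j + q) * \<rho> ^ j * norm x ^ q)"
      using coeff_norm_nonneg[of c "j + q"] \<rho> by (intro mult_right_mono) (auto simp: q_def)
    finally show ?thesis by (simp add: M_def mult.assoc)
  qed
  define \<Phi> where "\<Phi> j x l \<longleftrightarrow> (u j has_derivative l) (at x) \<and>
    (\<forall>h. \<bar>l h\<bar> \<le> coeff_norm c (j + q) * real (j + q) * norm x ^ (j + q - 1) * norm h)" for j x l
  have "\<exists>l. \<Phi> j x l" for j x
    unfolding \<Phi>_def u_def by (rule hom_part_derivative)
  then obtain L where "\<And>j x. \<Phi> j x (L j x)" by metis
  then have L: "\<And>j x. (u j has_derivative L j x) (at x)"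
    "\<And>j x h. \<bar>L j x h\<bar> \<le> coeff_norm c (j + q) * real (j + q) * norm x ^ (j + q - 1) * norm h"
    unfolding \<Phi>_def by blast+
  have Lb: "\<bar>L j x h\<bar> \<le> M j * norm x ^ p * norm h" if x: "norm x < \<rho>" for j x h
  proof -
    have "\<bar>L j x h\<bar> \<le> coeff_norm c (j + q) * real (j + q) * (norm x ^ j * norm x ^ p) * norm h"
      using L(2)[of j x h] by (simp add: q_def power_add)
    also have "\<dots> \<le> coeff_norm c (j + q) * real (j + q) * (\<rho> ^ j * norm x ^ p) * norm h"
      using x coeff_norm_nonneg[of c "j + q"] by (intro mult_left_mono mult_right_mono power_mono) auto
    finally show ?thesis by (simp add: M_def mult.commute mult.left_commute)
  qed
  define g' where "g' x h = (\<Sum>j. L j x h)" for x h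
  have sumL: "summable (\<lambda>j. L j x h)" if x: "norm x < \<rho>" for x h
  proof (rule summable_comparison_test')
    show "summable (\<lambda>j. M j * norm x ^ p * norm h)" by (intro summable_mult2 sumM)
  qed (use Lb[OF x] in simp)
  define K where "K = suminf M"
  have K: "K \<ge> 0" unfolding K_def by (intro suminf_nonneg sumM M0)
  have g'b: "\<bar>g' x h\<bar> \<le> K * norm x ^ p * norm h" if x: "norm x < \<rho>" for x h
  proof -
    have sa: "summable (\<lambda>j. \<bar>L j x h\<bar>)"
      by (rule summable_comparison_test'[OF summable_mult2[OF summable_mult2[OF sumM, of "norm x ^ p"], of "norm h"]]) (use Lb[OF x] in simp)
    have "\<bar>g' x h\<bar> \<le> (\<Sum>j. \<bar>L j x h\<bar>)" unfolding g'_def by (rule summable_rabs[OF sa])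
    also have "\<dots> \<le> (\<Sum>j. M j * norm x ^ p * norm h)"
      by (intro suminf_le sa summable_mult2 sumM Lb[OF x])
    also have "\<dots> = K * norm x ^ p * norm h"
      using suminf_mult2[OF summable_mult2[OF sumM, of "norm x ^ p"], of "norm h"] suminf_mult2[OF sumM, of "norm x ^ p"]
      by (simp add: K_def)
    finally show ?thesis .
  qed
  have us: "(\<lambda>j. u j x) sums (f x - hom_part c p x)" if x: "norm x < \<rho>" for x
  proof -
    have xr: "norm x < r0" using x \<rho> by simp
    have "(\<lambda>j. hom_part c j x) sums f x" using hom_part_sums[OF ser(1)[OF xr]] ser(2)[OF xr] by simp
    from sums_split_initial_segment[OF this, of q]
    have "(\<lambda>j. u j x) sums (f x - (\<Sum>i<q. hom_part c i x))" by (simp add: u_def)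
    moreover have "(\<Sum>i<q. hom_part c i x) = hom_part c p x"
    proof -
      have "hom_part c i x = 0" if "i < p" for i using that low by (simp add: hom_part_def)
      then show ?thesis by (simp add: q_def)
    qed
    ultimately show ?thesis by simp
  qed
  \<comment> \<open>Uniform convergence on the ball of the derivatives in operator norm.\<close>
  have tail: "\<forall>\<^sub>F n in sequentially. \<forall>x\<in>ball 0 \<rho>. \<forall>h. norm (sum (\<lambda>i. L i x h) {..<n} - g' x h) \<le> e * norm h" if e: "e > 0" for e
  proof -
    have "(\<lambda>n. K - sum M {..<n}) \<longlonglongrightarrow> K - K"
      unfolding K_def by (intro tendsto_intros summable_LIMSEQ sumM)
    then have "\<forall>\<^sub>F n in sequentially. K - sum M {..<n} < e / (\<rho> ^ p)"
      by (rule order_tendstoD(2)) (use e \<rho> in simp)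
    then show ?thesis
    proof eventually_elim
      case (elim n)
      show ?case
      proof (intro ballI allI)
        fix x h :: "real^'n" assume "x \<in> ball 0 \<rho>"
        then have x: "norm x < \<rho>" by simp
        have sa: "summable (\<lambda>j. \<bar>L (j + n) x h\<bar>)"
          by (rule summable_comparison_test'[OF summable_mult2[OF summable_mult2[OF summable_ignore_initial_segment[OF sumM], of n "norm x ^ p"], of "norm h"]])
             (use Lb[OF x] in simp)
        have "g' x h - sum (\<lambda>i. L i x h) {..<n} = (\<Sum>j. L (j + n) x h)"
          unfolding g'_def using suminf_split_initial_segment[OF sumL[OF x], of h n] by simp
        then have "norm (sum (\<lambda>i. L i x h) {..<n} - g' x h) = \<bar>\<Sum>j. L (j + n) x h\<bar>"
          by (simp add: norm_minus_commute)
        also have "\<dots> \<le> (\<Sum>j. \<bar>L (j + n) x h\<bar>)" by (rule summable_rabs[OF sa])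
        also have "\<dots> \<le> (\<Sum>j. M (j + n) * norm x ^ p * norm h)"
          by (intro suminf_le sa summable_mult2 summable_ignore_initial_segment sumM Lb[OF x])
        also have "\<dots> = (\<Sum>j. M (j + n)) * norm x ^ p * norm h"
          using suminf_mult2[OF summable_mult2[OF summable_ignore_initial_segment[OF sumM], of n "norm x ^ p"], of "norm h"]
            suminf_mult2[OF summable_ignore_initial_segment[OF sumM], of n "norm x ^ p"] by simp
        also have "(\<Sum>j. M (j + n)) = K - sum M {..<n}"
          unfolding K_def using suminf_split_initial_segment[OF sumM, of n] by simp
        also have "(K - sum M {..<n}) * norm x ^ p * norm h \<le> (e / \<rho> ^ p) * \<rho> ^ p * norm h"
          using elim x e \<rho> by (intro mult_right_mono mult_mono power_mono) auto
        also have "\<dots> = e * norm h" using \<rho> by simp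
        finally show "norm (sum (\<lambda>i. L i x h) {..<n} - g' x h) \<le> e * norm h" .
      qed
    qed
  qed
  have "\<exists>g. \<forall>x\<in>ball 0 \<rho>. (\<lambda>n. u n x) sums g x \<and> (g has_derivative g' x) (at x within ball 0 \<rho>)"
  proof (rule has_derivative_series[OF convex_ball])
    show "(u n has_derivative L n x) (at x within ball 0 \<rho>)" for n x
      using L(1) by (rule has_derivative_at_withinI)
    show "0 \<in> ball (0 :: real^'n) \<rho>" using \<rho> by simp
    show "(\<lambda>n. u n 0) sums (f 0 - hom_part c p 0)" by (rule us) (use \<rho> in simp)
  qed (rule tail)
  then obtain g where g: "\<And>x. x \<in> ball 0 \<rho> \<Longrightarrow> (\<lambda>n. u n x) sums g x"
    "\<And>x. x \<in> ball 0 \<rho> \<Longrightarrow> (g has_derivative g' x) (at x within ball 0 \<rho>)" by blast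
  have geq: "g x = f x - hom_part c p x" if "x \<in> ball 0 \<rho>" for x
    using g(1)[OF that] us[of x] that sums_unique2 by simp
  have main: "\<bar>f x - hom_part c p x\<bar> \<le> K * norm x ^ (p + 1) \<and>
     (\<exists>v. ((\<lambda>x. f x - hom_part c p x) has_derivative (\<lambda>h. v \<bullet> h)) (at x) \<and> norm v \<le> K * norm x ^ p)"
    if x: "norm x < \<rho>" for x
  proof
    have sa: "summable (\<lambda>j. \<bar>u j x\<bar>)"
      by (rule summable_comparison_test'[OF summable_mult2[OF sumM, of "norm x ^ q"]]) (use ub[OF x] in simp)
    have "\<bar>f x - hom_part c p x\<bar> = \<bar>\<Sum>j. u j x\<bar>" using sums_unique[OF us[OF x]] by simp
    also have "\<dots> \<le> (\<Sum>j. \<bar>u j x\<bar>)" by (rule summable_rabs[OF sa])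
    also have "\<dots> \<le> (\<Sum>j. M j * norm x ^ q)" by (intro suminf_le sa summable_mult2 sumM ub[OF x])
    also have "\<dots> = K * norm x ^ q" using suminf_mult2[OF sumM, of "norm x ^ q"] by (simp add: K_def)
    finally show "\<bar>f x - hom_part c p x\<bar> \<le> K * norm x ^ (p + 1)" by (simp add: q_def)
    have xb: "x \<in> ball 0 \<rho>" using x by simp
    have "(g has_derivative g' x) (at x)" using g(2)[OF xb] at_within_open[OF xb open_ball] by simp
    then have d: "((\<lambda>x. f x - hom_part c p x) has_derivative g' x) (at x)"
      by (rule has_derivative_transform_within_open[OF _ open_ball xb geq])
    have lin: "linear (g' x)" using has_derivative_linear[OF d] .
    define v where "v = adjoint (g' x) 1"
    have gv: "g' x h = v \<bullet> h" for h
      using adjoint_works[OF lin, of h 1] by (simp add: v_def inner_commute)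
    \<comment> \<open>The bound on the derivative is tested on its own representing vector
      \<open>v\<close>.\<close>
    have "norm v * norm v \<le> (K * norm x ^ p) * norm v"
      using g'b[OF x, of v] by (simp add: gv dot_square_norm power2_eq_square)
    then have "norm v \<le> K * norm x ^ p"
      using K by (cases "norm v = 0") (auto simp: mult_le_cancel_right)
    moreover have "g' x = (\<lambda>h. v \<bullet> h)" using gv by blast
    ultimately show "\<exists>v. ((\<lambda>x. f x - hom_part c p x) has_derivative (\<lambda>h. v \<bullet> h)) (at x) \<and> norm v \<le> K * norm x ^ p"
      using d by auto
  qed
  show ?thesis using \<rho>(1) K main by blast
qed

section \<open>Homogeneous functions and the spherical distance\<close>

lemma grad_eq:
  assumes "(f has_derivative (\<lambda>h. v \<bullet> h)) (at x)"
  shows "grad f x = v"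
  unfolding grad_def
proof (rule the_equality)
  show "(f has_derivative (\<lambda>h. v \<bullet> h)) (at x)" by (rule assms)
  fix g assume "(f has_derivative (\<lambda>h. g \<bullet> h)) (at x)"
  from has_derivative_unique[OF this assms] have "g \<bullet> h = v \<bullet> h" for h by metis
  then show "g = v" using vector_eq_rdot by blast
qed

lemma homogeneous_gradient_scale:
  fixes g :: "'a::euclidean_space \<Rightarrow> real"
  assumes hom: "\<And>s x. g (s *\<^sub>R x) = s ^ p * g x" and gD: "\<And>x. (g has_derivative (\<lambda>h. D x \<bullet> h)) (at x)"
    and s: "s > 0" and p: "p > 0"
  shows "D (s *\<^sub>R x) = s ^ (p - 1) *\<^sub>R D x"
proof -
  have "((\<lambda>x. s *\<^sub>R x) has_derivative (\<lambda>h. s *\<^sub>R h)) (at x)"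
    by (rule bounded_linear_imp_has_derivative) (rule bounded_linear_scaleR_right)
  from has_derivative_compose[OF this gD]
  have 1: "((\<lambda>x. g (s *\<^sub>R x)) has_derivative (\<lambda>h. D (s *\<^sub>R x) \<bullet> (s *\<^sub>R h))) (at x)" .
  have 2: "((\<lambda>x. g (s *\<^sub>R x)) has_derivative (\<lambda>h. s ^ p * (D x \<bullet> h))) (at x)"
    unfolding hom by (rule has_derivative_mult_right[OF gD])
  have "D (s *\<^sub>R x) \<bullet> (s *\<^sub>R h) = s ^ p * (D x \<bullet> h)" for h
    using has_derivative_unique[OF 1 2] by metis
  moreover have "s ^ p = s * s ^ (p - 1)" using p by (cases p) auto
  ultimately have "D (s *\<^sub>R x) \<bullet> h = (s ^ (p - 1) *\<^sub>R D x) \<bullet> h" for h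
    using s by (simp add: mult.assoc)
  then show ?thesis using vector_eq_rdot by blast
qed

text \<open>The homogeneity relation is differentiated along the ray through \<open>x\<close>, at
  parameter \<open>1\<close>.\<close>

lemma homogeneous_euler:
  fixes g :: "'a::euclidean_space \<Rightarrow> real"
  assumes hom: "\<And>s x. g (s *\<^sub>R x) = s ^ p * g x" and gD: "\<And>x. (g has_derivative (\<lambda>h. D x \<bullet> h)) (at x)"
  shows "D x \<bullet> x = real p * g x"
proof -
  have "((\<lambda>t::real. t *\<^sub>R x) has_derivative (\<lambda>h. h *\<^sub>R x)) (at 1)"
    by (rule bounded_linear_imp_has_derivative) (rule bounded_linear_scaleR_left)
  from has_derivative_compose[OF this gD]
  have "((\<lambda>t. g (t *\<^sub>R x)) has_derivative (\<lambda>h. D x \<bullet> (h *\<^sub>R x))) (at 1)" by simp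
  then have 1: "((\<lambda>t. g (t *\<^sub>R x)) has_real_derivative D x \<bullet> x) (at 1)"
    by (simp add: has_field_derivative_def mult_commute_abs)
  have "((\<lambda>t. t ^ p * g x) has_real_derivative (real p * 1 ^ (p - 1) * 1) * g x) (at 1)"
    by (rule derivative_eq_intros refl | simp)+
  then have 2: "((\<lambda>t. g (t *\<^sub>R x)) has_real_derivative real p * g x) (at 1)" unfolding hom by simp
  show ?thesis by (rule DERIV_unique[OF 1 2])
qed

text \<open>Chord and angle are related by \<open>dist^2 = 2 * (1 - cos angle)\<close>, so closeness
  in the ambient distance becomes closeness in \<open>arccos\<close>.\<close>

lemma sphere_setdist_tendsto_0:
  fixes \<theta> :: "real \<Rightarrow> real^'n::finite"
  assumes n\<theta>: "\<And>t. t \<ge> t0 \<Longrightarrow> norm (\<theta> t) = 1" and C: "C \<subseteq> sphere 0 1"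
    and app: "\<And>\<rho>. \<rho> > 0 \<Longrightarrow> \<forall>\<^sub>F t in at_top. \<exists>q\<in>C. dist (\<theta> t) q < \<rho>"
  shows "((\<lambda>t. sphere_setdist (\<theta> t) C) \<longlongrightarrow> 0) at_top"
proof (rule tendstoI)
  fix e :: real assume e: "e > 0"
  \<comment> \<open>The cap at \<open>1\<close>, which is below \<open>pi\<close>, keeps
    \<open>e'\<close> in the range where \<open>arccos\<close> inverts \<open>cos\<close>.\<close>
  define e' where "e' = min e 1"
  have e': "0 < e'" "e' \<le> 1" "e' \<le> e" using e by (auto simp: e'_def)
  have pi: "e' < pi" using e'(2) pi_gt3 by linarith
  have ce: "cos e' < 1" using cos_monotone_0_pi[of 0 e'] e' pi by simp
  \<comment> \<open>The length of the chord that subtends the angle \<open>e'\<close>.\<close>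
  define \<rho> where "\<rho> = sqrt (2 * (1 - cos e'))"
  have \<rho>: "\<rho> > 0" "\<rho>\<^sup>2 = 2 * (1 - cos e')" using ce by (simp_all add: \<rho>_def)
  have "\<forall>\<^sub>F t in at_top. (\<exists>q\<in>C. dist (\<theta> t) q < \<rho>) \<and> t \<ge> t0"
    by (intro eventually_conj app \<rho> eventually_ge_at_top)
  then show "\<forall>\<^sub>F t in at_top. dist (sphere_setdist (\<theta> t) C) 0 < e"
  proof eventually_elim
    case (elim t)
    then obtain q where q: "q \<in> C" "dist (\<theta> t) q < \<rho>" by blast
    have nt: "norm (\<theta> t) = 1" using n\<theta> elim by blast
    have b: "\<bar>\<theta> t \<bullet> a\<bar> \<le> 1" if "a \<in> C" for a
      using Cauchy_Schwarz_ineq2[of "\<theta> t" a] nt that C by auto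
    have lb: "0 \<le> arccos (\<theta> t \<bullet> a)" if "a \<in> C" for a
      using b[OF that] by (intro arccos_lbound) auto
    have "(dist (\<theta> t) q)\<^sup>2 < \<rho>\<^sup>2" using q(2) by (intro power_strict_mono) auto
    moreover have "(dist (\<theta> t) q)\<^sup>2 = 2 - 2 * (\<theta> t \<bullet> q)"
    proof -
      have "norm q = 1" using q(1) C by auto
      then have "q \<bullet> q = 1" "\<theta> t \<bullet> \<theta> t = 1" using nt by (simp_all add: dot_square_norm)
      then show ?thesis by (simp add: dist_norm power2_norm_eq_inner inner_diff_left inner_diff_right inner_commute)
    qed
    ultimately have "cos e' < \<theta> t \<bullet> q" using \<rho>(2) by simp
    then have "arccos (\<theta> t \<bullet> q) < arccos (cos e')" using b[OF q(1)] by (intro arccos_less_arccos) auto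
    then have aq: "arccos (\<theta> t \<bullet> q) < e'" using arccos_cos[of e'] e' pi by simp
    have "sphere_setdist (\<theta> t) C \<le> arccos (\<theta> t \<bullet> q)"
      unfolding sphere_setdist_def sphere_dist_def
      by (rule cINF_lower[OF _ q(1)]) (use lb in \<open>auto simp: bdd_below_def\<close>)
    moreover have "0 \<le> sphere_setdist (\<theta> t) C"
      unfolding sphere_setdist_def sphere_dist_def using q(1) lb by (intro cINF_greatest) auto
    ultimately show ?case using aq e' by (simp add: dist_real_def)
  qed
qed

section \<open>Reduction to polar coordinates\<close>

theorem mainTheorem11:
  fixes f fp :: "real^'n \<Rightarrow> real"
    and c :: "('n \<Rightarrow> nat) \<Rightarrow> real"
    and U :: "(real^'n) set"
    and r0 :: real
    and p :: nat
    and z z' G :: "real \<Rightarrow> real^'n"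
    and \<epsilon> C :: real
  assumes U_open: "open U" and U0: "0 \<in> U"
    and f_analytic: "real_analytic_on f U"
    and r0_pos: "r0 > 0" and ball_U: "ball 0 r0 \<subseteq> U"
    and f_series: "\<forall>x\<in>ball 0 r0.
         (\<lambda>\<alpha>. norm (c \<alpha> * monom_vec \<alpha> x)) summable_on UNIV \<and>
         f x = (\<Sum>\<^sub>\<infinity>\<alpha>. c \<alpha> * monom_vec \<alpha> x)"
    and p_ge: "p \<ge> 3"
    and low_zero: "\<forall>\<alpha>. mdeg \<alpha> < p \<longrightarrow> c \<alpha> = 0"
    and fp_def: "fp = hom_part c p"
    and fp_nonzero: "fp \<noteq> (\<lambda>_. 0)"
    and z_U: "\<forall>t\<ge>0. z t \<in> U"
    and z_nonzero: "\<forall>t\<ge>0. z t \<noteq> 0"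
    and z_deriv: "\<forall>t\<ge>0. (z has_vector_derivative z' t) (at t within {0..})"
    and z'_cont: "continuous_on {0..} z'"
    and ode: "\<forall>t\<ge>0. z' t + grad f (z t) = G t"
    and G_cont: "continuous_on {0..} G"
    and eps: "0 < \<epsilon>" "\<epsilon> < 1/2"
    and G_bound: "\<forall>t\<ge>0. norm (G t) \<le> C * norm (z t) powr (real p - \<epsilon>)"
    and z_lim: "(z \<longlongrightarrow> 0) at_top"
  shows "\<exists>\<alpha>0. ((\<lambda>t. f (z t) / norm (z t) ^ p) \<longlongrightarrow> \<alpha>0) at_top
           \<and> \<alpha>0 \<in> fp ` sphere_crit fp \<and> \<alpha>0 \<ge> 0
           \<and> (\<alpha>0 > 0 \<longrightarrow>
                (\<exists>\<theta>\<in>sphere_crit fp. fp \<theta> = \<alpha>0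
                   \<and> ((\<lambda>t. z t /\<^sub>R norm (z t)) \<longlongrightarrow> \<theta>) at_top)
                \<and> ((\<lambda>t. t powr (1 / (real p - 2)) * norm (z t))
                     \<longlongrightarrow> (\<alpha>0 * real p * (real p - 2)) powr (- 1 / (real p - 2))) at_top)
           \<and> (\<alpha>0 = 0 \<longrightarrow>
                (\<exists>C0\<in>components (sphere_crit fp \<inter> {\<theta>. fp \<theta> = 0}).
                   ((\<lambda>t. sphere_setdist (z t /\<^sub>R norm (z t)) C0) \<longlongrightarrow> 0) at_top)
                \<and> filterlim (\<lambda>t. t powr (1 / (real p - 2)) * norm (z t)) at_top at_top)"
proof -
  have p0: "p > 0" using p_ge by simp
  have gpoly: "real_polynomial_function fp" unfolding fp_def by (rule hom_part_polynomial)
  obtain D where D: "polynomial_function D" and gD: "\<And>x. (fp has_derivative (\<lambda>h. D x \<bullet> h)) (at x)"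
    using real_polynomial_function_gradient[OF gpoly] by blast
  have hom: "fp (s *\<^sub>R x) = s ^ p * fp x" for s x unfolding fp_def by (rule hom_part_scale)
  obtain \<rho> K where \<rho>: "\<rho> > 0" and K: "K \<ge> 0"
    and fK: "\<And>x. norm x < \<rho> \<Longrightarrow> \<bar>f x - fp x\<bar> \<le> K * norm x ^ (p + 1)"
    and dK: "\<And>x. norm x < \<rho> \<Longrightarrow> \<exists>v. ((\<lambda>x. f x - fp x) has_derivative (\<lambda>h. v \<bullet> h)) (at x) \<and> norm v \<le> K * norm x ^ p"
  proof -
    have ser: "(\<lambda>\<alpha>. norm (c \<alpha> * monom_vec \<alpha> x)) summable_on UNIV" "f x = (\<Sum>\<^sub>\<infinity>\<alpha>. c \<alpha> * monom_vec \<alpha> x)"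
      if "norm x < r0" for x using f_series that by auto
    show ?thesis
      using analytic_tail[of r0 c f p, OF r0_pos ser] low_zero that unfolding fp_def by blast
  qed
  have gradK: "norm (grad f x - D x) \<le> K * norm x ^ p" if x: "norm x < \<rho>" for x
  proof -
    obtain v where v: "((\<lambda>x. f x - fp x) has_derivative (\<lambda>h. v \<bullet> h)) (at x)" "norm v \<le> K * norm x ^ p"
      using dK[OF x] by blast
    have "((\<lambda>x. (f x - fp x) + fp x) has_derivative (\<lambda>h. v \<bullet> h + D x \<bullet> h)) (at x)"
      by (rule has_derivative_add[OF v(1) gD])
    then have "(f has_derivative (\<lambda>h. (v + D x) \<bullet> h)) (at x)" by (simp add: inner_add_left)
    then show ?thesis using v(2) grad_eq by fastforce
  qed
  have "\<forall>\<^sub>F t in at_top. dist (z t) 0 < min \<rho> 1" by (rule tendstoD[OF z_lim]) (use \<rho> in simp)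
  then have "\<forall>\<^sub>F t in at_top. norm (z t) < \<rho> \<and> norm (z t) < 1 \<and> t > 0"
    using eventually_gt_at_top[of 0] by eventually_elim simp
  \<comment> \<open>\<open>norm (z t) < 1\<close> allows \<open>r ^ p\<close> to be bounded by
    \<open>r powr (p - \<epsilon>)\<close>, and \<open>t > 0\<close> turns derivatives within
    \<open>{0..}\<close> into two-sided ones.\<close>
  then obtain t0 where t0: "\<And>t. t \<ge> t0 \<Longrightarrow> norm (z t) < \<rho> \<and> norm (z t) < 1 \<and> t > 0"
    unfolding eventually_at_top_linorder by blast
  define r where "r t = norm (z t)" for t
  define \<theta> where "\<theta> t = z t /\<^sub>R norm (z t)" for t
  \<comment> \<open>The deviation from the gradient flow of the leading form. It unites the forcing
    \<open>G\<close> with the contribution of the higher-order terms of \<open>f\<close>.\<close>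
  define E where "E t = z' t + D (z t)" for t
  \<comment> \<open>\<open>a\<close> and \<open>e\<close> are the radial and tangential parts of
    \<open>- E\<close>, divided by the natural size \<open>r ^ (p - 1)\<close> of the leading
    gradient.\<close>
  define a where "a t = - ((E t \<bullet> \<theta> t) / r t ^ (p - 1))" for t
  define e where "e t = - ((E t - (E t \<bullet> \<theta> t) *\<^sub>R \<theta> t) /\<^sub>R r t ^ (p - 1))" for t
  define w where "w t = r t powr (real p - 2)" for t
  \<comment> \<open>An error of order \<open>p - \<epsilon>\<close> in \<open>r\<close>, divided by
    \<open>r ^ (p - 1)\<close>, has order \<open>1 - \<epsilon>\<close>.\<close>
  define \<delta> where "\<delta> = 1 - \<epsilon>"
  define K1 where "K1 = \<bar>C\<bar> + K"
  have K1: "K1 \<ge> 0" using K by (simp add: K1_def)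
  have rpos: "r t > 0" if "t \<ge> t0" for t using z_nonzero t0[OF that] by (simp add: r_def)
  have zr: "z t = r t *\<^sub>R \<theta> t" if "t \<ge> t0" for t using rpos[OF that] by (simp add: r_def \<theta>_def)
  have n\<theta>: "norm (\<theta> t) = 1" if "t \<ge> t0" for t using rpos[OF that] by (simp add: r_def \<theta>_def)
  have \<theta>\<theta>: "\<theta> t \<bullet> \<theta> t = 1" if "t \<ge> t0" for t using n\<theta>[OF that] by (simp add: dot_square_norm)
  have wr: "w t * r t = r t ^ (p - 1)" "r t ^ (p - 1) > 0" "w t > 0" if "t \<ge> t0" for t
  proof -
    have "w t * r t powr 1 = r t powr (real p - 2 + 1)" unfolding w_def by (rule powr_add[symmetric])
    also have "real p - 2 + 1 = real (p - 1)" using p_ge by (simp add: of_nat_diff)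
    finally show "w t * r t = r t ^ (p - 1)" using rpos[OF that] by (simp add: powr_realpow)
    show "r t ^ (p - 1) > 0" "w t > 0" using rpos[OF that] by (simp_all add: w_def)
  qed
  have Eb: "norm (E t) / r t ^ (p - 1) \<le> K1 * r t powr \<delta>" if t: "t \<ge> t0" for t
  proof -
    have tt: "t \<ge> 0" "norm (z t) < \<rho>" "r t \<le> 1" using t0[OF t] by (auto simp: r_def)
    have "E t = G t - (grad f (z t) - D (z t))" using ode tt(1) by (simp add: E_def algebra_simps flip: ode[rule_format])
    then have "norm (E t) \<le> norm (G t) + norm (grad f (z t) - D (z t))" by (simp add: norm_triangle_ineq4)
    also have "norm (G t) \<le> \<bar>C\<bar> * r t powr (real p - \<epsilon>)"
      using G_bound[rule_format, OF tt(1)] mult_right_mono[OF abs_ge_self[of C], of "r t powr (real p - \<epsilon>)"] by (simp add: r_def)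
    also have "norm (grad f (z t) - D (z t)) \<le> K * r t powr (real p - \<epsilon>)"
    proof -
      have "norm (grad f (z t) - D (z t)) \<le> K * r t ^ p" using gradK[OF tt(2)] by (simp add: r_def)
      also have "r t ^ p = r t powr real p" using rpos[OF t] by (simp add: powr_realpow)
      also have "K * r t powr real p \<le> K * r t powr (real p - \<epsilon>)"
        using K tt(3) rpos[OF t] eps by (intro mult_left_mono powr_mono') auto
      finally show ?thesis .
    qed
    finally have "norm (E t) \<le> K1 * r t powr (real p - \<epsilon>)" by (simp add: K1_def distrib_right)
    also have "r t powr (real p - \<epsilon>) = r t powr \<delta> * r t ^ (p - 1)"
    proof -
      have "r t ^ (p - 1) = r t powr (real p - 1)"
        using rpos[OF t] p_ge by (simp add: of_nat_diff flip: powr_realpow)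
      moreover have "real p - \<epsilon> = \<delta> + (real p - 1)" by (simp add: \<delta>_def)
      ultimately show ?thesis by (simp only: powr_add)
    qed
    finally show ?thesis using wr(2)[OF t] by (simp add: pos_divide_le_eq mult.assoc)
  qed
  have dz: "(z has_vector_derivative z' t) (at t)" if t: "t \<ge> t0" for t
  proof -
    have "t > 0" using t0[OF t] by blast
    then have "at t within {0..} = at t" by (intro at_within_interior) simp
    then show ?thesis using z_deriv \<open>t > 0\<close> by (metis less_imp_le)
  qed
  have z'eq: "z' t = E t - r t ^ (p - 1) *\<^sub>R D (\<theta> t)" if t: "t \<ge> t0" for t
    using homogeneous_gradient_scale[OF hom gD rpos[OF t] p0, of "\<theta> t"] zr[OF t] by (simp add: E_def)
  have euler: "D (\<theta> t) \<bullet> \<theta> t = real p * fp (\<theta> t)" for t by (rule homogeneous_euler[OF hom gD])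
  have dr0: "(r has_real_derivative \<theta> t \<bullet> z' t) (at t)" if t: "t \<ge> t0" for t
  proof -
    have "z t \<noteq> 0" using z_nonzero t0[OF t] by simp
    from has_derivative_compose[OF dz[OF t, unfolded has_vector_derivative_def] has_derivative_norm[OF this]]
    have "((\<lambda>t. norm (z t)) has_derivative (\<lambda>h. (h *\<^sub>R z' t) \<bullet> sgn (z t))) (at t)" .
    moreover have "(\<lambda>h. (h *\<^sub>R z' t) \<bullet> sgn (z t)) = (*) (\<theta> t \<bullet> z' t)"
      by (rule ext) (simp add: \<theta>_def sgn_div_norm inner_commute)
    ultimately show ?thesis unfolding r_def[abs_def] has_field_derivative_def by simp
  qed
  \<comment> \<open>The constant \<open>K1\<close> is doubled because the tangential part of
    \<open>E\<close> is estimated by \<open>2 * norm (E t)\<close>.\<close>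
  interpret sphere_flow fp D r w a \<theta> e t0 "real p" "2 * K1" \<delta>
  proof
    show "polynomial_function fp" using gpoly by (simp add: real_polynomial_function_eq)
    show "polynomial_function D" by (rule D)
    show "(fp has_derivative (\<lambda>h. D x \<bullet> h)) (at x)" for x by (rule gD)
    show "2 * K1 \<ge> 0" "\<delta> > 0" "real p > 0" using K1 eps p0 by (auto simp: \<delta>_def)
    show "(r \<longlongrightarrow> 0) at_top" unfolding r_def using tendsto_norm[OF z_lim] by simp
    fix t assume t: "t0 \<le> t"
    note rp = rpos[OF t] and wrt = wr[OF t]
    show "norm (\<theta> t) = 1" "r t > 0" "w t > 0" by (rule n\<theta>[OF t] rp wrt(3))+
    have E\<theta>: "\<bar>E t \<bullet> \<theta> t\<bar> \<le> norm (E t)"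
      using Cauchy_Schwarz_ineq2[of "E t" "\<theta> t"] n\<theta>[OF t] by simp
    have K2: "norm (E t) / r t ^ (p - 1) + norm (E t) / r t ^ (p - 1) \<le> 2 * K1 * r t powr \<delta>" using Eb[OF t] by simp
    have Epos: "0 \<le> norm (E t) / r t ^ (p - 1)" using wrt(2) by simp
    have "\<bar>a t\<bar> = \<bar>E t \<bullet> \<theta> t\<bar> / r t ^ (p - 1)" using wrt(2) by (simp add: a_def)
    also have "\<dots> \<le> norm (E t) / r t ^ (p - 1)" using E\<theta> wrt(2) by (intro divide_right_mono) auto
    finally show "\<bar>a t\<bar> \<le> 2 * K1 * r t powr \<delta>" using K2 Epos by linarith
    have "norm (E t - (E t \<bullet> \<theta> t) *\<^sub>R \<theta> t) \<le> norm (E t) + norm ((E t \<bullet> \<theta> t) *\<^sub>R \<theta> t)" by (rule norm_triangle_ineq4)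
    also have "\<dots> \<le> norm (E t) + norm (E t)" using E\<theta> n\<theta>[OF t] by simp
    finally have "norm (E t - (E t \<bullet> \<theta> t) *\<^sub>R \<theta> t) / r t ^ (p - 1) \<le> (norm (E t) + norm (E t)) / r t ^ (p - 1)"
      using wrt(2) by (intro divide_right_mono) auto
    moreover have "norm (e t) = norm (E t - (E t \<bullet> \<theta> t) *\<^sub>R \<theta> t) / r t ^ (p - 1)"
      using wrt(2) by (simp add: e_def divide_inverse_commute)
    ultimately show "norm (e t) \<le> 2 * K1 * r t powr \<delta>" using K2 by (simp add: add_divide_distrib)
    show "e t \<bullet> \<theta> t = 0" using \<theta>\<theta>[OF t] by (simp add: e_def inner_diff_left)
    have \<theta>z': "\<theta> t \<bullet> z' t = E t \<bullet> \<theta> t - r t ^ (p - 1) * (real p * fp (\<theta> t))"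
      using euler[of t] by (simp add: z'eq[OF t] inner_diff_right inner_commute)
    also have "\<dots> = - (w t * r t * (real p * fp (\<theta> t) + a t))"
    proof -
      have "r t ^ (p - 1) \<noteq> 0" using wrt(2) by linarith
      then have "r t ^ (p - 1) * ((E t \<bullet> \<theta> t) / r t ^ (p - 1)) = E t \<bullet> \<theta> t" by simp
      then show ?thesis unfolding wrt(1) a_def by (simp only: distrib_left mult_minus_right minus_add_distrib minus_minus)
    qed
    finally have \<theta>z'': "\<theta> t \<bullet> z' t = - (w t * r t * (real p * fp (\<theta> t) + a t))" .
    show "(r has_real_derivative - (w t * r t * (real p * fp (\<theta> t) + a t))) (at t)"
      using dr0[OF t] unfolding \<theta>z'' .
    have "((\<lambda>t. inverse (r t)) has_real_derivative - (inverse (r t) * (\<theta> t \<bullet> z' t) * inverse (r t))) (at t)"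
      by (rule DERIV_inverse'[OF dr0[OF t]]) (use rp in simp)
    from has_vector_derivative_scaleR[OF this dz[OF t]]
    have "(\<theta> has_vector_derivative inverse (r t) *\<^sub>R z' t + - (inverse (r t) * (\<theta> t \<bullet> z' t) * inverse (r t)) *\<^sub>R z t) (at t)"
      by (simp add: \<theta>_def[abs_def] r_def[abs_def])
    moreover have "inverse (r t) *\<^sub>R z' t + - (inverse (r t) * (\<theta> t \<bullet> z' t) * inverse (r t)) *\<^sub>R z t
        = inverse (r t) *\<^sub>R (z' t - (\<theta> t \<bullet> z' t) *\<^sub>R \<theta> t)"
      using rp by (simp add: zr[OF t] scaleR_diff_right)
    moreover have "z' t - (\<theta> t \<bullet> z' t) *\<^sub>R \<theta> t = - (r t ^ (p - 1) *\<^sub>R (tangential D (\<theta> t) + e t))"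
    proof -
      have "r t ^ (p - 1) *\<^sub>R e t = - (E t - (E t \<bullet> \<theta> t) *\<^sub>R \<theta> t)" using wrt(2) rp by (simp add: e_def)
      moreover have "z' t - (\<theta> t \<bullet> z' t) *\<^sub>R \<theta> t =
          (E t - (E t \<bullet> \<theta> t) *\<^sub>R \<theta> t) - r t ^ (p - 1) *\<^sub>R tangential D (\<theta> t)"
        unfolding \<theta>z' by (simp add: z'eq[OF t] tangential_def euler algebra_simps)
      ultimately show ?thesis by (simp add: scaleR_add_right)
    qed
    moreover have "inverse (r t) *\<^sub>R - (r t ^ (p - 1) *\<^sub>R (tangential D (\<theta> t) + e t)) = - (w t *\<^sub>R (tangential D (\<theta> t) + e t))"
    proof -
      have "inverse (r t) * r t ^ (p - 1) = w t" using rp by (simp only: wrt(1)[symmetric]) simp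
      then show ?thesis by (simp only: scaleR_minus_right scaleR_scaleR)
    qed
    ultimately show "(\<theta> has_vector_derivative - (w t *\<^sub>R (tangential D (\<theta> t) + e t))) (at t)" by (simp only:)
  qed
  have crit: "sphere_crit fp = {x \<in> sphere 0 1. tangential D x = 0}"
    using grad_eq[OF gD] by (simp add: sphere_crit_def sphere_grad_def tangential_def)
  obtain L where L: "((\<lambda>t. fp (\<theta> t)) \<longlongrightarrow> L) at_top" using value_converges by blast
  have k: "real p - 2 > 0" using p_ge by simp
  have wk: "w t = r t powr (real p - 2)" for t by (simp add: w_def)
  \<comment> \<open>By homogeneity \<open>fp (z t) / r t ^ p = fp (\<theta> t)\<close>, and the
    higher-order terms contribute at most \<open>K * r t\<close>.\<close>
  have 1: "((\<lambda>t. f (z t) / norm (z t) ^ p) \<longlongrightarrow> L) at_top"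
  proof -
    have "((\<lambda>t. f (z t) / norm (z t) ^ p - fp (\<theta> t)) \<longlongrightarrow> 0) at_top"
    proof (rule Lim_null_comparison)
      have "((\<lambda>t. K * r t) \<longlongrightarrow> K * 0) at_top" by (intro tendsto_intros r_lim)
      then show "((\<lambda>t. K * r t) \<longlongrightarrow> 0) at_top" by simp
      show "\<forall>\<^sub>F t in at_top. norm (f (z t) / norm (z t) ^ p - fp (\<theta> t)) \<le> K * r t"
        using eventually_ge_at_top[of t0]
      proof eventually_elim
        case (elim t)
        have rp: "r t ^ p > 0" using rpos[OF elim] by simp
        have "fp (z t) = r t ^ p * fp (\<theta> t)" using zr[OF elim] hom by metis
        then have "f (z t) / r t ^ p - fp (\<theta> t) = (f (z t) - fp (z t)) / r t ^ p"
          using rpos[OF elim] by (simp add: diff_divide_distrib)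
        moreover have "\<bar>f (z t) - fp (z t)\<bar> / r t ^ p \<le> (K * r t ^ (p + 1)) / r t ^ p"
          using fK[of "z t"] t0[OF elim] rp by (intro divide_right_mono) (auto simp: r_def)
        ultimately show ?case
          using rpos[OF elim] by (simp add: r_def[symmetric] abs_divide power_abs)
      qed
    qed
    from tendsto_add[OF this L] show ?thesis by simp
  qed
  have 2: "L \<in> fp ` sphere_crit fp" using limit_value_critical[OF L] unfolding crit by blast
  have 3: "L \<ge> 0" by (rule limit_value_nonneg[OF L])
  have 4: "\<exists>\<theta>\<in>sphere_crit fp. fp \<theta> = L \<and> ((\<lambda>t. z t /\<^sub>R norm (z t)) \<longlongrightarrow> \<theta>) at_top" if Lpos: "L > 0"
  proof -
    obtain l where l: "(\<theta> \<longlongrightarrow> l) at_top" using direction_converges[OF L Lpos] by blast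
    have "((\<lambda>t. fp (\<theta> t)) \<longlongrightarrow> fp l) at_top"
      using cont_g[of UNIV] by (intro isCont_tendsto_compose[OF _ l]) (simp add: continuous_on_eq_continuous_at)
    then have "fp l = L" using L tendsto_unique[OF trivial_limit_at_top_linorder] by blast
    moreover have "((\<lambda>t. norm (\<theta> t)) \<longlongrightarrow> norm l) at_top" by (intro tendsto_norm l)
    moreover have "((\<lambda>t. norm (\<theta> t)) \<longlongrightarrow> 1) at_top"
      by (rule tendsto_eventually) (use eventually_ge_at_top[of t0] in eventually_elim, rule n\<theta>)
    ultimately show ?thesis
      using T_limit_zero[OF l] l tendsto_unique[OF trivial_limit_at_top_linorder] unfolding crit \<theta>_def[abs_def] by auto
  qed
  have 5: "((\<lambda>t. t powr (1 / (real p - 2)) * norm (z t)) \<longlongrightarrow> (L * real p * (real p - 2)) powr (- 1 / (real p - 2))) at_top" if "L > 0"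
    using radius_asymptotics_pos[OF L k wk that] by (simp add: r_def ac_simps)
  have 6: "\<exists>C0\<in>components (sphere_crit fp \<inter> {\<theta>. fp \<theta> = 0}).
       ((\<lambda>t. sphere_setdist (z t /\<^sub>R norm (z t)) C0) \<longlongrightarrow> 0) at_top" if "L = 0"
  proof -
    have eq: "{x \<in> sphere 0 1. tangential D x = 0 \<and> fp x = L} = sphere_crit fp \<inter> {\<theta>. fp \<theta> = 0}"
      unfolding crit that by blast
    obtain C0 where C0: "C0 \<in> components (sphere_crit fp \<inter> {\<theta>. fp \<theta> = 0})"
      "\<And>\<rho>. \<rho> > 0 \<Longrightarrow> \<forall>\<^sub>F t in at_top. \<exists>q\<in>C0. dist (\<theta> t) q < \<rho>"
      using approaches_component[OF L] unfolding eq by blast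
    have "C0 \<subseteq> sphere 0 1" using in_components_subset[OF C0(1)] unfolding crit by blast
    from sphere_setdist_tendsto_0[OF n\<theta> this C0(2)] C0(1) show ?thesis unfolding \<theta>_def by blast
  qed
  have 7: "filterlim (\<lambda>t. t powr (1 / (real p - 2)) * norm (z t)) at_top at_top" if "L = 0"
    using radius_asymptotics_zero[OF L[unfolded that] k wk] by (simp add: r_def)
  show ?thesis
    by (intro exI[of _ L] conjI impI) (use 1 2 3 4 5 6 7 in blast)+
qed

end
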